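(* Let $z:[0,t_f]\to\mathbb R^2$ be any solution to Problem (P), i.e. a curve minimizing the essential maximum of the curvature $\|\ddot z(t)\|$ among all unit-speed planar curves of fixed length $t_f$ with $z(0)=z_0$, $z(t_f)=z_f$, $\dot z(0)=v_0$, $\dot z(t_f)=v_f$. Then $z$ is either of type $CXC$ or a sub-path thereof, where $X$ can be $S$, $C$ or $O$; or of type $SOS$ or a sub-path thereof. Moreover, the radii of all the $C$ and $O$ arcs in the solution are the same.
   Context: Problem (P): given $z_0,z_f\in\mathbb R^2$, $v_0,v_f\in\mathbb R^2$ with $\|v_0\|=\|v_f\|=1$, and $t_f>0$, minimize $\operatorname{ess\,max}_{t\in[0,t_f]}\|\ddot z(t)\|$ over curves $z\in W^{2,\infty}((0,t_f),\mathbb R^2)$ with $z(0)=z_0$, $z(t_f)=z_f$, $\dot z(0)=v_0$, $\dot z(t_f)=v_f$ and $\|\dot z(t)\|=1$ for a.e. $t\in[0,t_f]$ (Euclidean norm). Standing assumption: $t_f>\|z_0-z_f\|$. Types of paths: $S$ denotes a straight line segment; $C$ denotes a circular arc which is not closed (total turning angle strictly between $0$ and $2\pi$); $O$ denotes a full circle covered exactly once. A word in these letters denotes the type of a $C^1$ concatenation of such pieces, traversed in the given order, each piece having positive length; two consecutive $C$'s in a word have opposite orientations (one turning left, one turning right). A sub-path of a path is its restriction to a subinterval of its parameter interval. *)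

theory Defs
  imports "HOL-Probability.Essential_Supremum"
begin

type_synonym plane = "real ^ 2"

subsection \<open>Curves of class $W^{2,\infty}$\<close>

definition Linf_on :: "real set \<Rightarrow> (real \<Rightarrow> plane) \<Rightarrow> bool" where
  "Linf_on I f \<longleftrightarrow>
     f \<in> borel_measurable (lebesgue_on I) \<and> (\<exists>M. AE t in lebesgue_on I. norm (f t) \<le> M)"

text \<open>Test functions are $C^1$ with compact support in the open interval, as is customary for
  Sobolev spaces in one dimension (Brezis); $C^\infty$ test functions give the same notion.\<close>

definition test_function :: "real \<Rightarrow> real \<Rightarrow> (real \<Rightarrow> real) \<Rightarrow> (real \<Rightarrow> real) \<Rightarrow> bool" where
  "test_function a b \<phi> \<phi>' \<longleftrightarrow>
     (\<forall>t. (\<phi> has_real_derivative \<phi>' t) (at t)) \<and> continuous_on UNIV \<phi>' \<and>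
     (\<exists>K. compact K \<and> K \<subseteq> {a<..<b} \<and> (\<forall>t. t \<notin> K \<longrightarrow> \<phi> t = 0))"

definition weak_derivative :: "real \<Rightarrow> real \<Rightarrow> (real \<Rightarrow> plane) \<Rightarrow> (real \<Rightarrow> plane) \<Rightarrow> bool" where
  "weak_derivative a b u g \<longleftrightarrow>
     (\<forall>\<phi> \<phi>'. test_function a b \<phi> \<phi>' \<longrightarrow>
        (LINT t|lebesgue_on {a<..<b}. \<phi>' t *\<^sub>R u t) = - (LINT t|lebesgue_on {a<..<b}. \<phi> t *\<^sub>R g t))"

definition W1inf :: "real \<Rightarrow> real \<Rightarrow> (real \<Rightarrow> plane) \<Rightarrow> (real \<Rightarrow> plane) \<Rightarrow> bool" where
  "W1inf a b u g \<longleftrightarrow> Linf_on {a<..<b} u \<and> Linf_on {a<..<b} g \<and> weak_derivative a b u g"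

text \<open>\<open>W2inf a b z v c\<close>: the curve \<open>z\<close> is in $W^{2,\infty}((a,b))$ with first and second weak
  derivatives \<open>v\<close> and \<open>c\<close>. Elements of the Sobolev space are classes modulo null sets;
  \<open>z\<close> and \<open>v\<close> are the representatives that are continuous up to the end points, which makes
  sense of the boundary values. The derivative \<open>c\<close> is determined up to a null set only.\<close>

definition W2inf ::
  "real \<Rightarrow> real \<Rightarrow> (real \<Rightarrow> plane) \<Rightarrow> (real \<Rightarrow> plane) \<Rightarrow> (real \<Rightarrow> plane) \<Rightarrow> bool" where
  "W2inf a b z v c \<longleftrightarrow>
     W1inf a b z v \<and> W1inf a b v c \<and> continuous_on {a..b} z \<and> continuous_on {a..b} v"


subsection \<open>The minimax curvature problem\<close>

definition admissible ::
  "plane \<Rightarrow> plane \<Rightarrow> plane \<Rightarrow> plane \<Rightarrow> real \<Rightarrow>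
   (real \<Rightarrow> plane) \<Rightarrow> (real \<Rightarrow> plane) \<Rightarrow> (real \<Rightarrow> plane) \<Rightarrow> bool" where
  "admissible z0 v0 zf vf tf z v c \<longleftrightarrow>
     W2inf 0 tf z v c \<and>
     z 0 = z0 \<and> z tf = zf \<and> v 0 = v0 \<and> v tf = vf \<and>
     (AE t in lebesgue_on {0..tf}. norm (v t) = 1)"

definition max_curvature :: "real \<Rightarrow> (real \<Rightarrow> plane) \<Rightarrow> ereal" where
  "max_curvature tf c = esssup (lebesgue_on {0..tf}) (\<lambda>t. ereal (norm (c t)))"

definition solves_P ::
  "plane \<Rightarrow> plane \<Rightarrow> plane \<Rightarrow> plane \<Rightarrow> real \<Rightarrow> (real \<Rightarrow> plane) \<Rightarrow> bool" where
  "solves_P z0 v0 zf vf tf z \<longleftrightarrow>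
     (\<exists>v c. admissible z0 v0 zf vf tf z v c \<and>
        (\<forall>y w d. admissible z0 v0 zf vf tf y w d \<longrightarrow> max_curvature tf c \<le> max_curvature tf d))"


subsection \<open>Types of paths\<close>

text \<open>All pieces are parametrised by arc length.\<close>

definition line_piece :: "(real \<Rightarrow> plane) \<Rightarrow> real \<Rightarrow> real \<Rightarrow> bool" where
  "line_piece z a b \<longleftrightarrow> (\<exists>p d. norm d = 1 \<and> (\<forall>t\<in>{a..b}. z t = p + (t - a) *\<^sub>R d))"

text \<open>The sign \<open>\<sigma>\<close> is \<open>1\<close> for a left turn and \<open>-1\<close> for a right turn; the total turning angle
  is \<open>(b - a) / r\<close>.\<close>

definition circle_piece :: "(real \<Rightarrow> plane) \<Rightarrow> real \<Rightarrow> real \<Rightarrow> real \<Rightarrow> real \<Rightarrow> bool" where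
  "circle_piece z \<sigma> r a b \<longleftrightarrow>
     \<sigma> \<in> {1, -1} \<and> 0 < r \<and>
     (\<exists>p \<theta>. \<forall>t\<in>{a..b}.
        z t = p + r *\<^sub>R vector [cos (\<theta> + \<sigma> * (t - a) / r), sin (\<theta> + \<sigma> * (t - a) / r)])"

datatype letter = LetterS | LetterC | LetterO

fun piece :: "letter \<Rightarrow> (real \<Rightarrow> plane) \<Rightarrow> real \<Rightarrow> real \<Rightarrow> real \<Rightarrow> real \<Rightarrow> bool" where
  "piece LetterS z \<sigma> r a b \<longleftrightarrow> a < b \<and> line_piece z a b"
| "piece LetterC z \<sigma> r a b \<longleftrightarrow> a < b \<and> circle_piece z \<sigma> r a b \<and> (b - a) / r < 2 * pi"
| "piece LetterO z \<sigma> r a b \<longleftrightarrow> a < b \<and> circle_piece z \<sigma> r a b \<and> (b - a) / r = 2 * pi"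

text \<open>The path \<open>z\<close> on \<open>[0, L]\<close> has the type \<open>w\<close>: its \<open>i\<close>-th piece lives on \<open>[s i, s (Suc i)]\<close>, with
  orientation \<open>\<sigma> i\<close> and radius \<open>r i\<close> (irrelevant for line segments). Since the pieces are smooth
  up to their end points, being $C^1$ on \<open>{0<..<L}\<close> says that the concatenation is $C^1$.\<close>

definition path_of_type :: "letter list \<Rightarrow> real \<Rightarrow> (real \<Rightarrow> plane) \<Rightarrow> bool" where
  "path_of_type w L z \<longleftrightarrow>
     z C1_differentiable_on {0<..<L} \<and>
     (\<exists>s \<sigma> r :: nat \<Rightarrow> real.
        s 0 = 0 \<and> s (length w) = L \<and>
        (\<forall>i < length w. piece (w ! i) z (\<sigma> i) (r i) (s i) (s (Suc i))) \<and>
        (\<forall>i. Suc i < length w \<and> w ! i = LetterC \<and> w ! Suc i = LetterC \<longrightarrow> \<sigma> (Suc i) = - \<sigma> i))"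

definition subpath :: "real \<Rightarrow> (real \<Rightarrow> plane) \<Rightarrow> real \<Rightarrow> (real \<Rightarrow> plane) \<Rightarrow> bool" where
  "subpath l z L Z \<longleftrightarrow> (\<exists>\<alpha>. 0 \<le> \<alpha> \<and> \<alpha> + l \<le> L \<and> (\<forall>t\<in>{0..l}. z t = Z (\<alpha> + t)))"

definition type_or_subpath :: "letter list \<Rightarrow> real \<Rightarrow> (real \<Rightarrow> plane) \<Rightarrow> bool" where
  "type_or_subpath w l z \<longleftrightarrow>
     path_of_type w l z \<or> (\<exists>L Z. path_of_type w L Z \<and> subpath l z L Z)"

text \<open>Some piece of type \<open>C\<close> or \<open>O\<close> contained in the path \<open>z\<close> on \<open>[0, l]\<close> has radius \<open>r\<close>. The
  subinterval is arbitrary, so this does not depend on a decomposition into pieces.\<close>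

definition arc_radius :: "real \<Rightarrow> (real \<Rightarrow> plane) \<Rightarrow> real \<Rightarrow> bool" where
  "arc_radius l z r \<longleftrightarrow>
     (\<exists>a b \<sigma>. 0 \<le> a \<and> b \<le> l \<and> (piece LetterC z \<sigma> r a b \<or> piece LetterO z \<sigma> r a b))"

end

theory Submission
  imports Defs "HOL-Probability.Characteristic_Functions"
begin

text \<open>A curve of unit speed is determined by its starting point and by an angle function \<open>\<theta>\<close>,
  the velocity being \<open>cis (\<theta> t)\<close>; the maximal curvature is the least Lipschitz constant of \<open>\<theta>\<close>.
  The problem thus asks for an angle of least Lipschitz constant \<open>K\<close> among those with given
  directions at both ends and a given integral of \<open>cis (\<theta> t)\<close> (\<open>solution_has_minimax_angle\<close>).
  Since \<open>t\<^sub>f\<close> exceeds the distance of the end points, \<open>K\<close> is positive. The transition between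
  curves with weak derivatives and Lipschitz angles rests on \<open>weak_derivative_lipschitz\<close> and
  \<open>lipschitz_angle_lift\<close> in one direction and on densities of Lipschitz functions in the other
  (\<open>angle_gives_admissible_curve\<close>).

  Suppose that \<open>\<theta>\<close> is optimal. No angle with a smaller Lipschitz constant and the same end
  values can satisfy the linearised integral constraint, because Brouwer's theorem would turn it
  into a competitor (\<open>minimax_angle_first_order\<close>). Separation of convex sets then gives
  multipliers, so that \<open>\<theta>\<close> minimises a linear functional among all \<open>K\<close>-Lipschitz angles
  (\<open>minimax_angle_multiplier\<close>). Let \<open>l\<close> be the switching function of this functional, with
  derivative \<open>\<rho> * sin (\<theta> t - \<alpha>)\<close>. Where \<open>l\<close> does not vanish, \<open>\<theta>\<close> has slope \<open>K\<close> or \<open>-K\<close> according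
  to its sign, and the Hamiltonian \<open>\<rho> * cos (\<theta> t - \<alpha>) + K * \<bar>l t\<bar>\<close> is constant. Hence \<open>l\<close>
  vanishes exactly where \<open>cos (\<theta> t - \<alpha>)\<close> reaches a bound \<open>h\<close> (\<open>minimax_angle_bang_structure\<close>).
  In particular a stretch of constant slope has the slope \<open>0\<close>, \<open>K\<close> or \<open>-K\<close>: every piece is a
  segment or an arc of radius \<open>1 / K\<close>, which is the claim about the radii
  (\<open>minimax_arc_radius\<close>).

  That there are at most three pieces follows by surgery. The constraints see only the end
  directions and the integral of \<open>cis (\<theta> t)\<close>. So one may reverse a stretch of \<open>\<theta>\<close> between two
  times of equal value, or move a full turn to another place and change its sense of rotation.
  The result is again a minimizer for the same \<open>K\<close>, to which the necessary conditions apply once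
  more. For \<open>h < 1\<close> the switches are equally spaced, and reversing a suitable stretch excludes
  three of them (\<open>minimax_angle_no_three_switches\<close>), which leaves at most three arcs of
  alternating orientation. For \<open>h = 1\<close> the curve consists of segments of the direction \<open>\<alpha>\<close>, of
  full circles, and of at most one shorter arc at each end. Two full circles could be joined and
  replaced by one circle of twice the radius, whose curvature is not allowed
  (\<open>minimax_angle_no_two_loops\<close>), and a full circle cannot occur together with a segment and an
  outer arc (\<open>minimax_angle_no_arc_loop_line\<close>). The types CSC, COC and SOS and their sub-paths
  remain.\<close>

section \<open>Angles and directions\<close>

lemma norm_cis_diff: "cmod (cis a - cis b) = 2 * \<bar>sin ((a - b) / 2)\<bar>"
proof -
  have "(cmod (cis a - cis b))\<^sup>2 = 2 - 2 * cos (a - b)"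
    unfolding cmod_power2 cos_diff
    by (simp add: power2_diff algebra_simps sin_squared_eq)
  also have "cos (a - b) = 1 - 2 * (sin ((a - b) / 2))\<^sup>2"
    using cos_double_sin[of "(a - b) / 2"] by (metis mult_2 field_sum_of_halves)
  finally have "(cmod (cis a - cis b))\<^sup>2 = (2 * \<bar>sin ((a - b) / 2)\<bar>)\<^sup>2"
    by (simp add: power2_eq_square)
  then show ?thesis by (subst (asm) power2_eq_iff_nonneg) auto
qed

lemma norm_cis_diff_le: "cmod (cis a - cis b) \<le> \<bar>a - b\<bar>"
  using abs_sin_x_le_abs_x[of "(a - b) / 2"] by (simp add: norm_cis_diff)

lemma norm_cis_linearisation: "cmod (cis x - 1 - \<i> * of_real x) \<le> x\<^sup>2"
proof -
  have "cmod (cis x - 1 - \<i> * of_real x) \<le> x\<^sup>2 / 2"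
    using iexp_approx1[of x 1] by (simp add: cis_conv_exp algebra_simps numeral_2_eq_2)
  then show ?thesis by (smt (verit) zero_le_power2 field_sum_of_halves)
qed

lemma continuous_on_cis_comp [continuous_intros]:
  "continuous_on S f \<Longrightarrow> continuous_on S (\<lambda>t. cis (f t))"
  unfolding cis_conv_exp by (intro continuous_intros)

lemma cis_eq_of_crests: "cos (x - \<alpha>) = 1 \<Longrightarrow> cos (y - \<alpha>) = 1 \<Longrightarrow> cis x = cis y"
proof -
  have *: "cis z = cis \<alpha>" if "cos (z - \<alpha>) = 1" for z
  proof -
    have "sin (z - \<alpha>) = 0" using that sin_cos_squared_add[of "z - \<alpha>"] by simp
    then have "cis (z - \<alpha>) = 1" using that by (simp add: complex_eq_iff)
    then show ?thesis using cis_mult[of "z - \<alpha>" \<alpha>] by simp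
  qed
  assume "cos (x - \<alpha>) = 1" "cos (y - \<alpha>) = 1"
  then show "cis x = cis y" using *[of x] *[of y] by simp
qed

text \<open>The difference is continuous and takes its values in the discrete set of multiples of \<open>2 *
  pi\<close>.\<close>

lemma cis_eq_imp_constant_difference:
  fixes f g :: "real \<Rightarrow> real"
  assumes f: "continuous_on {a..b} f" and g: "continuous_on {a..b} g"
    and eq: "\<And>t. t \<in> {a<..<b} \<Longrightarrow> cis (f t) = cis (g t)" and ab: "a < b" and t: "t \<in> {a..b}"
  shows "f t - g t = f a - g a"
proof -
  define k where "k t = f t - g t" for t
  have k: "continuous_on {a..b} k" unfolding k_def by (intro continuous_intros f g)
  have int: "\<exists>n::int. k t = of_int n * 2 * pi" if "t \<in> {a<..<b}" for t
  proof -
    have "cis (k t) = 1" using eq[OF that] by (simp add: k_def cis_divide[symmetric])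
    then have "cos (k t) = 1" by (simp add: complex_eq_iff)
    then show ?thesis by (simp add: cos_one_2pi_int)
  qed
  then have disc: "\<exists>e>0. \<forall>y. y \<in> {a<..<b} \<and> k y \<noteq> k x \<longrightarrow> e \<le> norm (k y - k x)" if x: "x \<in> {a<..<b}" for x
  proof (intro exI[of _ pi] conjI allI impI)
    fix y assume y: "y \<in> {a<..<b} \<and> k y \<noteq> k x"
    obtain i j :: int where ij: "k y = of_int i * 2 * pi" "k x = of_int j * 2 * pi"
      using int[of y] int[OF x] y by blast
    then have "i \<noteq> j" using y by auto
    then have "1 \<le> \<bar>of_int (i - j) :: real\<bar>" by linarith
    then have "2 * pi * 1 \<le> 2 * pi * \<bar>of_int (i - j)\<bar>" by (intro mult_left_mono) auto
    also have "\<dots> = norm (k y - k x)"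
    proof -
      have "k y - k x = 2 * pi * of_int (i - j)" by (simp add: ij algebra_simps)
      then show ?thesis by (simp only: real_norm_def abs_mult) simp
    qed
    finally show "pi \<le> norm (k y - k x)" using pi_gt_zero by linarith
  qed simp
  have "k constant_on {a<..<b}"
    by (rule continuous_discrete_range_constant)
      (use disc in \<open>auto intro: continuous_on_subset[OF k]\<close>)
  then obtain c where c: "\<And>t. t \<in> {a<..<b} \<Longrightarrow> k t = c" unfolding constant_on_def by blast
  have "continuous_on (closure {a<..<b}) k" using ab k by simp
  then have "k t = c" if "t \<in> {a..b}" for t
    using continuous_constant_on_closure[of "{a<..<b}" k c t] c ab that by simp
  then show ?thesis using t ab by (simp add: k_def)
qed

section \<open>Angle functions of least Lipschitz constant\<close>

text \<open>The data that the boundary conditions fix for a curve with angle \<open>\<theta>\<close>. Directions are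
  compared, not angles: the two angles may differ by multiples of \<open>2 * pi\<close> at the ends, which
  lets full turns be removed or inserted.\<close>

definition same_ends :: "real \<Rightarrow> (real \<Rightarrow> real) \<Rightarrow> (real \<Rightarrow> real) \<Rightarrow> bool" where
  "same_ends T \<eta> \<theta> \<longleftrightarrow> cis (\<eta> 0) = cis (\<theta> 0) \<and> cis (\<eta> T) = cis (\<theta> T) \<and>
     integral {0..T} (\<lambda>t. cis (\<eta> t)) = integral {0..T} (\<lambda>t. cis (\<theta> t))"

text \<open>The angle function of an optimal curve. The boundary data are those of \<open>\<theta>\<close> itself, so that
  the notion passes without further ado to every rearrangement of \<open>\<theta>\<close> that keeps these data.\<close>

definition minimax_angle :: "real \<Rightarrow> real \<Rightarrow> (real \<Rightarrow> real) \<Rightarrow> bool" where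
  "minimax_angle K T \<theta> \<longleftrightarrow> 0 < T \<and> 0 < K \<and> K-lipschitz_on {0..T} \<theta> \<and>
     (\<forall>K' \<eta>. K' < K \<longrightarrow> K'-lipschitz_on {0..T} \<eta> \<longrightarrow> \<not> same_ends T \<eta> \<theta>)"

lemma minimax_angleD:
  assumes "minimax_angle K T \<theta>"
  shows "0 < T" "0 < K" "K-lipschitz_on {0..T} \<theta>" "continuous_on {0..T} \<theta>"
    "continuous_on {0..T} (\<lambda>t. cis (\<theta> t))"
  using assms lipschitz_on_continuous_on continuous_on_cis_comp
  unfolding minimax_angle_def by blast+

text \<open>If the direction is constant, a constant angle has the same data, and its Lipschitz
  constant \<open>0\<close> is less than \<open>K\<close>.\<close>

lemma minimax_angle_not_constant:
  assumes "minimax_angle K T \<theta>"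
  shows "\<not> (\<lambda>t. cis (\<theta> t)) constant_on {0..T}"
proof
  assume "(\<lambda>t. cis (\<theta> t)) constant_on {0..T}"
  then obtain u where u: "\<And>t. t \<in> {0..T} \<Longrightarrow> cis (\<theta> t) = u"
    unfolding constant_on_def by blast
  have "integral {0..T} (\<lambda>t. cis (\<theta> 0)) = integral {0..T} (\<lambda>t. cis (\<theta> t))"
    using minimax_angleD(1)[OF assms] by (intro integral_cong) (simp add: u)
  then have "same_ends T (\<lambda>_. \<theta> 0) \<theta>"
    using minimax_angleD(1)[OF assms] by (simp add: same_ends_def u)
  moreover have "0-lipschitz_on {0..T} (\<lambda>_. \<theta> 0)" by (rule lipschitz_on_constant)
  ultimately show False using assms unfolding minimax_angle_def by blast
qed

text \<open>The licence for all surgery below: a rearrangement of a minimizer that keeps the data and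
  the Lipschitz constant is a minimizer, hence subject to the same necessary conditions.\<close>

lemma same_ends_minimax:
  assumes "minimax_angle K T \<theta>" "K-lipschitz_on {0..T} \<eta>" "same_ends T \<eta> \<theta>"
  shows "minimax_angle K T \<eta>"
  using assms unfolding minimax_angle_def same_ends_def by metis

section \<open>First-order conditions\<close>

text \<open>The map sending \<open>w\<close> to the weighted moment is self-adjoint and positive definite as soon
  as no direction is orthogonal to all values of \<open>g\<close>. The weight \<open>t * (T - t)\<close> vanishes at both
  ends, so that a correction of an angle by the functions under the integral does not touch its
  end values.\<close>

lemma weighted_moments_invert:
  fixes g :: "real \<Rightarrow> complex"
  assumes T: "0 < T" and g: "continuous_on {0..T} g"
    and span: "\<And>w. (\<And>t. t \<in> {0..T} \<Longrightarrow> w \<bullet> g t = 0) \<Longrightarrow> w = 0"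
  obtains B :: "complex \<Rightarrow> complex" where "linear B"
    "\<And>w. integral {0..T} (\<lambda>t. (t * (T - t) * (B w \<bullet> g t)) *\<^sub>R g t) = w"
proof -
  define A where "A w = integral {0..T} (\<lambda>t. (t * (T - t) * (w \<bullet> g t)) *\<^sub>R g t)" for w
  have int: "(\<lambda>t. (t * (T - t) * (w \<bullet> g t)) *\<^sub>R g t) integrable_on {0..T}" for w
    by (intro integrable_continuous_real continuous_intros g)
  have lin: "linear A"
  proof
    fix x y :: complex and r :: real
    show "A (x + y) = A x + A y"
      unfolding A_def integral_add[OF int int, symmetric]
      by (intro integral_cong) (simp add: inner_add_left algebra_simps)
    show "A (r *\<^sub>R x) = r *\<^sub>R A x"
      unfolding A_def integral_cmul[symmetric]
      by (intro integral_cong) (simp add: algebra_simps)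
  qed
  have "w = 0" if "A w = 0" for w
  proof (rule span)
    have "integral {0..T} (\<lambda>t. t * (T - t) * (w \<bullet> g t)\<^sup>2) = w \<bullet> A w"
      using integral_linear[OF int bounded_linear_inner_right, of w w]
      unfolding A_def o_def by (simp add: power2_eq_square algebra_simps)
    also have "\<dots> = 0" using that by simp
    finally have zero: "\<forall>t\<in>{0..T}. t * (T - t) * (w \<bullet> g t)\<^sup>2 = 0"
      using T by (subst (asm) integral_eq_0_iff) (auto intro!: continuous_intros g)
    have "w \<bullet> g t = 0" if "t \<in> {0<..<T}" for t
      using bspec[OF zero, of t] that by auto
    moreover have "continuous_on (closure {0<..<T}) (\<lambda>t. w \<bullet> g t)"
      using T g by (auto intro!: continuous_intros)
    moreover fix t assume "t \<in> {0..T}"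
    ultimately show "w \<bullet> g t = 0"
      using continuous_constant_on_closure[of "{0<..<T}" "\<lambda>t. w \<bullet> g t" 0 t] T by simp
  qed
  then have "inj A" using lin by (simp add: linear_injective_0)
  then obtain B where "linear B" "\<And>w. A (B w) = w"
    using eucl.linear_injective_isomorphism[OF lin] by auto
  then show ?thesis using that unfolding A_def by blast
qed

text \<open>A vector orthogonal to all normals of the curve is parallel to all its tangents. The
  direction then takes at most two values, so it is constant by continuity.\<close>

lemma minimax_angle_normals_span:
  assumes \<theta>: "minimax_angle K T \<theta>"
    and w: "\<And>t. t \<in> {0..T} \<Longrightarrow> w \<bullet> (\<i> * cis (\<theta> t)) = 0"
  shows "w = 0"
proof (rule ccontr)
  assume "w \<noteq> 0"
  define u where "u = w / of_real (cmod w)"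
  have u: "cmod u = 1" using \<open>w \<noteq> 0\<close> by (simp add: u_def norm_divide)
  have "cis (\<theta> t) \<in> {u, - u}" if t: "t \<in> {0..T}" for t
  proof -
    have "u \<bullet> (\<i> * cis (\<theta> t)) = 0"
      using w[OF t] by (simp add: u_def inner_complex_def algebra_simps)
    then have a: "Im u * cos (\<theta> t) = Re u * sin (\<theta> t)" by (simp add: inner_complex_def)
    have b: "(Re u)\<^sup>2 + (Im u)\<^sup>2 = 1" using u by (simp add: cmod_def)
    define r where "r = Re u * cos (\<theta> t) + Im u * sin (\<theta> t)"
    have sc: "(sin (\<theta> t))\<^sup>2 + (cos (\<theta> t))\<^sup>2 = 1" by (rule sin_cos_squared_add)
    have re: "Re u = r * cos (\<theta> t)" using a sc unfolding r_def by algebra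
    have im: "Im u = r * sin (\<theta> t)" using a sc unfolding r_def by algebra
    have "r\<^sup>2 * ((sin (\<theta> t))\<^sup>2 + (cos (\<theta> t))\<^sup>2) = 1"
      using b unfolding re im by (simp only: power_mult_distrib distrib_left add.commute)
    then have "r\<^sup>2 = 1" by (simp only: sc mult_1_right)
    then have "r = 1 \<or> r = -1" by (simp add: power2_eq_1_iff)
    then show ?thesis using re im by (auto simp: complex_eq_iff)
  qed
  then have "finite ((\<lambda>t. cis (\<theta> t)) ` {0..T})"
    by (rule finite_subset[OF image_subsetI, of _ _ "{u, -u}"]) auto
  then have "(\<lambda>t. cis (\<theta> t)) constant_on {0..T}"
    by (intro continuous_finite_range_constant minimax_angleD(5)[OF \<theta>]) auto
  then show False using minimax_angle_not_constant[OF \<theta>] by blast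
qed

text \<open>If the first variation of the integral in the direction of \<open>\<eta>\<close> vanished, then the angle \<open>\<theta>
  + \<epsilon> * (\<eta> - \<theta>)\<close> would miss the prescribed integral only by a quantity of order \<open>\<epsilon>\<^sup>2\<close>. Adding \<open>\<epsilon>
  * h w\<close> for a suitable small \<open>w\<close> repairs this: the right \<open>w\<close> is a fixed point of a continuous
  self-map of a disc, which exists by Brouwer's theorem. The room between \<open>K'\<close> and \<open>K\<close> absorbs
  the Lipschitz constant of \<open>h w\<close>, so the repaired angle would be a competitor with a Lipschitz
  constant below \<open>K\<close>.\<close>

lemma minimax_angle_first_order:
  assumes \<theta>: "minimax_angle K T \<theta>" and K': "K' < K" and \<eta>: "K'-lipschitz_on {0..T} \<eta>"
    and ends: "\<eta> 0 = \<theta> 0" "\<eta> T = \<theta> T"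
  shows "integral {0..T} (\<lambda>t. (\<eta> t - \<theta> t) *\<^sub>R (\<i> * cis (\<theta> t))) \<noteq> 0"
proof
  assume zero: "integral {0..T} (\<lambda>t. (\<eta> t - \<theta> t) *\<^sub>R (\<i> * cis (\<theta> t))) = 0"
  note \<theta>D = minimax_angleD[OF \<theta>]
  have T: "0 < T" and K: "0 < K" by (fact \<theta>D)+
  have c\<eta>: "continuous_on {0..T} \<eta>" using \<eta> by (rule lipschitz_on_continuous_on)
  define g where "g t = \<i> * cis (\<theta> t)" for t
  have g1: "cmod (g t) = 1" for t by (simp add: g_def norm_mult)
  have cg: "continuous_on {0..T} g" unfolding g_def by (intro continuous_intros \<theta>D)
  obtain B where B: "linear B"
    and mom: "\<And>w. integral {0..T} (\<lambda>t. (t * (T - t) * (B w \<bullet> g t)) *\<^sub>R g t) = w"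
    using weighted_moments_invert[OF T cg minimax_angle_normals_span[OF \<theta>, folded g_def]]
    by blast
  obtain b where b: "0 < b" "\<And>w. cmod (B w) \<le> b * cmod w"
    using linear_bounded_pos[OF B] by blast
  define h where "h w t = t * (T - t) * (B w \<bullet> g t)" for w t
  define C where "C = T + T * T * K"
  have C: "0 < C" using T K by (simp add: C_def add_pos_pos)
  have hlip: "(b * cmod w * C)-lipschitz_on {0..T} (h w)" for w
  proof (rule lipschitz_onI)
    fix s t assume st: "s \<in> {0..T}" "t \<in> {0..T}"
    define q where "q u = u * (T - u)" for u
    have q1: "\<bar>q s - q t\<bar> \<le> T * \<bar>s - t\<bar>"
    proof -
      have "q s - q t = (T - s - t) * (s - t)" by (simp add: q_def algebra_simps)
      moreover have "\<bar>T - s - t\<bar> \<le> T" using st by auto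
      ultimately show ?thesis by (simp add: abs_mult mult_right_mono)
    qed
    have q2: "\<bar>q t\<bar> \<le> T * T"
      using st unfolding q_def abs_mult by (intro mult_mono) auto
    have g2: "\<bar>B w \<bullet> g s\<bar> \<le> cmod (B w)" using Cauchy_Schwarz_ineq2[of "B w" "g s"] g1 by simp
    have "cmod (g s - g t) \<le> \<bar>\<theta> s - \<theta> t\<bar>"
      using norm_cis_diff_le[of "\<theta> s" "\<theta> t"]
      by (simp add: g_def norm_mult flip: right_diff_distrib)
    also have "\<dots> \<le> K * \<bar>s - t\<bar>"
      using lipschitz_onD[OF \<theta>D(3) st] by (simp add: dist_real_def)
    finally have "cmod (B w) * cmod (g s - g t) \<le> cmod (B w) * (K * \<bar>s - t\<bar>)"
      by (intro mult_left_mono; simp)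
    then have g3: "\<bar>B w \<bullet> (g s - g t)\<bar> \<le> cmod (B w) * (K * \<bar>s - t\<bar>)"
      by (rule order.trans[OF Cauchy_Schwarz_ineq2])
    have "h w s - h w t = (q s - q t) * (B w \<bullet> g s) + q t * (B w \<bullet> (g s - g t))"
      by (simp add: h_def q_def inner_diff_right algebra_simps)
    then have "\<bar>h w s - h w t\<bar> \<le> \<bar>q s - q t\<bar> * \<bar>B w \<bullet> g s\<bar> + \<bar>q t\<bar> * \<bar>B w \<bullet> (g s - g t)\<bar>"
      by (metis abs_mult abs_triangle_ineq)
    also have "\<dots> \<le> (T * \<bar>s - t\<bar>) * cmod (B w) + (T * T) * (cmod (B w) * (K * \<bar>s - t\<bar>))"
      using T by (intro add_mono mult_mono q1 q2 g2 g3) auto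
    also have "\<dots> = cmod (B w) * (C * \<bar>s - t\<bar>)" by (simp add: C_def algebra_simps)
    also have "\<dots> \<le> (b * cmod w) * (C * \<bar>s - t\<bar>)"
      using C by (intro mult_right_mono b) auto
    finally show "dist (h w s) (h w t) \<le> b * cmod w * C * dist s t"
      by (simp add: dist_real_def mult.assoc)
  qed (use b C in auto)
  \<comment> \<open>The Lipschitz constant of \<open>h w\<close> is at most \<open>(K - K') / 2\<close> for \<open>w\<close> in the disc of radius
    \<open>r\<close>.\<close>
  define r where "r = (K - K') / (2 * b * C)"
  have r: "0 < r" using K' b C by (simp add: r_def)
  have "bounded ((\<lambda>t. \<eta> t - \<theta> t) ` {0..T})"
    by (intro compact_imp_bounded compact_continuous_image continuous_intros c\<eta> \<theta>D) auto
  then obtain D0 where "\<forall>t\<in>{0..T}. \<bar>\<eta> t - \<theta> t\<bar> \<le> D0"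
    unfolding bounded_iff by auto
  then have D0: "\<bar>\<eta> t - \<theta> t\<bar> \<le> D0" if "t \<in> {0..T}" for t using that by blast
  define D where "D = D0 + T * T * (b * r)"
  define \<delta> where "\<delta> w t = \<eta> t - \<theta> t + h w t" for w t
  have \<delta>: "\<bar>\<delta> w t\<bar> \<le> D" if w: "w \<in> cball 0 r" and t: "t \<in> {0..T}" for w t
  proof -
    have "\<bar>t * (T - t)\<bar> \<le> T * T" using t unfolding abs_mult by (intro mult_mono) auto
    moreover have "\<bar>B w \<bullet> g t\<bar> \<le> b * r"
    proof -
      have "\<bar>B w \<bullet> g t\<bar> \<le> cmod (B w)" using Cauchy_Schwarz_ineq2[of "B w" "g t"] g1 by simp
      also have "\<dots> \<le> b * cmod w" by (rule b)
      also have "\<dots> \<le> b * r" using w b by simp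
      finally show ?thesis .
    qed
    ultimately have "\<bar>h w t\<bar> \<le> T * T * (b * r)"
      unfolding h_def abs_mult[of "t * (T - t)"] using T by (intro mult_mono) auto
    then show ?thesis using D0[OF t] unfolding \<delta>_def D_def by linarith
  qed
  \<comment> \<open>Small enough for the remainder \<open>T * (\<epsilon> * D)\<^sup>2\<close> of the linearisation to be at most \<open>\<epsilon> * r\<close>.\<close>
  define \<epsilon> where "\<epsilon> = min 1 (r / (T * D\<^sup>2 + 1))"
  have den: "0 < T * D\<^sup>2 + 1" using T by (simp add: add_nonneg_pos)
  have \<epsilon>: "0 < \<epsilon>" "\<epsilon> \<le> 1" using r den by (auto simp: \<epsilon>_def)
  have "\<epsilon> \<le> r / (T * D\<^sup>2 + 1)" by (simp add: \<epsilon>_def)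
  then have "\<epsilon> * (T * D\<^sup>2 + 1) \<le> r" using den by (simp only: pos_le_divide_eq)
  then have \<epsilon>r: "\<epsilon> * (T * D\<^sup>2) \<le> r" using \<epsilon> by (simp add: algebra_simps)
  have ch: "continuous_on {0..T} (h w)" for w by (rule lipschitz_on_continuous_on[OF hlip])
  have c\<delta>: "continuous_on {0..T} (\<delta> w)" for w
    unfolding \<delta>_def by (intro continuous_intros c\<eta> \<theta>D ch)
  define F where "F w = integral {0..T} (\<lambda>t. cis (\<theta> t + \<epsilon> * \<delta> w t))
      - integral {0..T} (\<lambda>t. cis (\<theta> t))" for w
  \<comment> \<open>The fixed points of \<open>f\<close> are the zeros of \<open>F\<close>. To first order \<open>F w\<close> is \<open>\<epsilon> *\<^sub>R w\<close>, so that
    \<open>f\<close> maps the disc into itself.\<close>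
  define f where "f w = w - (1 / \<epsilon>) *\<^sub>R F w" for w
  have f_cball: "f w \<in> cball 0 r" if w: "w \<in> cball 0 r" for w
  proof -
    have m: "integral {0..T} (\<lambda>t. \<delta> w t *\<^sub>R g t) = w"
    proof -
      have "integral {0..T} (\<lambda>t. \<delta> w t *\<^sub>R g t)
          = integral {0..T} (\<lambda>t. (\<eta> t - \<theta> t) *\<^sub>R g t) + integral {0..T} (\<lambda>t. h w t *\<^sub>R g t)"
        by (subst integral_add[symmetric])
          (auto simp: \<delta>_def algebra_simps
            intro!: integrable_continuous_real continuous_intros c\<eta> \<theta>D cg ch)
      then show ?thesis using zero mom[of w] by (simp add: g_def h_def)
    qed
    define R where "R t = cis (\<theta> t + \<epsilon> * \<delta> w t) - cis (\<theta> t) - \<epsilon> *\<^sub>R (\<delta> w t *\<^sub>R g t)" for t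
    have i1: "(\<lambda>t. cis (\<theta> t + \<epsilon> * \<delta> w t)) integrable_on {0..T}"
      and i2: "(\<lambda>t. cis (\<theta> t)) integrable_on {0..T}"
      and i3: "(\<lambda>t. \<delta> w t *\<^sub>R g t) integrable_on {0..T}"
      by (intro integrable_continuous_real continuous_intros \<theta>D c\<delta> cg)+
    have "integral {0..T} R = F w - \<epsilon> *\<^sub>R integral {0..T} (\<lambda>t. \<delta> w t *\<^sub>R g t)"
      unfolding R_def F_def
        integral_diff[OF integrable_diff[OF i1 i2] integrable_cmul[OF i3]] integral_diff[OF i1 i2]
        integral_cmul ..
    then have "integral {0..T} R = F w - \<epsilon> *\<^sub>R w" unfolding m .
    moreover have "\<epsilon> *\<^sub>R f w = \<epsilon> *\<^sub>R w - F w"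
      using \<epsilon> by (simp add: f_def scaleR_diff_right)
    ultimately have "\<epsilon> *\<^sub>R f w = - integral {0..T} R" by simp
    moreover have "cmod (integral {0..T} R) \<le> (\<epsilon> * D)\<^sup>2 * (T - 0)"
    proof (rule integral_bound)
      show "continuous_on {0..T} R"
        unfolding R_def by (intro continuous_intros \<theta>D c\<delta> cg)
      fix t assume t: "t \<in> {0..T}"
      have "R t = cis (\<theta> t) * (cis (\<epsilon> * \<delta> w t) - 1 - \<i> * of_real (\<epsilon> * \<delta> w t))"
        by (simp add: R_def g_def algebra_simps scaleR_conv_of_real flip: cis_mult)
      then have "cmod (R t) \<le> (\<epsilon> * \<delta> w t)\<^sup>2"
        using norm_cis_linearisation[of "\<epsilon> * \<delta> w t"] by (simp add: norm_mult)
      also have "\<dots> \<le> (\<epsilon> * D)\<^sup>2"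
        using \<delta>[OF w t] \<epsilon> by (intro power2_le_iff_abs_le[THEN iffD2])
          (auto simp: abs_mult intro!: mult_left_mono mult_nonneg_nonneg)
      finally show "cmod (R t) \<le> (\<epsilon> * D)\<^sup>2" .
    qed (use T in auto)
    ultimately have "\<epsilon> * cmod (f w) \<le> \<epsilon> * (\<epsilon> * (T * D\<^sup>2))"
      using \<epsilon> by (metis (no_types, opaque_lifting) abs_of_pos diff_zero mult.assoc mult.commute
          norm_minus_cancel norm_scaleR power2_eq_square)
    also have "\<dots> \<le> \<epsilon> * r" using \<epsilon>r \<epsilon> by simp
    finally show ?thesis using \<epsilon> by simp
  qed
  have cB: "continuous_on S B" for S
    using B by (simp add: linear_continuous_on linear_conv_bounded_linear)
  have "continuous_on (cball 0 r) f"
  proof -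
    have c1: "continuous_on (cball 0 r \<times> {0..T}) (\<lambda>p. \<phi> (snd p))"
      if "continuous_on {0..T} \<phi>" for \<phi> :: "real \<Rightarrow> 'z::real_normed_vector"
      by (rule continuous_on_compose2[OF that continuous_on_snd]) (auto intro: continuous_intros)
    have "continuous_on (cball 0 r \<times> {0..T}) (\<lambda>p. B (fst p))"
      by (rule continuous_on_compose2[OF cB[of UNIV] continuous_on_fst]) (auto intro: continuous_intros)
    then have "continuous_on (cball 0 r \<times> cbox 0 T) (\<lambda>(w, t). cis (\<theta> t + \<epsilon> * \<delta> w t))"
      unfolding \<delta>_def h_def split_def cbox_interval
      by (intro continuous_intros c1 \<theta>D c\<eta> cg)
    from integral_continuous_on_param[OF this]
    show ?thesis unfolding f_def F_def by (auto intro!: continuous_intros simp: cbox_interval)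
  qed
  then obtain w where w: "w \<in> cball 0 r" "f w = w"
    using brouwer_ball[OF r, of 0 f] f_cball by auto
  then have F0: "F w = 0" using \<epsilon> by (simp add: f_def)
  \<comment> \<open>The competitor, written as a convex combination to bound its Lipschitz constant.\<close>
  define \<zeta> where "\<zeta> t = (1 - \<epsilon>) * \<theta> t + \<epsilon> * (\<eta> t + h w t)" for t
  have \<zeta>: "\<zeta> t = \<theta> t + \<epsilon> * \<delta> w t" for t by (simp add: \<zeta>_def \<delta>_def algebra_simps)
  have h0: "h w 0 = 0" "h w T = 0" by (auto simp: h_def)
  have "same_ends T \<zeta> \<theta>"
    using F0 ends h0 by (simp add: same_ends_def \<zeta> F_def \<delta>_def)
  moreover have "(\<bar>1 - \<epsilon>\<bar> * K + \<bar>\<epsilon>\<bar> * (K' + b * cmod w * C))-lipschitz_on {0..T} \<zeta>"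
    unfolding \<zeta>_def
    by (intro lipschitz_on_add lipschitz_on_cmult_real \<theta>D(3) \<eta> hlip)
  moreover have "\<bar>1 - \<epsilon>\<bar> * K + \<bar>\<epsilon>\<bar> * (K' + b * cmod w * C) < K"
  proof -
    have "b * cmod w * C \<le> b * r * C" using w b C by (intro mult_right_mono mult_left_mono) auto
    also have "\<dots> = (K - K') / 2" using b C by (simp add: r_def)
    finally have "K' + b * cmod w * C < K" using K' by (simp add: field_simps)
    then have "\<epsilon> * (K' + b * cmod w * C) < \<epsilon> * K" using \<epsilon> by simp
    then show ?thesis using \<epsilon> by (simp add: algebra_simps)
  qed
  ultimately show False using \<theta> unfolding minimax_angle_def by blast
qed

text \<open>Send an angle that starts at \<open>\<theta> 0\<close> and has Lipschitz constant less than \<open>K\<close> to its end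
  value and its linearised integral, both relative to \<open>\<theta>\<close>. The image is convex and, by the
  previous lemma, misses the origin; a separating functional is the pair of multipliers. It
  remains to pass from constants less than \<open>K\<close> to the constant \<open>K\<close>.\<close>

lemma minimax_angle_multiplier:
  assumes \<theta>: "minimax_angle K T \<theta>"
  obtains \<mu> :: real and w :: complex where "\<mu> \<noteq> 0 \<or> w \<noteq> 0"
    "\<And>\<eta>. K-lipschitz_on {0..T} \<eta> \<Longrightarrow> \<eta> 0 = \<theta> 0 \<Longrightarrow>
       0 \<le> \<mu> * (\<eta> T - \<theta> T) + integral {0..T} (\<lambda>t. (\<eta> t - \<theta> t) * (w \<bullet> (\<i> * cis (\<theta> t))))"
proof -
  note \<theta>D = minimax_angleD[OF \<theta>]
  define M where "M \<eta> = (\<eta> T - \<theta> T, integral {0..T} (\<lambda>t. (\<eta> t - \<theta> t) *\<^sub>R (\<i> * cis (\<theta> t))))"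
    for \<eta> :: "real \<Rightarrow> real"
  define A where "A = {\<eta>. \<eta> 0 = \<theta> 0 \<and> (\<exists>L<K. L-lipschitz_on {0..T} \<eta>)}"
  have int: "(\<lambda>t. (\<eta> t - \<theta> t) *\<^sub>R (\<i> * cis (\<theta> t))) integrable_on {0..T}"
    if "continuous_on {0..T} \<eta>" for \<eta>
    by (intro integrable_continuous_real continuous_intros \<theta>D that)
  have A_cont: "continuous_on {0..T} \<eta>" if "\<eta> \<in> A" for \<eta>
    using that lipschitz_on_continuous_on by (auto simp: A_def)
  have M_comb: "M (\<lambda>t. (1 - u) * \<eta> t + u * \<zeta> t) = (1 - u) *\<^sub>R M \<eta> + u *\<^sub>R M \<zeta>"
    if "continuous_on {0..T} \<eta>" "continuous_on {0..T} \<zeta>" for \<eta> \<zeta> u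
  proof -
    have "integral {0..T} (\<lambda>t. ((1 - u) * \<eta> t + u * \<zeta> t - \<theta> t) *\<^sub>R (\<i> * cis (\<theta> t)))
      = integral {0..T} (\<lambda>t. (1 - u) *\<^sub>R ((\<eta> t - \<theta> t) *\<^sub>R (\<i> * cis (\<theta> t)))
          + u *\<^sub>R ((\<zeta> t - \<theta> t) *\<^sub>R (\<i> * cis (\<theta> t))))"
      by (intro integral_cong) (simp add: algebra_simps)
    also have "\<dots> = (1 - u) *\<^sub>R integral {0..T} (\<lambda>t. (\<eta> t - \<theta> t) *\<^sub>R (\<i> * cis (\<theta> t)))
        + u *\<^sub>R integral {0..T} (\<lambda>t. (\<zeta> t - \<theta> t) *\<^sub>R (\<i> * cis (\<theta> t)))"
      by (simp only: integral_add integrable_cmul int that integral_cmul)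
    finally show ?thesis by (simp add: M_def algebra_simps)
  qed
  have "convex (M ` A)"
    unfolding convex_alt
  proof (intro ballI allI impI)
    fix x y and u :: real
    assume "x \<in> M ` A" "y \<in> M ` A" and u': "0 \<le> u \<and> u \<le> 1"
    then obtain \<eta> \<zeta> where x: "x = M \<eta>" and y: "y = M \<zeta>" and \<eta>: "\<eta> \<in> A" and \<zeta>: "\<zeta> \<in> A"
      by blast
    have u: "0 \<le> u" "u \<le> 1" using u' by auto
    obtain L L' where L: "L < K" "L-lipschitz_on {0..T} \<eta>" "L' < K" "L'-lipschitz_on {0..T} \<zeta>"
      using \<eta> \<zeta> by (auto simp: A_def)
    have "(\<bar>1 - u\<bar> * L + \<bar>u\<bar> * L')-lipschitz_on {0..T} (\<lambda>t. (1 - u) * \<eta> t + u * \<zeta> t)"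
      by (intro lipschitz_on_add lipschitz_on_cmult_real L)
    moreover have "\<bar>1 - u\<bar> * L + \<bar>u\<bar> * L' < K"
      using convex_bound_lt[of L K L' "1 - u" u] L u by simp
    moreover have "(1 - u) * \<eta> 0 + u * \<zeta> 0 = \<theta> 0" using \<eta> \<zeta> by (simp add: A_def algebra_simps)
    ultimately have "(\<lambda>t. (1 - u) * \<eta> t + u * \<zeta> t) \<in> A" unfolding A_def by blast
    then show "(1 - u) *\<^sub>R x + u *\<^sub>R y \<in> M ` A"
      unfolding x y M_comb[OF A_cont[OF \<eta>] A_cont[OF \<zeta>], symmetric] by (rule imageI)
  qed
  moreover have "0 \<notin> M ` A"
    using minimax_angle_first_order[OF \<theta>] by (auto simp: M_def A_def zero_prod_def)
  ultimately have "\<exists>a. a \<noteq> 0 \<and> (\<forall>x\<in>M ` A. 0 \<le> a \<bullet> x)" by (rule separating_hyperplane_set_0)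
  then obtain a where a: "a \<noteq> 0" "\<And>\<eta>. \<eta> \<in> A \<Longrightarrow> 0 \<le> a \<bullet> M \<eta>" by auto
  have nonneg: "0 \<le> a \<bullet> M \<eta>" if \<eta>: "K-lipschitz_on {0..T} \<eta>" "\<eta> 0 = \<theta> 0" for \<eta>
  proof (rule ccontr)
    assume neg: "\<not> ?thesis"
    define c where "c = (\<lambda>_::real. \<theta> 0)"
    have c: "c \<in> A" unfolding A_def c_def using \<theta>D(2) lipschitz_on_constant by fastforce
    \<comment> \<open>the point of the segment from \<open>c\<close> to \<open>\<eta>\<close> where the functional takes half its value at \<open>\<eta>\<close>\<close>
    define x y where "x = a \<bullet> M c" and "y = a \<bullet> M \<eta>"
    have xy: "0 \<le> x" "y < 0" using a(2)[OF c] neg by (auto simp: x_def y_def)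
    define u where "u = (x - y / 2) / (x - y)"
    have u: "0 < u" "u < 1" using xy by (auto simp: u_def field_simps)
    have "(\<bar>1 - u\<bar> * 0 + \<bar>u\<bar> * K)-lipschitz_on {0..T} (\<lambda>t. (1 - u) * c t + u * \<eta> t)"
      unfolding c_def by (intro lipschitz_on_add lipschitz_on_cmult_real lipschitz_on_constant \<eta>)
    moreover have "\<bar>1 - u\<bar> * 0 + \<bar>u\<bar> * K < K" using u \<theta>D(2) by simp
    moreover have "(1 - u) * c 0 + u * \<eta> 0 = \<theta> 0" using \<eta> by (simp add: c_def algebra_simps)
    ultimately have "(\<lambda>t. (1 - u) * c t + u * \<eta> t) \<in> A" unfolding A_def by blast
    from a(2)[OF this] have "0 \<le> a \<bullet> ((1 - u) *\<^sub>R M c + u *\<^sub>R M \<eta>)"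
      unfolding M_comb[OF A_cont[OF c] lipschitz_on_continuous_on[OF \<eta>(1)]] .
    also have "\<dots> = x - u * (x - y)" by (simp add: inner_add_right x_def y_def algebra_simps)
    also have "\<dots> = y / 2" using xy by (simp add: u_def)
    finally show False using xy by simp
  qed
  obtain \<mu> w where mw: "a = (\<mu>, w)" by fastforce
  have "a \<bullet> M \<eta> = \<mu> * (\<eta> T - \<theta> T) + integral {0..T} (\<lambda>t. (\<eta> t - \<theta> t) * (w \<bullet> (\<i> * cis (\<theta> t))))"
    if "K-lipschitz_on {0..T} \<eta>" for \<eta>
    using integral_linear[OF int[OF lipschitz_on_continuous_on[OF that]]
        bounded_linear_inner_right, of w]
    by (simp add: mw M_def o_def)
  then have "0 \<le> \<mu> * (\<eta> T - \<theta> T) + integral {0..T} (\<lambda>t. (\<eta> t - \<theta> t) * (w \<bullet> (\<i> * cis (\<theta> t))))"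
    if "K-lipschitz_on {0..T} \<eta>" "\<eta> 0 = \<theta> 0" for \<eta> using nonneg that by metis
  moreover have "\<mu> \<noteq> 0 \<or> w \<noteq> 0" using a(1) by (auto simp: mw zero_prod_def)
  ultimately show ?thesis using that by blast
qed

section \<open>The switching function and its Hamiltonian\<close>

lemma integral_split3:
  fixes f :: "real \<Rightarrow> 'a::euclidean_space"
  assumes "continuous_on {c..d} f" "c \<le> a" "a \<le> b" "b \<le> d"
  shows "integral {c..d} f = integral {c..a} f + integral {a..b} f + integral {b..d} f"
proof -
  have "f integrable_on {c..d}" by (rule integrable_continuous_real[OF assms(1)])
  moreover have "f integrable_on {a..d}"
    using assms by (intro integrable_continuous_real continuous_on_subset[OF assms(1)]) auto
  ultimately show ?thesis
    using Henstock_Kurzweil_Integration.integral_combine[of c a d f]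
      Henstock_Kurzweil_Integration.integral_combine[of a b d f] assms by (simp add: add.assoc)
qed

text \<open>A needle variation. Replace \<open>\<theta>\<close> on \<open>{a..b}\<close> by the line of extreme slope and shift it
  afterwards by the error \<open>e\<close> made at \<open>b\<close>. The functional changes by \<open>e * (\<mu> + integral {b..T}
  \<gamma>)\<close>, up to at most \<open>\<bar>e\<bar> * M * (b - a)\<close>. If the first term dominates, the inequality for
  minimizers leaves only \<open>e = 0\<close>, and then \<open>\<theta>\<close> had the extreme slope itself.\<close>

lemma extremal_slope:
  assumes \<theta>: "K-lipschitz_on {0..T} \<theta>" and \<gamma>: "continuous_on {0..T} \<gamma>"
    and bound: "\<And>t. t \<in> {0..T} \<Longrightarrow> \<bar>\<gamma> t\<bar> \<le> M"
    and opt: "\<And>\<eta>. K-lipschitz_on {0..T} \<eta> \<Longrightarrow> \<eta> 0 = \<theta> 0 \<Longrightarrow>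
       0 \<le> \<mu> * (\<eta> T - \<theta> T) + integral {0..T} (\<lambda>t. (\<eta> t - \<theta> t) * \<gamma> t)"
    and ab: "0 \<le> a" "a \<le> b" "b \<le> T" and \<sigma>: "\<sigma> \<in> {1, -1}"
    and large: "M * (b - a) < \<sigma> * - (\<mu> + integral {b..T} \<gamma>)"
    and t: "t \<in> {a..b}"
  shows "\<theta> t = \<theta> a + \<sigma> * K * (t - a)"
proof -
  have K: "0 \<le> K" using \<theta> by (rule lipschitz_on_nonneg)
  define e where "e = \<theta> a + \<sigma> * K * (b - a) - \<theta> b"
  define \<eta> where "\<eta> t = (if t \<le> a then \<theta> t else if t \<le> b then \<theta> a + \<sigma> * K * (t - a) else \<theta> t + e)" for t
  have lin: "K-lipschitz_on {a..b} (\<lambda>t. \<theta> a + \<sigma> * K * (t - a))"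
    by (rule lipschitz_onI) (use \<sigma> K in \<open>auto simp: dist_real_def abs_mult simp flip: right_diff_distrib\<close>)
  have "K-lipschitz_on {b..T} (\<lambda>t. \<theta> t + e)"
    using lipschitz_on_add[OF lipschitz_on_subset[OF \<theta>, of "{b..T}"] lipschitz_on_constant[of _ e]] ab by auto
  from lipschitz_on_concat[OF lin this]
  have "K-lipschitz_on {a..T} (\<lambda>t. if t \<le> b then \<theta> a + \<sigma> * K * (t - a) else \<theta> t + e)"
    by (simp add: e_def)
  from lipschitz_on_concat[OF lipschitz_on_subset[OF \<theta>, of "{0..a}"] this]
  have \<eta>: "K-lipschitz_on {0..T} \<eta>" unfolding \<eta>_def using ab by auto
  define \<delta> where "\<delta> t = \<eta> t - \<theta> t" for t
  have c\<delta>: "continuous_on {0..T} \<delta>"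
    unfolding \<delta>_def by (intro continuous_intros lipschitz_on_continuous_on[OF \<eta>] lipschitz_on_continuous_on[OF \<theta>])
  have \<delta>_ab: "0 \<le> \<sigma> * \<delta> s \<and> \<sigma> * \<delta> s \<le> \<sigma> * e" if s: "s \<in> {a..b}" for s
  proof -
    have "\<delta> s = \<theta> a + \<sigma> * K * (s - a) - \<theta> s" using s by (auto simp: \<delta>_def \<eta>_def)
    moreover have "\<bar>\<theta> s - \<theta> a\<bar> \<le> K * (s - a)" "\<bar>\<theta> b - \<theta> s\<bar> \<le> K * (b - s)"
      using lipschitz_onD[OF \<theta>, of s a] lipschitz_onD[OF \<theta>, of b s] s ab by (auto simp: dist_real_def)
    moreover have "K * (b - a) = K * (s - a) + K * (b - s)" by (simp add: algebra_simps)
    ultimately show ?thesis using \<sigma> unfolding e_def by auto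
  qed
  have c\<delta>\<gamma>: "continuous_on {c..d} (\<lambda>t. \<delta> t * \<gamma> t)" if "0 \<le> c" "d \<le> T" for c d
    using that by (intro continuous_on_subset[OF continuous_on_mult[OF c\<delta> \<gamma>]]) auto
  have split: "integral {0..T} (\<lambda>t. \<delta> t * \<gamma> t) = integral {0..a} (\<lambda>t. \<delta> t * \<gamma> t)
      + integral {a..b} (\<lambda>t. \<delta> t * \<gamma> t) + integral {b..T} (\<lambda>t. \<delta> t * \<gamma> t)"
    using c\<delta>\<gamma> ab by (intro integral_split3) auto
  have "integral {0..a} (\<lambda>t. \<delta> t * \<gamma> t) = 0"
    by (subst integral_cong[where g="\<lambda>_. 0"]) (auto simp: \<delta>_def \<eta>_def)
  moreover have "integral {b..T} (\<lambda>t. \<delta> t * \<gamma> t) = e * integral {b..T} \<gamma>"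
    using ab by (subst integral_cong[where g="\<lambda>t. e * \<gamma> t"]) (auto simp: \<delta>_def \<eta>_def e_def)
  moreover have "\<bar>integral {a..b} (\<lambda>t. \<delta> t * \<gamma> t)\<bar> \<le> (\<sigma> * e * M) * (b - a)"
  proof -
    have "norm (integral {a..b} (\<lambda>t. \<delta> t * \<gamma> t)) \<le> (\<sigma> * e * M) * (b - a)"
    proof (rule integral_bound[OF ab(2)])
      show "continuous_on {a..b} (\<lambda>t. \<delta> t * \<gamma> t)"
        using ab by (intro c\<delta>\<gamma>)
      fix s assume s: "s \<in> {a..b}"
      have "\<bar>\<delta> s\<bar> \<le> \<sigma> * e" using \<delta>_ab[OF s] \<sigma> by auto
      moreover have "\<bar>\<gamma> s\<bar> \<le> M" using bound[of s] s ab by auto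
      ultimately show "norm (\<delta> s * \<gamma> s) \<le> \<sigma> * e * M"
        unfolding real_norm_def abs_mult by (intro mult_mono) auto
    qed
    then show ?thesis by simp
  qed
  moreover
  have "\<delta> T = e" using ab \<sigma> by (auto simp: \<delta>_def \<eta>_def e_def)
  have "\<eta> 0 = \<theta> 0" using ab by (simp add: \<eta>_def)
  from opt[OF \<eta> this] have "0 \<le> \<mu> * e + integral {0..T} (\<lambda>t. \<delta> t * \<gamma> t)"
    unfolding \<delta>_def[symmetric] \<open>\<delta> T = e\<close> .
  ultimately have "0 \<le> \<mu> * e + e * integral {b..T} \<gamma> + (\<sigma> * e * M) * (b - a)"
    using split by linarith
  also have "\<dots> = (\<sigma> * e) * (M * (b - a) - \<sigma> * - (\<mu> + integral {b..T} \<gamma>))"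
    using \<sigma> by (auto simp: algebra_simps)
  finally have "\<sigma> * e \<le> 0" using large
    by (smt (verit) mult_pos_neg)
  then have "\<sigma> * \<delta> t = 0" using \<delta>_ab[OF t] by linarith
  then have "\<eta> t = \<theta> t" using \<sigma> by (auto simp: \<delta>_def)
  then show ?thesis using t by (auto simp: \<eta>_def split: if_splits)
qed

text \<open>The derivative vanishes everywhere. The lemma replaces differentiation where the functions
  are merely Lipschitz: to prove an identity it is enough to compare both sides on short
  intervals up to second order.\<close>

lemma quadratic_increments_imp_constant:
  fixes f :: "real \<Rightarrow> 'a::real_normed_vector"
  assumes ab: "a \<le> b"
    and f: "\<And>s t. a \<le> s \<Longrightarrow> s \<le> t \<Longrightarrow> t \<le> b \<Longrightarrow> norm (f t - f s) \<le> C * (t - s)\<^sup>2"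
  shows "f b = f a"
proof -
  have "(f has_derivative (\<lambda>_. 0)) (at x within {a..b})" if x: "x \<in> {a..b}" for x
  proof (rule has_derivativeI_sandwich[of 1])
    show "((\<lambda>y. C * \<bar>y - x\<bar>) \<longlongrightarrow> 0) (at x within {a..b})"
      by (rule tendsto_eq_intros refl)+ simp
    fix y assume y: "y \<in> {a..b}" "y \<noteq> x"
    have "norm (f y - f x) \<le> C * (y - x)\<^sup>2"
      using f[of x y] f[of y x] x y(1)
      by (cases "x \<le> y") (auto simp: norm_minus_commute power2_commute)
    also have "\<dots> = C * \<bar>y - x\<bar> * norm (y - x)" by (simp add: power2_eq_square abs_mult_self_eq)
    finally show "norm (f y - f x - 0) / norm (y - x) \<le> C * \<bar>y - x\<bar>"
      using y(2) by (simp add: pos_divide_le_eq)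
  qed auto
  then obtain c where "\<And>x. x \<in> {a..b} \<Longrightarrow> f x = c"
    using has_derivative_zero_constant[of "{a..b}" f] by auto
  then show ?thesis using ab by simp
qed

lemma cos_near_critical_point:
  fixes x y :: real
  assumes "sin x = 0" shows "\<bar>cos y - cos x\<bar> \<le> (y - x)\<^sup>2"
proof -
  have "cos y - cos x = - (cos x * (1 - cos (y - x)))"
    using cos_add[of x "y - x"] assms by (simp add: algebra_simps)
  then have "\<bar>cos y - cos x\<bar> = \<bar>cos x\<bar> * \<bar>1 - cos (y - x)\<bar>"
    by (simp only: abs_minus_cancel abs_mult)
  also have "\<bar>1 - cos (y - x)\<bar> = 1 - cos (y - x)" by simp
  also have "\<bar>cos x\<bar> * (1 - cos (y - x)) \<le> 1 * (1 - cos (y - x))" by (intro mult_right_mono) auto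
  also have "1 - cos (y - x) = 2 * (sin ((y - x) / 2))\<^sup>2"
    using cos_double_sin[of "(y - x) / 2"] by (metis add_diff_cancel_left' diff_add_cancel diff_diff_eq2 field_sum_of_halves mult_2)
  also have "(sin ((y - x) / 2))\<^sup>2 \<le> ((y - x) / 2)\<^sup>2"
    using abs_sin_x_le_abs_x[of "(y - x) / 2"] by (simp only: abs_le_square_iff)
  finally show ?thesis by (simp add: power_divide) (smt (verit) zero_le_power2)
qed

text \<open>The function \<open>l\<close> is the switching function: its sign decides about the slope of \<open>\<theta>\<close>. The
  hypothesis on slopes is the quantitative form of this that a needle variation yields; the
  interval must be short in comparison with the value of \<open>l\<close> at its right end.\<close>

locale multiplier =
  fixes K T \<rho> \<alpha> :: real and \<theta> l :: "real \<Rightarrow> real"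
  assumes K: "0 < K" and T: "0 < T" and \<rho>: "0 < \<rho>"
    and lip: "K-lipschitz_on {0..T} \<theta>"
    and deriv: "\<And>t. t \<in> {0..T} \<Longrightarrow> (l has_real_derivative \<rho> * sin (\<theta> t - \<alpha>)) (at t within {0..T})"
    and slope: "\<And>a b \<sigma> t. 0 \<le> a \<Longrightarrow> a \<le> b \<Longrightarrow> b \<le> T \<Longrightarrow> \<sigma> \<in> {1, -1} \<Longrightarrow>
      \<rho> * (b - a) < \<sigma> * l b \<Longrightarrow> t \<in> {a..b} \<Longrightarrow> \<theta> t = \<theta> a + \<sigma> * K * (t - a)"
begin

lemma cont_l: "continuous_on {0..T} l"
  unfolding continuous_on_eq_continuous_within by (intro ballI DERIV_continuous[OF deriv])

lemma deriv_at: "0 < t \<Longrightarrow> t < T \<Longrightarrow> (l has_real_derivative \<rho> * sin (\<theta> t - \<alpha>)) (at t)"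
  using deriv[of t] by (simp add: at_within_Icc_at)

lemma deriv_local:
  assumes t: "0 < t" "t < T" and \<sigma>: "\<sigma> \<in> {1, -1}" and pos: "0 < \<sigma> * l t"
  shows "(\<theta> has_real_derivative \<sigma> * K) (at t)"
proof -
  \<comment> \<open>The factor \<open>2 * \<bar>s - t\<bar>\<close> is the length of the interval around \<open>t\<close> with right end \<open>s\<close>.\<close>
  have "isCont (\<lambda>s. \<sigma> * l s - \<rho> * (2 * \<bar>s - t\<bar>)) t"
    using DERIV_isCont[OF deriv_at[OF t]] by (intro continuous_intros)
  then have "((\<lambda>s. \<sigma> * l s - \<rho> * (2 * \<bar>s - t\<bar>)) \<longlongrightarrow> \<sigma> * l t) (at t)"
    by (simp add: isCont_def)
  from order_tendstoD(1)[OF this pos]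
  have "eventually (\<lambda>s. 0 < \<sigma> * l s - \<rho> * (2 * \<bar>s - t\<bar>)) (at t)" .
  moreover have "eventually (\<lambda>s. s \<in> {0<..<T}) (at t)"
    using t by (intro eventually_at_in_open') auto
  ultimately have "eventually (\<lambda>s. 0 < \<sigma> * l s - \<rho> * (2 * \<bar>s - t\<bar>) \<and> s \<in> {0<..<T}) (at t)"
    by (rule eventually_conj)
  then obtain d where d: "0 < d"
    "\<And>s. s \<noteq> t \<Longrightarrow> \<bar>s - t\<bar> < d \<Longrightarrow> 0 < \<sigma> * l s - \<rho> * (2 * \<bar>s - t\<bar>) \<and> s \<in> {0<..<T}"
    unfolding eventually_at by (auto simp: dist_real_def)
  define c where "c = d / 2"
  have c: "0 < c" "c < d" using d by (auto simp: c_def)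
  have ends: "0 < t - c" "t + c < T" using d(2)[of "t - c"] d(2)[of "t + c"] c by auto
  have "\<rho> * ((t + c) - (t - c)) < \<sigma> * l (t + c)" using d(2)[of "t + c"] c by auto
  then have lin: "\<theta> s = \<theta> (t - c) + \<sigma> * K * (s - (t - c))" if "s \<in> {t - c..t + c}" for s
    using slope[of "t - c" "t + c" \<sigma> s] ends c \<sigma> that by auto
  have "((\<lambda>s. \<theta> (t - c) + \<sigma> * K * (s - (t - c))) has_real_derivative \<sigma> * K) (at t)"
    by (auto intro!: derivative_eq_intros)
  then show ?thesis
    by (rule has_field_derivative_transform_within_open[of _ _ _ "{t - c<..<t + c}"])
      (use c in \<open>auto intro!: lin[symmetric]\<close>)
qed

lemma zero_free_interval:
  assumes ab: "0 \<le> a" "a < b" "b \<le> T" and nz: "\<And>t. a < t \<Longrightarrow> t < b \<Longrightarrow> l t \<noteq> 0"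
  obtains \<sigma> where "\<sigma> \<in> {1, -1}" "\<And>t. t \<in> {a<..<b} \<Longrightarrow> 0 < \<sigma> * l t"
    "\<And>t. t \<in> {a..b} \<Longrightarrow> \<theta> t = \<theta> a + \<sigma> * K * (t - a)"
proof -
  define \<sigma> where "\<sigma> = sgn (l ((a + b) / 2))"
  have \<sigma>: "\<sigma> \<in> {1, -1}" using nz[of "(a + b) / 2"] ab by (auto simp: \<sigma>_def sgn_if)
  have pos: "0 < \<sigma> * l t" if t: "t \<in> {a<..<b}" for t
  proof (rule ccontr)
    assume neg: "\<not> 0 < \<sigma> * l t"
    have "connected (l ` {a<..<b})"
      using ab by (intro connected_continuous_image continuous_on_subset[OF cont_l]) auto
    moreover have "l t \<in> l ` {a<..<b}" "l ((a + b) / 2) \<in> l ` {a<..<b}" using t ab by auto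
    ultimately have "0 \<in> l ` {a<..<b}"
      using neg unfolding \<sigma>_def connected_iff_interval sgn_if
      by (cases "0 < l ((a + b) / 2)") (auto split: if_splits)
    then show False using nz by auto
  qed
  have "\<theta> t - \<sigma> * K * t = \<theta> a - \<sigma> * K * a" if t: "t \<in> {a..b}" for t
  proof (rule DERIV_isconst2[of a b])
    show "continuous_on {a..b} (\<lambda>t. \<theta> t - \<sigma> * K * t)"
      using ab by (intro continuous_intros continuous_on_subset[OF lipschitz_on_continuous_on[OF lip]]) auto
    fix x assume "a < x" "x < b"
    then have "(\<theta> has_real_derivative \<sigma> * K) (at x)"
      using ab \<sigma> pos by (intro deriv_local) auto
    then show "((\<lambda>t. \<theta> t - \<sigma> * K * t) has_real_derivative 0) (at x)"
      by (auto intro!: derivative_eq_intros)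
  qed (use ab t in auto)
  then have "\<theta> t = \<theta> a + \<sigma> * K * (t - a)" if "t \<in> {a..b}" for t
    using that by (fastforce simp: algebra_simps)
  then show ?thesis using that \<sigma> pos by blast
qed

text \<open>The Hamiltonian of the problem. On a piece of slope \<open>\<sigma> * K\<close> the derivatives of its two terms cancel.\<close>

definition H where "H t = \<rho> * cos (\<theta> t - \<alpha>) + K * \<bar>l t\<bar>"

lemma H_zero_free:
  assumes ab: "0 \<le> a" "a \<le> b" "b \<le> T" and nz: "\<And>t. a < t \<Longrightarrow> t < b \<Longrightarrow> l t \<noteq> 0"
  shows "H b = H a"
proof (cases "a = b")
  case False
  then have "a < b" using ab by simp
  obtain \<sigma> where \<sigma>: "\<sigma> \<in> {1, -1}" and pos: "\<And>t. t \<in> {a<..<b} \<Longrightarrow> 0 < \<sigma> * l t"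
    and lin: "\<And>t. t \<in> {a..b} \<Longrightarrow> \<theta> t = \<theta> a + \<sigma> * K * (t - a)"
    by (rule zero_free_interval[OF ab(1) \<open>a < b\<close> ab(3)]) (rule nz, assumption+, rule that)
  have "continuous_on {a..b} (\<lambda>t. \<sigma> * l t)"
    using ab by (intro continuous_intros continuous_on_subset[OF cont_l]) auto
  then have "continuous_on (closure {a<..<b}) (\<lambda>t. \<sigma> * l t)" using \<open>a < b\<close> by simp
  then have nonneg: "0 \<le> \<sigma> * l t" if "t \<in> {a..b}" for t
    using continuous_ge_on_closure[of "{a<..<b}" "\<lambda>t. \<sigma> * l t" t 0] pos that \<open>a < b\<close>
    by (force simp: less_imp_le)
  define f where "f t = \<rho> * cos (\<theta> a + \<sigma> * K * (t - a) - \<alpha>) + K * (\<sigma> * l t)" for t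
  have H: "H t = f t" if "t \<in> {a..b}" for t
  proof -
    have "\<bar>l t\<bar> = \<sigma> * l t" using nonneg[OF that] \<sigma> by auto
    then show ?thesis using lin[OF that] by (simp add: H_def f_def)
  qed
  have "f b = f a"
  proof (rule DERIV_isconst_end[OF \<open>a < b\<close>])
    show "continuous_on {a..b} f"
      unfolding f_def using ab by (intro continuous_intros continuous_on_subset[OF cont_l]) auto
    fix x assume x: "a < x" "x < b"
    have "(f has_real_derivative
        \<rho> * (- sin (\<theta> a + \<sigma> * K * (x - a) - \<alpha>) * (\<sigma> * K)) + K * (\<sigma> * (\<rho> * sin (\<theta> x - \<alpha>)))) (at x)"
      unfolding f_def using x ab by (auto intro!: derivative_eq_intros deriv_at)
    then show "(f has_real_derivative 0) (at x)" using lin[of x] x by (simp add: algebra_simps)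
  qed
  then show ?thesis using H ab by simp
qed auto

text \<open>Between the first and the last zero \<open>p\<close> and \<open>q\<close> of \<open>l\<close> in \<open>{a..b}\<close> only the cosine can
  change. By Rolle's theorem its argument passes a critical point of the cosine between \<open>p\<close> and
  \<open>q\<close>, so the change is of second order in the length of the interval.\<close>

lemma H_increment:
  assumes ab: "0 \<le> a" "a \<le> b" "b \<le> T"
  shows "\<bar>H b - H a\<bar> \<le> (2 * \<rho> * K\<^sup>2) * (b - a)\<^sup>2"
proof (cases "\<exists>t\<in>{a..b}. l t = 0")
  case False
  then have "H b = H a" using ab by (intro H_zero_free) auto
  then show ?thesis using \<rho> by simp
next
  case True
  define Z where "Z = {t \<in> {a..b}. l t = 0}"
  have "closed Z" unfolding Z_def
    using ab by (intro continuous_closed_preimage_constant continuous_on_subset[OF cont_l]) auto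
  then have Z: "compact Z" "Z \<noteq> {}" using True unfolding Z_def
    by (auto simp: compact_eq_bounded_closed intro: bounded_subset[of "{a..b}"])
  obtain p where p: "p \<in> Z" "\<And>t. t \<in> Z \<Longrightarrow> p \<le> t" using compact_attains_inf[OF Z] by blast
  obtain q where q: "q \<in> Z" "\<And>t. t \<in> Z \<Longrightarrow> t \<le> q" using compact_attains_sup[OF Z] by blast
  have pq: "a \<le> p" "p \<le> q" "q \<le> b" "l p = 0" "l q = 0" using p q by (auto simp: Z_def)
  have "l t \<noteq> 0" if "a < t" "t < p" for t
    using p(2)[of t] that pq by (auto simp: Z_def)
  then have "H p = H a" using pq ab by (intro H_zero_free) auto
  moreover have "l t \<noteq> 0" if "q < t" "t < b" for t
    using q(2)[of t] that pq by (auto simp: Z_def)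
  then have "H b = H q" using pq ab by (intro H_zero_free) auto
  ultimately have eq: "H b - H a = \<rho> * (cos (\<theta> q - \<alpha>) - cos (\<theta> p - \<alpha>))"
    using pq by (simp add: H_def algebra_simps)
  show ?thesis
  proof (cases "p = q")
    case True
    then show ?thesis using eq \<rho> by simp
  next
    case False
    then have "p < q" using pq by simp
    obtain z where z: "p < z" "z < q" "sin (\<theta> z - \<alpha>) = 0"
    proof -
      have "continuous_on {p..q} l" using pq ab by (intro continuous_on_subset[OF cont_l]) auto
      moreover have d: "(l has_real_derivative \<rho> * sin (\<theta> x - \<alpha>)) (at x)" if "p < x" "x < q" for x
        using that pq ab by (intro deriv_at) auto
      ultimately obtain y z where "p < z" "z < q" "(l has_real_derivative y) (at z)" "l q - l p = (q - p) * y"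
        using MVT[OF \<open>p < q\<close>, of l] real_differentiable_def by blast
      then show ?thesis using that d[of z] pq \<rho> DERIV_unique by fastforce
    qed
    have "\<bar>cos (\<theta> s - \<alpha>) - cos (\<theta> z - \<alpha>)\<bar> \<le> K\<^sup>2 * (b - a)\<^sup>2" if s: "s \<in> {p, q}" for s
    proof -
      have "\<bar>\<theta> s - \<theta> z\<bar> \<le> K * \<bar>s - z\<bar>"
        using lipschitz_onD[OF lip, of s z] s z pq ab by (auto simp: dist_real_def)
      also have "\<dots> \<le> K * (b - a)" using s z pq K by (intro mult_left_mono) auto
      finally have "(\<theta> s - \<theta> z)\<^sup>2 \<le> (K * (b - a))\<^sup>2"
        using K ab by (intro power2_le_iff_abs_le[THEN iffD2]) auto
      then show ?thesis
        using cos_near_critical_point[OF z(3), of "\<theta> s - \<alpha>"] by (simp add: power_mult_distrib)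
    qed
    from this[of p] this[of q]
    have "\<bar>cos (\<theta> q - \<alpha>) - cos (\<theta> p - \<alpha>)\<bar> \<le> 2 * K\<^sup>2 * (b - a)\<^sup>2" by simp
    then show ?thesis using \<rho> by (simp add: eq abs_mult)
  qed
qed

lemma H_constant: "t \<in> {0..T} \<Longrightarrow> H t = H 0"
  using quadratic_increments_imp_constant[of 0 t H "2 * \<rho> * K\<^sup>2"] H_increment by simp

lemma cos_eq: "t \<in> {0..T} \<Longrightarrow> cos (\<theta> t - \<alpha>) + K / \<rho> * \<bar>l t\<bar> = H 0 / \<rho>"
  using H_constant[of t] \<rho> by (simp add: H_def field_simps)

text \<open>Since \<open>K * \<bar>l t\<bar>\<close> is the rest of a conserved quantity, the zeros of the switching function
  can be read off from the direction of the curve alone.\<close>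

lemma zero_iff: "t \<in> {0..T} \<Longrightarrow> l t = 0 \<longleftrightarrow> cos (\<theta> t - \<alpha>) = H 0 / \<rho>"
  using cos_eq[of t] K \<rho> by (auto simp: field_simps)

text \<open>At an accumulation point of zeros both \<open>l\<close> and its derivative vanish, and the latter only
  happens where the cosine is \<open>1\<close> or \<open>-1\<close>.\<close>

lemma finite_zeros:
  assumes h: "\<bar>H 0 / \<rho>\<bar> < 1"
  shows "finite {t \<in> {0..T}. l t = 0}"
proof (rule ccontr)
  let ?Z = "{t \<in> {0..T}. l t = 0}"
  assume "infinite ?Z"
  then obtain x where x: "x \<in> {0..T}" "x islimpt ?Z"
    using compact_eq_Bolzano_Weierstrass[of "{0..T}"] by (auto simp: subset_iff)
  have "closed ?Z" by (intro continuous_closed_preimage_constant cont_l; simp)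
  then have "x \<in> ?Z" using x(2) unfolding closed_limpt by blast
  then have "l x = 0" by blast
  then have "cos (\<theta> x - \<alpha>) = H 0 / \<rho>" using zero_iff x by blast
  then have "sin (\<theta> x - \<alpha>) \<noteq> 0" using h by (metis less_irrefl sin_zero_abs_cos_one)
  then have ne: "\<rho> * sin (\<theta> x - \<alpha>) \<noteq> 0" using \<rho> by simp
  have "((\<lambda>y. (l y - l x) / (y - x)) \<longlongrightarrow> \<rho> * sin (\<theta> x - \<alpha>)) (at x within {0..T})"
    using deriv[OF x(1)] by (simp add: has_field_derivative_iff)
  from tendsto_imp_eventually_ne[OF this ne]
  have "eventually (\<lambda>y. (l y - l x) / (y - x) \<noteq> 0) (at x within {0..T})" .
  then have "eventually (\<lambda>y. y \<notin> ?Z) (at x)"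
    unfolding eventually_at_filter by eventually_elim (use \<open>l x = 0\<close> in auto)
  then show False using x(2) by (simp add: islimpt_iff_eventually)
qed

end

definition has_slope :: "(real \<Rightarrow> real) \<Rightarrow> real \<Rightarrow> real \<Rightarrow> real \<Rightarrow> bool" where
  "has_slope \<theta> m a b \<longleftrightarrow> (\<forall>t\<in>{a..b}. \<theta> t = \<theta> a + m * (t - a))"

text \<open>What the multipliers say about \<open>\<theta>\<close> without mentioning them: \<open>h\<close> is the Hamiltonian divided
  by \<open>\<rho>\<close>, and the switching function vanishes exactly where \<open>cos (\<theta> t - \<alpha>)\<close> attains its upper
  bound \<open>h\<close>. Where it does not vanish, the curve is an arc of curvature \<open>K\<close>. For \<open>h < 1\<close> the
  switches are isolated; for \<open>h = 1\<close> the curve may also run straight in direction \<open>\<alpha>\<close>.\<close>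

definition bang_structure :: "real \<Rightarrow> real \<Rightarrow> (real \<Rightarrow> real) \<Rightarrow> real \<Rightarrow> real \<Rightarrow> bool" where
  "bang_structure K T \<theta> \<alpha> h \<longleftrightarrow> - 1 < h \<and> h \<le> 1 \<and>
     (\<forall>t\<in>{0..T}. cos (\<theta> t - \<alpha>) \<le> h) \<and>
     (\<forall>a b. 0 \<le> a \<longrightarrow> a < b \<longrightarrow> b \<le> T \<longrightarrow> (\<forall>t\<in>{a<..<b}. cos (\<theta> t - \<alpha>) < h) \<longrightarrow>
        (\<exists>\<sigma>\<in>{1, -1}. has_slope \<theta> (\<sigma> * K) a b)) \<and>
     (h < 1 \<longrightarrow> finite {t \<in> {0..T}. cos (\<theta> t - \<alpha>) = h})"

text \<open>If the vector multiplier \<open>w\<close> is zero, or if the Hamiltonian exceeds \<open>\<rho>\<close>, then the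
  switching function has no zero and the whole curve is one arc. Otherwise the bound of the
  cosine by the Hamiltonian is sharp at the switches. The bound \<open>-1\<close> is impossible, as the
  direction would be constant.\<close>

theorem minimax_angle_bang_structure:
  assumes \<theta>: "minimax_angle K T \<theta>"
  shows "(\<exists>\<sigma>\<in>{1, -1}. has_slope \<theta> (\<sigma> * K) 0 T) \<or> (\<exists>\<alpha> h. bang_structure K T \<theta> \<alpha> h)"
proof -
  note \<theta>D = minimax_angleD[OF \<theta>]
  obtain \<mu> w where nz: "\<mu> \<noteq> 0 \<or> w \<noteq> 0"
    and opt: "\<And>\<eta>. K-lipschitz_on {0..T} \<eta> \<Longrightarrow> \<eta> 0 = \<theta> 0 \<Longrightarrow>
       0 \<le> \<mu> * (\<eta> T - \<theta> T) + integral {0..T} (\<lambda>t. (\<eta> t - \<theta> t) * (w \<bullet> (\<i> * cis (\<theta> t))))"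
    using minimax_angle_multiplier[OF \<theta>] by blast
  define \<gamma> where "\<gamma> t = w \<bullet> (\<i> * cis (\<theta> t))" for t
  have c\<gamma>: "continuous_on {0..T} \<gamma>" unfolding \<gamma>_def by (intro continuous_intros \<theta>D)
  have bound: "\<bar>\<gamma> t\<bar> \<le> cmod w" for t
    using Cauchy_Schwarz_ineq2[of w "\<i> * cis (\<theta> t)"] by (simp add: \<gamma>_def norm_mult)
  define l where "l t = - (\<mu> + integral {t..T} \<gamma>)" for t
  have slope: "\<theta> t = \<theta> a + \<sigma> * K * (t - a)"
    if "0 \<le> a" "a \<le> b" "b \<le> T" "\<sigma> \<in> {1, -1}" "cmod w * (b - a) < \<sigma> * l b" "t \<in> {a..b}" for a b \<sigma> t
    by (rule extremal_slope[OF \<theta>D(3) c\<gamma> bound opt[folded \<gamma>_def] that(1-4) that(5)[unfolded l_def] that(6)])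
  show ?thesis
  proof (cases "w = 0")
    case True
    then have "l T \<noteq> 0" using nz by (simp add: l_def)
    then have \<sigma>: "sgn (l T) \<in> {1, -1}" "0 < sgn (l T) * l T" by (auto simp: sgn_if)
    have "has_slope \<theta> (sgn (l T) * K) 0 T"
      unfolding has_slope_def
    proof
      fix t assume "t \<in> {0..T}"
      then show "\<theta> t = \<theta> 0 + sgn (l T) * K * (t - 0)"
        using slope[of 0 T "sgn (l T)" t] \<sigma> True \<theta>D(1) by simp
    qed
    then show ?thesis using \<sigma>(1) by blast
  next
    case False
    define \<rho> where "\<rho> = cmod w"
    have \<rho>: "0 < \<rho>" using False by (simp add: \<rho>_def)
    \<comment> \<open>The opposite of the direction of \<open>w\<close>, which turns \<open>w \<bullet> (\<i> * cis x)\<close> into \<open>\<rho> * sin (x -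
      \<alpha>)\<close>.\<close>
    define \<alpha> where "\<alpha> = Arg w + pi"
    have w: "Re w = \<rho> * cos (Arg w)" "Im w = \<rho> * sin (Arg w)"
      using Re_rcis[of \<rho> "Arg w"] Im_rcis[of \<rho> "Arg w"] by (simp_all add: \<rho>_def rcis_cmod_Arg)
    have \<gamma>: "\<gamma> t = \<rho> * sin (\<theta> t - \<alpha>)" for t
      by (simp add: \<gamma>_def \<alpha>_def inner_complex_def w sin_diff cos_add sin_add algebra_simps)
    have deriv: "(l has_real_derivative \<rho> * sin (\<theta> t - \<alpha>)) (at t within {0..T})" if "t \<in> {0..T}" for t
    proof -
      have "((\<lambda>u. integral {u..T} \<gamma>) has_real_derivative - \<gamma> t) (at t within {0..T})"
        using integral_has_vector_derivative'[OF c\<gamma> that]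
        by (simp add: has_real_derivative_iff_has_vector_derivative)
      then show ?thesis unfolding l_def \<gamma>[symmetric] by (auto intro!: derivative_eq_intros)
    qed
    interpret multiplier K T \<rho> \<alpha> \<theta> l
      using \<theta>D \<rho> deriv slope[folded \<rho>_def] by unfold_locales blast+
    define h where "h = H 0 / \<rho>"
    have cos_le: "cos (\<theta> t - \<alpha>) \<le> h" if "t \<in> {0..T}" for t
    proof -
      have "0 \<le> K / \<rho> * \<bar>l t\<bar>" using K \<rho> by simp
      then show ?thesis using cos_eq[OF that] by (simp add: h_def)
    qed
    have zero: "l t = 0 \<longleftrightarrow> cos (\<theta> t - \<alpha>) = h" if "t \<in> {0..T}" for t
      using zero_iff[OF that] by (simp add: h_def)
    have piece: "\<exists>\<sigma>\<in>{1, -1}. has_slope \<theta> (\<sigma> * K) a b"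
      if ab: "0 \<le> a" "a < b" "b \<le> T" and lt: "\<forall>t\<in>{a<..<b}. cos (\<theta> t - \<alpha>) < h" for a b
    proof -
      have "l t \<noteq> 0" if "a < t" "t < b" for t using lt zero[of t] that ab by auto
      from zero_free_interval[OF ab this] show ?thesis unfolding has_slope_def by metis
    qed
    show ?thesis
    proof (cases "h \<le> 1")
      case False
      then have "\<forall>t\<in>{0<..<T}. cos (\<theta> t - \<alpha>) < h" using cos_le_one by (meson le_less_trans not_le)
      from piece[OF order.refl T order.refl this] show ?thesis by blast
    next
      case True
      have "- 1 < h"
      proof (rule ccontr)
        assume "\<not> - 1 < h"
        then have "cos (\<theta> t - \<alpha>) = - 1" if "t \<in> {0..T}" for t
          using cos_le[OF that] cos_ge_minus_one[of "\<theta> t - \<alpha>"] by linarith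
        then have "cis (\<theta> t - \<alpha>) = - 1" if "t \<in> {0..T}" for t
          using that sin_cos_squared_add[of "\<theta> t - \<alpha>"] by (auto simp: complex_eq_iff)
        then have "cis (\<theta> t) = - cis \<alpha>" if "t \<in> {0..T}" for t
          using that cis_mult[of "\<theta> t - \<alpha>" \<alpha>] by simp
        then show False using minimax_angle_not_constant[OF \<theta>] unfolding constant_on_def by blast
      qed
      moreover have "finite {t \<in> {0..T}. cos (\<theta> t - \<alpha>) = h}" if "h < 1"
      proof -
        have "finite {t \<in> {0..T}. l t = 0}"
          using finite_zeros that \<open>- 1 < h\<close> by (auto simp: h_def[symmetric] abs_less_iff)
        moreover have "{t \<in> {0..T}. cos (\<theta> t - \<alpha>) = h} = {t \<in> {0..T}. l t = 0}" using zero by auto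
        ultimately show ?thesis by simp
      qed
      ultimately have "bang_structure K T \<theta> \<alpha> h"
        unfolding bang_structure_def using True cos_le piece by blast
      then show ?thesis by blast
    qed
  qed
qed

section \<open>Rearranging a minimizer\<close>

lemma has_slopeD: "has_slope \<theta> m a b \<Longrightarrow> t \<in> {a..b} \<Longrightarrow> \<theta> t = \<theta> a + m * (t - a)"
  unfolding has_slope_def by blast

lemma has_slope_diff:
  assumes "has_slope \<theta> m a b" "s \<in> {a..b}" "t \<in> {a..b}"
  shows "\<theta> t = \<theta> s + m * (t - s)"
  using has_slopeD[OF assms(1,2)] has_slopeD[OF assms(1,3)] by (simp add: algebra_simps)

lemma has_slope_subset:
  assumes "has_slope \<theta> m a b" "a \<le> c" "d \<le> b"
  shows "has_slope \<theta> m c d"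
  unfolding has_slope_def by (intro ballI has_slope_diff[OF assms(1)]) (use assms in auto)

lemma has_slope_join:
  assumes "has_slope \<theta> m a b" "has_slope \<theta> m b c" "a \<le> b" "b \<le> c"
  shows "has_slope \<theta> m a c"
  unfolding has_slope_def
proof
  fix t assume t: "t \<in> {a..c}"
  show "\<theta> t = \<theta> a + m * (t - a)"
  proof (cases "t \<le> b")
    case True
    then show ?thesis using has_slopeD[OF assms(1), of t] t by auto
  next
    case False
    then have "\<theta> t = \<theta> b + m * (t - b)" using has_slopeD[OF assms(2), of t] t by auto
    moreover have "\<theta> b = \<theta> a + m * (b - a)" using has_slopeD[OF assms(1), of b] assms(3) by auto
    ultimately show ?thesis by (simp add: algebra_simps)
  qed
qed

lemma has_slopeI:
  assumes "\<And>t. t \<in> {a..b} \<Longrightarrow> \<theta> t = c + m * (t - a)"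
  shows "has_slope \<theta> m a b"
proof (cases "a \<le> b")
  case True
  then have "\<theta> a = c" using assms[of a] by simp
  then show ?thesis using assms by (simp add: has_slope_def)
qed (simp add: has_slope_def)

lemma has_slope_unique:
  assumes "has_slope \<theta> m a b" "has_slope \<theta> m' a b" "a < b"
  shows "m = m'"
proof -
  have "\<theta> b = \<theta> a + m * (b - a)" "\<theta> b = \<theta> a + m' * (b - a)"
    using has_slopeD[OF assms(1), of b] has_slopeD[OF assms(2), of b] assms(3) by auto
  then have "m * (b - a) = m' * (b - a)" by linarith
  then show ?thesis using assms(3) by simp
qed

text \<open>The direction is constantly \<open>cis \<alpha>\<close>, so the angle is constant.\<close>

lemma has_slope_at_crest:
  assumes \<theta>: "continuous_on {p..q} \<theta>" and one: "\<And>t. t \<in> {p<..<q} \<Longrightarrow> cos (\<theta> t - \<alpha>) = 1"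
  shows "has_slope \<theta> 0 p q"
  unfolding has_slope_def
proof
  fix t assume t: "t \<in> {p..q}"
  show "\<theta> t = \<theta> p + 0 * (t - p)"
  proof (cases "p < q")
    case True
    have "\<theta> t - \<alpha> = \<theta> p - \<alpha>"
    proof (rule cis_eq_imp_constant_difference[OF \<theta> continuous_on_const _ True t])
      show "cis (\<theta> t) = cis \<alpha>" if "t \<in> {p<..<q}" for t
        using cis_eq_of_crests[of "\<theta> t" \<alpha> \<alpha>] one[OF that] by simp
    qed
    then show ?thesis by simp
  next
    case False
    then have "t = p" using t by simp
    then show ?thesis by simp
  qed
qed

lemma integral_reverse:
  fixes f :: "real \<Rightarrow> 'a::euclidean_space"
  shows "integral {a..b} (\<lambda>t. f (a + b - t)) = integral {a..b} f"
proof -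
  have "integral {a..b} (\<lambda>t. f (- (t + (- (a + b)))))
      = integral {- b - (- (a + b))..- a - (- (a + b))} (\<lambda>t. f (- (t + (- (a + b)))))"
    by simp
  also have "\<dots> = integral {- b..- a} (\<lambda>t. f (- t))"
    by (rule integral_shift_real_ivl)
  also have "\<dots> = integral {a..b} f" by (rule Henstock_Kurzweil_Integration.integral_reflect_real)
  finally show ?thesis by (simp add: algebra_simps)
qed

lemma lipschitz_on_reverse:
  fixes f :: "real \<Rightarrow> 'a::metric_space"
  assumes "K-lipschitz_on {a..b} f"
  shows "K-lipschitz_on {a..b} (\<lambda>t. f (a + b - t))"
proof (rule lipschitz_onI)
  fix s t assume "s \<in> {a..b}" "t \<in> {a..b}"
  then show "dist (f (a + b - s)) (f (a + b - t)) \<le> K * dist s t"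
    using lipschitz_onD[OF assms, of "a + b - s" "a + b - t"] by (simp add: dist_real_def abs_minus_commute)
qed (rule lipschitz_on_nonneg[OF assms])

text \<open>Reversing time swaps the end directions and keeps the integral. Statements about the
  beginning of a curve thereby yield statements about its end.\<close>

lemma minimax_angle_reverse:
  assumes \<theta>: "minimax_angle K T \<theta>"
  shows "minimax_angle K T (\<lambda>t. \<theta> (T - t))"
  unfolding minimax_angle_def
proof (intro conjI allI impI notI)
  show "K-lipschitz_on {0..T} (\<lambda>t. \<theta> (T - t))"
    using lipschitz_on_reverse[OF minimax_angleD(3)[OF \<theta>]] by simp
  fix K' \<eta> assume K': "K' < K" and \<eta>: "K'-lipschitz_on {0..T} \<eta>"
    and se: "same_ends T \<eta> (\<lambda>t. \<theta> (T - t))"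
  have "K'-lipschitz_on {0..T} (\<lambda>t. \<eta> (T - t))" using lipschitz_on_reverse[OF \<eta>] by simp
  moreover have "same_ends T (\<lambda>t. \<eta> (T - t)) \<theta>"
    using se integral_reverse[of 0 T "\<lambda>t. cis (\<eta> t)"] integral_reverse[of 0 T "\<lambda>t. cis (\<theta> t)"]
    by (simp add: same_ends_def)
  ultimately show False using \<theta> K' unfolding minimax_angle_def by blast
qed (use minimax_angleD[OF \<theta>] in auto)

text \<open>Between two times at which the angle has the same value, the angle can be traversed
  backwards: it stays Lipschitz, and the integral of the direction does not depend on the order
  in which the directions occur.\<close>

lemma minimax_angle_reverse_segment:
  assumes \<theta>: "minimax_angle K T \<theta>" and ab: "0 \<le> a" "a \<le> b" "b \<le> T" and eq: "\<theta> a = \<theta> b"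
  shows "minimax_angle K T (\<lambda>t. if t \<le> a then \<theta> t else if t \<le> b then \<theta> (a + b - t) else \<theta> t)"
    (is "minimax_angle K T ?\<eta>")
proof (rule same_ends_minimax[OF \<theta>])
  note lip = minimax_angleD(3)[OF \<theta>]
  have "K-lipschitz_on {a..b} (\<lambda>t. \<theta> (a + b - t))"
    using ab by (intro lipschitz_on_reverse lipschitz_on_subset[OF lip]) auto
  moreover have "K-lipschitz_on {b..T} \<theta>" "K-lipschitz_on {0..a} \<theta>"
    using ab by (auto intro: lipschitz_on_subset[OF lip])
  ultimately show \<eta>: "K-lipschitz_on {0..T} ?\<eta>"
    using eq ab by (intro lipschitz_on_concat) auto
  have "integral {0..T} (\<lambda>t. cis (?\<eta> t))
    = integral {0..a} (\<lambda>t. cis (?\<eta> t)) + integral {a..b} (\<lambda>t. cis (?\<eta> t)) + integral {b..T} (\<lambda>t. cis (?\<eta> t))"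
    by (rule integral_split3[OF continuous_on_cis_comp[OF lipschitz_on_continuous_on[OF \<eta>]] ab])
  also have "integral {0..a} (\<lambda>t. cis (?\<eta> t)) = integral {0..a} (\<lambda>t. cis (\<theta> t))"
    by (intro integral_cong) auto
  also have "integral {a..b} (\<lambda>t. cis (?\<eta> t)) = integral {a..b} (\<lambda>t. cis (\<theta> (a + b - t)))"
    using eq by (intro integral_cong) auto
  also have "\<dots> = integral {a..b} (\<lambda>t. cis (\<theta> t))" by (rule integral_reverse)
  also have "integral {b..T} (\<lambda>t. cis (?\<eta> t)) = integral {b..T} (\<lambda>t. cis (\<theta> t))"
    using ab eq by (intro integral_cong) auto
  also have "integral {0..a} (\<lambda>t. cis (\<theta> t)) + integral {a..b} (\<lambda>t. cis (\<theta> t)) + integral {b..T} (\<lambda>t. cis (\<theta> t))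
      = integral {0..T} (\<lambda>t. cis (\<theta> t))"
    by (rule integral_split3[symmetric, OF minimax_angleD(5)[OF \<theta>] ab])
  finally show "same_ends T ?\<eta> \<theta>" unfolding same_ends_def using ab eq by auto
qed

lemma cis_add_2pi_int: "cis (x + 2 * pi * of_int k) = cis x"
proof -
  have "cis (2 * pi * of_int k) = 1" by (rule cis_multiple_2pi) simp
  then show ?thesis by (simp flip: cis_mult)
qed

lemma integral_cis_linear:
  fixes c m a t :: real
  assumes "m \<noteq> 0" "a \<le> t"
  shows "integral {a..t} (\<lambda>r. cis (c + m * (r - a))) = (- \<i> / of_real m) * (cis (c + m * (t - a)) - cis c)"
proof -
  define F where "F t = - \<i> / of_real m * cis (c + m * (t - a))" for t
  have "((\<lambda>t. cis (c + m * (t - a))) has_integral F t - F a) {a..t}"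
  proof (rule fundamental_theorem_of_calculus)
    fix u
    have "((\<lambda>z. exp (\<i> * (of_real c + of_real m * (z - of_real a)))) has_field_derivative
        exp (\<i> * (of_real c + of_real m * (of_real u - of_real a))) * (\<i> * of_real m)) (at (of_real u))"
      by (auto intro!: derivative_eq_intros)
    from DERIV_cmult[OF this, of "- \<i> / of_real m"]
    have "((\<lambda>z. - \<i> / of_real m * exp (\<i> * (of_real c + of_real m * (z - of_real a)))) has_field_derivative
        exp (\<i> * (of_real c + of_real m * (of_real u - of_real a)))) (at (of_real u))"
      using assms(1) by (simp add: field_simps)
    from has_vector_derivative_real_field[OF this, of "{a..t}"]
    show "(F has_vector_derivative cis (c + m * (u - a))) (at u within {a..t})"
      by (simp add: F_def[abs_def] cis_conv_exp)
  qed (use assms in simp)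
  then show ?thesis by (simp add: F_def integral_unique right_diff_distrib)
qed

lemma integral_cis_full_turn:
  fixes m c s L :: real and k :: int
  assumes "m * L = 2 * pi * of_int k" "m \<noteq> 0" "0 \<le> L"
  shows "integral {s..s + L} (\<lambda>t. cis (c + m * (t - s))) = 0"
  using integral_cis_linear[OF assms(2), of s "s + L" c] assms(1,3) cis_add_2pi_int[of c k] by simp

text \<open>A stretch on which the direction integrates to zero and the angle changes by a multiple of
  \<open>2 * pi\<close> contributes nothing to the data. It can be cut out of \<open>{a..b}\<close> and replaced by any
  other closed loop of the same length inserted at an earlier time \<open>s\<close>, here one of slope \<open>m\<close>;
  the rest of the angle is shifted in time and by multiples of \<open>2 * pi\<close>. The freedom in \<open>m\<close> is
  essential: a loop may change its sense of rotation, and a double loop may be unrolled into a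
  simple loop of half the curvature.\<close>

lemma minimax_angle_move_loop:
  fixes j k :: int
  assumes \<theta>: "minimax_angle K T \<theta>"
    and sab: "0 \<le> s" "s \<le> a" "a \<le> b" "b \<le> T"
    and loop: "\<theta> b = \<theta> a + 2 * pi * of_int j" "integral {a..b} (\<lambda>t. cis (\<theta> t)) = 0"
    and m: "\<bar>m\<bar> \<le> K" "m \<noteq> 0" "m * (b - a) = 2 * pi * of_int k"
  shows "\<exists>\<eta>. minimax_angle K T \<eta> \<and> (\<forall>t\<in>{0..s}. \<eta> t = \<theta> t) \<and>
    (\<forall>t\<in>{s..s + (b - a)}. \<eta> t = \<theta> s + m * (t - s)) \<and>
    (\<forall>t\<in>{s + (b - a)..b}. \<eta> t = \<theta> (t - (b - a)) + 2 * pi * of_int k) \<and>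
    (\<forall>t\<in>{b..T}. \<eta> t = \<theta> t + 2 * pi * of_int (k - j))"
proof -
  note lip = minimax_angleD(3)[OF \<theta>]
  note K = minimax_angleD(2)[OF \<theta>]
  define L where "L = b - a"
  have L: "0 \<le> L" "s + L \<le> b" "b \<le> T" "0 \<le> s" using sab by (auto simp: L_def)
  define \<eta> where "\<eta> t = (if t \<le> s then \<theta> t else if t \<le> s + L then \<theta> s + m * (t - s)
    else if t \<le> b then \<theta> (t - L) + 2 * pi * of_int k else \<theta> t + 2 * pi * of_int (k - j))" for t
  have l2: "K-lipschitz_on {s..s + L} (\<lambda>t. \<theta> s + m * (t - s))"
  proof (rule lipschitz_onI)
    fix x y
    have "\<bar>m * (x - y)\<bar> \<le> K * \<bar>x - y\<bar>" using m(1) by (simp add: abs_mult mult_right_mono)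
    then show "dist (\<theta> s + m * (x - s)) (\<theta> s + m * (y - s)) \<le> K * dist x y"
      by (simp add: dist_real_def algebra_simps)
  qed (use K in simp)
  have l3: "K-lipschitz_on {s + L..b} (\<lambda>t. \<theta> (t - L) + 2 * pi * of_int k)"
  proof (rule lipschitz_onI)
    fix x y assume "x \<in> {s + L..b}" "y \<in> {s + L..b}"
    then show "dist (\<theta> (x - L) + 2 * pi * of_int k) (\<theta> (y - L) + 2 * pi * of_int k) \<le> K * dist x y"
      using lipschitz_onD[OF lip, of "x - L" "y - L"] L sab by (auto simp: dist_real_def)
  qed (use K in simp)
  have l4: "K-lipschitz_on {b..T} (\<lambda>t. \<theta> t + 2 * pi * of_int (k - j))"
  proof (rule lipschitz_onI)
    fix x y assume "x \<in> {b..T}" "y \<in> {b..T}"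
    then show "dist (\<theta> x + 2 * pi * of_int (k - j)) (\<theta> y + 2 * pi * of_int (k - j)) \<le> K * dist x y"
      using lipschitz_onD[OF lip, of x y] L sab by (auto simp: dist_real_def)
  qed (use K in simp)
  have l1: "K-lipschitz_on {0..s} \<theta>" using sab by (intro lipschitz_on_subset[OF lip]) auto
  have mL: "m * L = 2 * pi * of_int k" using m by (simp add: L_def)
  have glue: "\<theta> (b - L) + 2 * pi * of_int k = \<theta> b + 2 * pi * of_int (k - j)"
    using loop(1) by (simp add: L_def algebra_simps)
  have "K-lipschitz_on {s + L..T} (\<lambda>t. if t \<le> b then \<theta> (t - L) + 2 * pi * of_int k
      else \<theta> t + 2 * pi * of_int (k - j))"
    by (rule lipschitz_on_concat[OF l3 l4 glue])
  from lipschitz_on_concat[OF l2 this]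
  have "K-lipschitz_on {s..T} (\<lambda>t. if t \<le> s + L then \<theta> s + m * (t - s) else
      if t \<le> b then \<theta> (t - L) + 2 * pi * of_int k else \<theta> t + 2 * pi * of_int (k - j))"
    using L mL by simp
  from lipschitz_on_concat[OF l1 this]
  have \<eta>: "K-lipschitz_on {0..T} \<eta>" unfolding \<eta>_def using L by simp
  have p1: "\<forall>t\<in>{0..s}. \<eta> t = \<theta> t" by (simp add: \<eta>_def)
  have p2: "\<forall>t\<in>{s..s + L}. \<eta> t = \<theta> s + m * (t - s)" by (auto simp: \<eta>_def)
  have p3: "\<forall>t\<in>{s + L..b}. \<eta> t = \<theta> (t - L) + 2 * pi * of_int k"
    using mL L by (auto simp: \<eta>_def)
  have p4: "\<forall>t\<in>{b..T}. \<eta> t = \<theta> t + 2 * pi * of_int (k - j)"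
  proof
    fix t assume t: "t \<in> {b..T}"
    show "\<eta> t = \<theta> t + 2 * pi * of_int (k - j)"
    proof (cases "t = b")
      case True
      then show ?thesis using p3 L glue by auto
    next
      case False
      then show ?thesis using t L by (auto simp: \<eta>_def)
    qed
  qed
  have c\<eta>: "continuous_on {0..T} (\<lambda>t. cis (\<eta> t))"
    by (intro continuous_on_cis_comp lipschitz_on_continuous_on[OF \<eta>])
  have c\<theta>: "continuous_on {c..d} (\<lambda>t. cis (\<theta> t))" if "0 \<le> c" "d \<le> T" for c d
    using that by (intro continuous_on_subset[OF minimax_angleD(5)[OF \<theta>]]) auto
  have "integral {0..T} (\<lambda>t. cis (\<eta> t)) = integral {0..s} (\<lambda>t. cis (\<eta> t))
      + integral {s..s + L} (\<lambda>t. cis (\<eta> t)) + integral {s + L..T} (\<lambda>t. cis (\<eta> t))"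
    using L by (intro integral_split3[OF c\<eta>]) auto
  also have "integral {0..s} (\<lambda>t. cis (\<eta> t)) = integral {0..s} (\<lambda>t. cis (\<theta> t))"
    using p1 by (intro integral_cong) auto
  also have "integral {s..s + L} (\<lambda>t. cis (\<eta> t)) = integral {s..s + L} (\<lambda>t. cis (\<theta> s + m * (t - s)))"
    using p2 by (intro integral_cong) auto
  also have "\<dots> = 0" by (rule integral_cis_full_turn[OF mL m(2) L(1)])
  also have "integral {s + L..T} (\<lambda>t. cis (\<eta> t))
     = integral {s + L..b} (\<lambda>t. cis (\<eta> t)) + integral {b..T} (\<lambda>t. cis (\<eta> t))"
    using L by (intro Henstock_Kurzweil_Integration.integral_combine[symmetric]
        integrable_continuous_real continuous_on_subset[OF c\<eta>]) auto
  also have "integral {s + L..b} (\<lambda>t. cis (\<eta> t)) = integral {s + L..b} (\<lambda>t. cis (\<theta> (t + (- L))))"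
    using p3 by (intro integral_cong) (simp add: cis_add_2pi_int)
  also have "\<dots> = integral {s..a} (\<lambda>t. cis (\<theta> t))"
    using integral_shift_real_ivl[of s "- L" a "\<lambda>t. cis (\<theta> t)"] by (simp add: L_def algebra_simps)
  also have "integral {b..T} (\<lambda>t. cis (\<eta> t)) = integral {b..T} (\<lambda>t. cis (\<theta> t))"
  proof (intro integral_cong)
    fix t assume "t \<in> {b..T}"
    then have "\<eta> t = \<theta> t + 2 * pi * of_int (k - j)" using p4 by blast
    then show "cis (\<eta> t) = cis (\<theta> t)" by (simp only: cis_add_2pi_int)
  qed
  also have "integral {0..s} (\<lambda>t. cis (\<theta> t)) + 0
      + (integral {s..a} (\<lambda>t. cis (\<theta> t)) + integral {b..T} (\<lambda>t. cis (\<theta> t)))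
      = integral {0..T} (\<lambda>t. cis (\<theta> t))"
    using integral_split3[OF c\<theta>[of 0 T], of a b] sab loop(2)
      Henstock_Kurzweil_Integration.integral_combine[OF sab(1,2)
        integrable_continuous_real[OF c\<theta>[of 0 a]]] by simp
  finally have int: "integral {0..T} (\<lambda>t. cis (\<eta> t)) = integral {0..T} (\<lambda>t. cis (\<theta> t))" .
  have "\<eta> T = \<theta> T + 2 * pi * of_int (k - j)" using p4 sab by auto
  then have "cis (\<eta> T) = cis (\<theta> T)" by (simp only: cis_add_2pi_int)
  then have "same_ends T \<eta> \<theta>" using int p1 sab by (simp add: same_ends_def)
  from same_ends_minimax[OF \<theta> \<eta> this] show ?thesis
    using p1 p2 p3 p4 unfolding L_def by blast
qed

section \<open>Excluded slopes and loops\<close>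

text \<open>On less than a full period the cosine takes a value twice only symmetrically about a
  critical point.\<close>

lemma cos_eq_shift_imp:
  fixes x y :: real
  assumes "cos x = cos (x + y)" "0 < \<bar>y\<bar>" "\<bar>y\<bar> < 2 * pi"
  shows "sin (x + y / 2) = 0"
proof -
  have "cos (x + y) - cos x = - 2 * (sin (x + y / 2) * sin (y / 2))"
    using cos_diff_cos[of "x + y" x] by (simp add: field_simps minus_mult_left[symmetric])
  moreover have "sin (y / 2) \<noteq> 0"
    using sin_zero_pi_iff[of "y / 2"] assms by auto
  ultimately show ?thesis using assms(1) by simp
qed

lemma bang_structureD:
  assumes "bang_structure K T \<theta> \<alpha> h"
  shows "- 1 < h" "h \<le> 1" "\<And>t. t \<in> {0..T} \<Longrightarrow> cos (\<theta> t - \<alpha>) \<le> h"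
    "\<And>a b. 0 \<le> a \<Longrightarrow> a < b \<Longrightarrow> b \<le> T \<Longrightarrow> \<forall>t\<in>{a<..<b}. cos (\<theta> t - \<alpha>) < h \<Longrightarrow>
       \<exists>\<sigma>\<in>{1, -1}. has_slope \<theta> (\<sigma> * K) a b"
    "h < 1 \<Longrightarrow> finite {t \<in> {0..T}. cos (\<theta> t - \<alpha>) = h}"
  using assms unfolding bang_structure_def by blast+

lemma bang_structure_local:
  assumes S: "bang_structure K T \<theta> \<alpha> h" and \<theta>: "continuous_on {0..T} \<theta>"
    and t: "0 \<le> a" "a < t" "t < b" "b \<le> T" and ne: "cos (\<theta> t - \<alpha>) \<noteq> h"
  obtains c d \<sigma> where "a < c" "c < t" "t < d" "d < b" "\<sigma> \<in> {1, -1}" "has_slope \<theta> (\<sigma> * K) c d"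
proof -
  have "continuous_on {a<..<b} (\<lambda>s. cos (\<theta> s - \<alpha>))"
    using t by (intro continuous_intros continuous_on_subset[OF \<theta>]) auto
  then have "open ({a<..<b} \<inter> (\<lambda>s. cos (\<theta> s - \<alpha>)) -` {..<h})"
    by (subst (asm) continuous_on_open_vimage[OF open_greaterThanLessThan])
      (use open_lessThan in \<open>auto simp: Int_commute\<close>)
  moreover have "t \<in> {a<..<b} \<inter> (\<lambda>s. cos (\<theta> s - \<alpha>)) -` {..<h}"
    using bang_structureD(3)[OF S, of t] ne t by auto
  ultimately obtain e where e: "0 < e"
    "ball t e \<subseteq> {a<..<b} \<inter> (\<lambda>s. cos (\<theta> s - \<alpha>)) -` {..<h}"
    unfolding open_contains_ball by blast
  define c where "c = t - e / 2"
  define d where "d = t + e / 2"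
  have cd: "{c..d} \<subseteq> ball t e" using e(1) by (auto simp: c_def d_def dist_real_def)
  have sub: "a < s \<and> s < b \<and> cos (\<theta> s - \<alpha>) < h" if s: "s \<in> {c..d}" for s
  proof -
    have "s \<in> ball t e" using cd s by blast
    then have "s \<in> {a<..<b} \<inter> (\<lambda>s. cos (\<theta> s - \<alpha>)) -` {..<h}" using e(2) by blast
    then show ?thesis by simp
  qed
  have le: "c < t" "t < d" using e(1) by (auto simp: c_def d_def)
  then have "a < c" "d < b" using sub[of c] sub[of d] by auto
  moreover obtain \<sigma> where "\<sigma> \<in> {1, -1}" "has_slope \<theta> (\<sigma> * K) c d"
    using bang_structureD(4)[OF S, of c d] sub calculation le t by fastforce
  ultimately show ?thesis using that le by blast
qed

text \<open>Either \<open>cos (\<theta> t - \<alpha>)\<close> is below its bound somewhere, which fixes the slope nearby, or it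
  attains the bound throughout, which the finiteness of the switches permits for \<open>h = 1\<close> only.\<close>

lemma bang_structure_slope_cases:
  assumes S: "bang_structure K T \<theta> \<alpha> h" and \<theta>: "continuous_on {0..T} \<theta>"
    and ab: "0 \<le> a" "a < b" "b \<le> T" and s: "has_slope \<theta> m a b"
  shows "m \<in> {K, - K} \<or> h = 1 \<and> (\<forall>t\<in>{a<..<b}. cos (\<theta> t - \<alpha>) = 1)"
proof (cases "\<forall>t\<in>{a<..<b}. cos (\<theta> t - \<alpha>) = h")
  case True
  have "h = 1"
  proof (rule ccontr)
    assume "h \<noteq> 1"
    then have "finite {t \<in> {0..T}. cos (\<theta> t - \<alpha>) = h}"
      using bang_structureD(2,5)[OF S] by linarith
    moreover have "{a<..<b} \<subseteq> {t \<in> {0..T}. cos (\<theta> t - \<alpha>) = h}" using True ab by auto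
    ultimately have "finite {a<..<b}" by (rule finite_subset[rotated])
    then show False using ab(2) infinite_Ioo by blast
  qed
  then show ?thesis using True by simp
next
  case False
  then obtain t where t: "a < t" "t < b" "cos (\<theta> t - \<alpha>) \<noteq> h" by auto
  obtain c d \<sigma> where cd: "a < c" "c < t" "t < d" "d < b" "\<sigma> \<in> {1, -1}" "has_slope \<theta> (\<sigma> * K) c d"
    by (rule bang_structure_local[OF S \<theta> ab(1) t(1,2) ab(3) t(3)])
  have "has_slope \<theta> m c d" using has_slope_subset[OF s] cd by auto
  then have "m = \<sigma> * K" using has_slope_unique cd by (metis less_trans)
  then show ?thesis using cd(5) by auto
qed

text \<open>This rules out configurations: it suffices to rearrange a minimizer so that some other
  slope occurs.\<close>

lemma minimax_angle_slope_values:
  assumes \<theta>: "minimax_angle K T \<theta>" and ab: "0 \<le> a" "a < b" "b \<le> T" and s: "has_slope \<theta> m a b"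
  shows "m \<in> {0, K, - K}"
  using minimax_angle_bang_structure[OF \<theta>]
proof (elim disjE exE bexE)
  fix \<sigma> :: real assume \<sigma>: "\<sigma> \<in> {1, -1}" "has_slope \<theta> (\<sigma> * K) 0 T"
  have "has_slope \<theta> (\<sigma> * K) a b" using has_slope_subset[OF \<sigma>(2)] ab by auto
  then have "m = \<sigma> * K" using has_slope_unique[OF s] ab by blast
  then show ?thesis using \<sigma>(1) by auto
next
  fix \<alpha> h assume "bang_structure K T \<theta> \<alpha> h"
  from bang_structure_slope_cases[OF this minimax_angleD(4)[OF \<theta>] ab s]
  show ?thesis
  proof
    assume "h = 1 \<and> (\<forall>t\<in>{a<..<b}. cos (\<theta> t - \<alpha>) = 1)"
    then have "has_slope \<theta> 0 a b"
      using ab by (intro has_slope_at_crest continuous_on_subset[OF minimax_angleD(4)[OF \<theta>]]) auto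
    then have "m = 0" using has_slope_unique[OF s] ab by blast
    then show ?thesis by simp
  qed simp
qed

lemma bang_structure_flat:
  assumes K: "0 < K" and S: "bang_structure K T \<theta> \<alpha> h" and \<theta>: "continuous_on {0..T} \<theta>"
    and ab: "0 \<le> a" "a < b" "b \<le> T" and s: "has_slope \<theta> 0 a b"
  shows "h = 1" "cos (\<theta> a - \<alpha>) = 1"
proof -
  have all: "h = 1 \<and> (\<forall>t\<in>{a<..<b}. cos (\<theta> t - \<alpha>) = 1)"
    using bang_structure_slope_cases[OF S \<theta> ab s] K by auto
  then show "h = 1" by simp
  have "\<theta> ((a + b) / 2) = \<theta> a" using has_slopeD[OF s, of "(a + b) / 2"] ab by auto
  then show "cos (\<theta> a - \<alpha>) = 1" using bspec[OF conjunct2[OF all], of "(a + b) / 2"] ab by auto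
qed

text \<open>Off the switches the angle has only one slope locally.\<close>

lemma bang_structure_corner:
  assumes \<theta>: "minimax_angle K T \<theta>" and S: "bang_structure K T \<theta> \<alpha> h"
    and ct: "0 \<le> c" "c < t" "t < d" "d \<le> T"
    and s: "has_slope \<theta> m c t" "has_slope \<theta> m' t d" "m \<noteq> m'"
  shows "cos (\<theta> t - \<alpha>) = h"
proof (rule ccontr)
  assume ne: "cos (\<theta> t - \<alpha>) \<noteq> h"
  obtain c' d' \<sigma> where cd: "c < c'" "c' < t" "t < d'" "d' < d" "has_slope \<theta> (\<sigma> * K) c' d'"
    by (rule bang_structure_local[OF S minimax_angleD(4)[OF \<theta>] ct ne])
  have "has_slope \<theta> m c' t" "has_slope \<theta> m' t d'"
    using has_slope_subset s cd by (meson order.strict_implies_order order.refl)+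
  moreover have "has_slope \<theta> (\<sigma> * K) c' t" "has_slope \<theta> (\<sigma> * K) t d'"
    using has_slope_subset cd by (meson order.strict_implies_order order.refl)+
  ultimately show False using has_slope_unique cd s(3) by metis
qed

lemma minimax_angle_corner_structure:
  assumes \<theta>: "minimax_angle K T \<theta>" and ct: "0 \<le> c" "c < t" "t < d" "d \<le> T"
    and s: "has_slope \<theta> m c t" "has_slope \<theta> m' t d" "m \<noteq> m'"
  obtains \<alpha> h where "bang_structure K T \<theta> \<alpha> h"
proof -
  have False if \<sigma>: "has_slope \<theta> \<sigma> 0 T" for \<sigma>
  proof -
    have "has_slope \<theta> \<sigma> c t" "has_slope \<theta> \<sigma> t d" using has_slope_subset[OF \<sigma>] ct by auto
    then show False using has_slope_unique s ct by metis
  qed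
  then show ?thesis using minimax_angle_bang_structure[OF \<theta>] that by blast
qed

lemma has_slope_full_turn_integral:
  assumes "has_slope \<theta> m a b" "m * (b - a) = 2 * pi * of_int k" "m \<noteq> 0" "a \<le> b"
  shows "integral {a..b} (\<lambda>t. cis (\<theta> t)) = 0" "\<theta> b = \<theta> a + 2 * pi * of_int k"
proof -
  have "integral {a..b} (\<lambda>t. cis (\<theta> t)) = integral {a..a + (b - a)} (\<lambda>t. cis (\<theta> a + m * (t - a)))"
  proof -
    have "integral {a..b} (\<lambda>t. cis (\<theta> t)) = integral {a..b} (\<lambda>t. cis (\<theta> a + m * (t - a)))"
    proof (rule integral_cong)
      fix t assume "t \<in> {a..b}"
      from has_slopeD[OF assms(1) this] show "cis (\<theta> t) = cis (\<theta> a + m * (t - a))" by (rule arg_cong)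
    qed
    then show ?thesis by simp
  qed
  also have "\<dots> = 0" using assms by (intro integral_cis_full_turn) auto
  finally show "integral {a..b} (\<lambda>t. cis (\<theta> t)) = 0" .
  show "\<theta> b = \<theta> a + 2 * pi * of_int k" using has_slopeD[OF assms(1), of b] assms by simp
qed

text \<open>Two full turns in a row have the length of a single circle of twice the radius. Replacing
  them by this circle gives a minimizer with the slope \<open>K / 2\<close>.\<close>

lemma minimax_angle_no_double_loop:
  assumes \<theta>: "minimax_angle K T \<theta>" and a: "0 \<le> a" "a \<le> b" "b \<le> T" "K * (b - a) = 4 * pi"
    and \<sigma>: "\<sigma> \<in> {1, -1 :: int}" and s: "has_slope \<theta> (of_int \<sigma> * K) a b"
  shows False
proof -
  have K: "0 < K" by (rule minimax_angleD(2)[OF \<theta>])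
  have "a \<noteq> b" using a by auto
  then have "a < b" using a by simp
  have full: "of_int \<sigma> * K * (b - a) = 2 * pi * of_int (2 * \<sigma>)" using \<sigma> a(4) by auto
  have half: "of_int \<sigma> * K / 2 * (b - a) = 2 * pi * of_int \<sigma>" using \<sigma> a(4) by auto
  obtain \<eta> where \<eta>: "minimax_angle K T \<eta>"
    and e: "\<forall>t\<in>{a..a + (b - a)}. \<eta> t = \<theta> a + of_int \<sigma> * K / 2 * (t - a)"
    using minimax_angle_move_loop[OF \<theta> a(1) order.refl a(2,3)
        has_slope_full_turn_integral(2,1)[OF s full _ a(2)], of "of_int \<sigma> * K / 2" \<sigma>] half K \<sigma>
    by (auto simp del: of_int_mult)
  have "has_slope \<eta> (of_int \<sigma> * K / 2) a b" using e by (intro has_slopeI[where c="\<theta> a"]) auto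
  from minimax_angle_slope_values[OF \<eta> a(1) \<open>a < b\<close> a(3) this] show False using K \<sigma> by auto
qed

text \<open>Move the later loop directly in front of the earlier one and let it turn in the same
  sense. Together they form a double loop.\<close>

lemma minimax_angle_no_two_loops:
  assumes \<theta>: "minimax_angle K T \<theta>" and a: "0 \<le> a" "a \<le> b" "b \<le> c" "c \<le> d" "d \<le> T"
    and L: "K * (b - a) = 2 * pi" "K * (d - c) = 2 * pi"
    and \<sigma>: "\<sigma> \<in> {1, -1 :: int}" and s: "has_slope \<theta> (of_int \<sigma> * K) a b"
    and \<tau>: "\<tau> \<in> {1, -1 :: int}" and s': "has_slope \<theta> (of_int \<tau> * K) c d"
  shows False
proof -
  have K: "0 < K" by (rule minimax_angleD(2)[OF \<theta>])
  have full: "of_int \<tau> * K * (d - c) = 2 * pi * of_int \<tau>" using \<tau> L by auto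
  have dc: "d - c = b - a" using L K by (metis mult_left_cancel order_less_irrefl)
  have full': "of_int \<sigma> * K * (d - c) = 2 * pi * of_int \<sigma>" using \<sigma> L by auto
  have ac: "a \<le> c" using a by simp
  obtain \<eta> where \<eta>: "minimax_angle K T \<eta>"
    and e1: "\<forall>t\<in>{a..a + (d - c)}. \<eta> t = \<theta> a + of_int \<sigma> * K * (t - a)"
    and e2: "\<forall>t\<in>{a + (d - c)..d}. \<eta> t = \<theta> (t - (d - c)) + 2 * pi * of_int \<sigma>"
    using minimax_angle_move_loop[OF \<theta> a(1) ac a(4,5)
        has_slope_full_turn_integral(2,1)[OF s' full _ a(4)], of "of_int \<sigma> * K" \<sigma>] full' K \<sigma> \<tau>
    by auto
  define e where "e = b + (b - a)"
  have "has_slope \<eta> (of_int \<sigma> * K) a b" using e1 dc by (intro has_slopeI[where c="\<theta> a"]) auto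
  moreover have "has_slope \<eta> (of_int \<sigma> * K) b e"
  proof (rule has_slopeI[where c="\<theta> a + 2 * pi * of_int \<sigma>"])
    fix t assume t: "t \<in> {b..e}"
    then have "\<eta> t = \<theta> (t - (b - a)) + 2 * pi * of_int \<sigma>" using e2 a dc by (auto simp: e_def)
    also have "\<theta> (t - (b - a)) = \<theta> a + of_int \<sigma> * K * (t - (b - a) - a)"
      using t by (intro has_slopeD[OF s]) (auto simp: e_def)
    finally show "\<eta> t = \<theta> a + 2 * pi * of_int \<sigma> + of_int \<sigma> * K * (t - b)" by (simp add: algebra_simps)
  qed
  ultimately have "has_slope \<eta> (of_int \<sigma> * K) a e"
    using a by (rule_tac has_slope_join[of _ _ a b e]) (auto simp: e_def)
  moreover have "K * (e - a) = 4 * pi" using L(1) by (simp add: e_def algebra_simps)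
  moreover have "a \<le> e" "e \<le> T" using a dc by (auto simp: e_def)
  ultimately show False using minimax_angle_no_double_loop[OF \<eta> a(1) _ _ _ \<sigma>] by blast
qed

text \<open>Insert the loop in the middle of the initial arc, turning against it. The multipliers of
  the new minimizer have a switch at the corner created there, while the line forces \<open>h = 1\<close> and
  has the direction \<open>\<alpha>\<close>. So the arc has the direction of the line at its middle, and by
  hypothesis also at its end, although less than half a turn lies between.\<close>

lemma minimax_angle_no_arc_loop_line:
  assumes \<theta>: "minimax_angle K T \<theta>" and a: "0 < p" "p \<le> a" "a \<le> b" "b \<le> T"
    and L: "K * (b - a) = 2 * pi" and p: "K * p < 2 * pi"
    and \<sigma>: "\<sigma> \<in> {1, -1 :: int}" and arc: "has_slope \<theta> (of_int \<sigma> * K) 0 p"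
    and \<tau>: "\<tau> \<in> {1, -1 :: int}" and loop: "has_slope \<theta> (of_int \<tau> * K) a b"
    and line: "has_slope \<theta> 0 u v" "p \<le> u" "u < v" "v \<le> a \<or> b \<le> u" "v \<le> T" "cis (\<theta> u) = cis (\<theta> p)"
  shows False
proof -
  have K: "0 < K" by (rule minimax_angleD(2)[OF \<theta>])
  have full: "of_int \<tau> * K * (b - a) = 2 * pi * of_int \<tau>" using \<tau> L by auto
  have full': "of_int (- \<sigma>) * K * (b - a) = 2 * pi * of_int (- \<sigma>)" using \<sigma> L by auto
  define s where "s = p / 2"
  have s: "0 \<le> s" "s \<le> a" "0 < s" "s < p" using a by (auto simp: s_def)
  have "a \<noteq> b" using L by auto
  then have ab: "a < b" using a by simp
  obtain \<eta> where \<eta>: "minimax_angle K T \<eta>"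
    and e0: "\<forall>t\<in>{0..s}. \<eta> t = \<theta> t"
    and e1: "\<forall>t\<in>{s..s + (b - a)}. \<eta> t = \<theta> s + of_int (- \<sigma>) * K * (t - s)"
    and e2: "\<forall>t\<in>{s + (b - a)..b}. \<eta> t = \<theta> (t - (b - a)) + 2 * pi * of_int (- \<sigma>)"
    and e3: "\<forall>t\<in>{b..T}. \<eta> t = \<theta> t + 2 * pi * of_int (- \<sigma> - \<tau>)"
    using minimax_angle_move_loop[OF \<theta> s(1,2) a(3,4)
        has_slope_full_turn_integral(2,1)[OF loop full _ a(3)], of "of_int (- \<sigma>) * K" "- \<sigma>"] full' K \<sigma> \<tau>
    by (auto simp del: of_int_minus of_int_diff simp: abs_mult)
  have s1: "has_slope \<eta> (of_int \<sigma> * K) 0 s"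
  proof (rule has_slopeI[where c="\<theta> 0"])
    fix t assume t: "t \<in> {0..s}"
    then have "\<eta> t = \<theta> t" using e0 by blast
    also have "\<dots> = \<theta> 0 + of_int \<sigma> * K * (t - 0)" using t s by (intro has_slopeD[OF arc]) auto
    finally show "\<eta> t = \<theta> 0 + of_int \<sigma> * K * (t - 0)" .
  qed
  have s2: "has_slope \<eta> (of_int (- \<sigma>) * K) s (s + (b - a))"
    using e1 by (intro has_slopeI[where c="\<theta> s"]) blast
  have ne: "of_int \<sigma> * K \<noteq> of_int (- \<sigma>) * K" using \<sigma> K by auto
  have sT: "s < s + (b - a)" "s + (b - a) \<le> T" using s a ab by auto
  obtain \<alpha> h where S: "bang_structure K T \<eta> \<alpha> h"
    by (rule minimax_angle_corner_structure[OF \<eta> order.refl s(3) sT s1 s2 ne])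
  have corner: "cos (\<eta> s - \<alpha>) = h"
    by (rule bang_structure_corner[OF \<eta> S order.refl s(3) sT s1 s2 ne])
  obtain u' v' k where uv: "0 \<le> u'" "u' < v'" "v' \<le> T" "has_slope \<eta> 0 u' v'"
    and k: "\<eta> u' = \<theta> u + 2 * pi * of_int k"
  proof (cases "v \<le> a")
    case True
    let ?u = "u + (b - a)" and ?v = "v + (b - a)"
    have sh: "\<eta> t = \<theta> u + 2 * pi * of_int (- \<sigma>)" if t: "t \<in> {?u..?v}" for t
    proof -
      have "\<eta> t = \<theta> (t - (b - a)) + 2 * pi * of_int (- \<sigma>)" using e2 t True line s by auto
      also have "\<theta> (t - (b - a)) = \<theta> u + 0 * (t - (b - a) - u)"
        using t by (intro has_slopeD[OF line(1)]) auto
      finally show ?thesis by simp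
    qed
    show ?thesis
    proof (rule that[of ?u ?v "- \<sigma>"])
      show "has_slope \<eta> 0 ?u ?v"
        using sh by (intro has_slopeI[where c="\<theta> u + 2 * pi * of_int (- \<sigma>)"]) auto
      show "\<eta> ?u = \<theta> u + 2 * pi * of_int (- \<sigma>)" using sh[of ?u] line by simp
    qed (use line True a in auto)
  next
    case False
    then have bu: "b \<le> u" using line by simp
    have sh: "\<eta> t = \<theta> u + 2 * pi * of_int (- \<sigma> - \<tau>)" if t: "t \<in> {u..v}" for t
    proof -
      have "\<eta> t = \<theta> t + 2 * pi * of_int (- \<sigma> - \<tau>)" using e3 t bu line by auto
      also have "\<theta> t = \<theta> u + 0 * (t - u)" using t by (intro has_slopeD[OF line(1)]) auto
      finally show ?thesis by simp
    qed
    show ?thesis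
    proof (rule that[of u v "- \<sigma> - \<tau>"])
      show "has_slope \<eta> 0 u v"
        using sh by (intro has_slopeI[where c="\<theta> u + 2 * pi * of_int (- \<sigma> - \<tau>)"]) auto
      show "\<eta> u = \<theta> u + 2 * pi * of_int (- \<sigma> - \<tau>)" using sh[of u] line by simp
    qed (use line bu a in auto)
  qed
  have h: "h = 1" "cos (\<eta> u' - \<alpha>) = 1" using bang_structure_flat[OF K S minimax_angleD(4)[OF \<eta>] uv] by auto
  have "cos (\<theta> s - \<alpha>) = 1" using corner h e0 s by simp
  then have cs: "cis (\<theta> s - \<alpha>) = 1" using sin_cos_squared_add[of "\<theta> s - \<alpha>"] by (auto simp: complex_eq_iff)
  have "cis (\<eta> u' - \<alpha>) = 1"
    using h(2) sin_cos_squared_add[of "\<eta> u' - \<alpha>"] by (auto simp: complex_eq_iff)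
  then have "cis (\<theta> u) = cis \<alpha>" using cis_add_2pi_int[of "\<theta> u" k] cis_mult[of "\<eta> u' - \<alpha>" \<alpha>] by (simp add: k)
  moreover have "cis (\<theta> s) = cis \<alpha>" using cs cis_mult[of "\<theta> s - \<alpha>" \<alpha>] by simp
  ultimately have eq: "cis (\<theta> p) = cis (\<theta> s)" using line(6) by simp
  have "\<theta> p = \<theta> s + of_int \<sigma> * K * (p - s)" using s by (intro has_slope_diff[OF arc]) auto
  then have "cmod (cis (\<theta> p) - cis (\<theta> s)) = 2 * \<bar>sin (of_int \<sigma> * K * (p - s) / 2)\<bar>"
    unfolding norm_cis_diff by simp
  then have "sin (of_int \<sigma> * K * (p - s) / 2) = 0" using eq by simp
  moreover have "\<bar>of_int \<sigma> * K * (p - s) / 2\<bar> = K * p / 4" using \<sigma> K a by (auto simp: s_def abs_mult)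
  moreover have "0 < K * p / 4" using K a by simp
  moreover have "K * p / 4 < pi" using p pi_gt_zero by linarith
  ultimately show False using sin_zero_pi_iff[of "of_int \<sigma> * K * (p - s) / 2"] by auto
qed

section \<open>Angles with three pieces\<close>

text \<open>The value \<open>c\<close> is taken at the first corner \<open>s\<^sub>1\<close>; the outer two pieces extend to infinity.\<close>

definition broken_line :: "real \<Rightarrow> real \<Rightarrow> real \<Rightarrow> real \<Rightarrow> real \<Rightarrow> real \<Rightarrow> real \<Rightarrow> real" where
  "broken_line c m\<^sub>1 m\<^sub>2 m\<^sub>3 s\<^sub>1 s\<^sub>2 t =
     (if t \<le> s\<^sub>1 then c + m\<^sub>1 * (t - s\<^sub>1) else if t \<le> s\<^sub>2 then c + m\<^sub>2 * (t - s\<^sub>1)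
      else c + m\<^sub>2 * (s\<^sub>2 - s\<^sub>1) + m\<^sub>3 * (t - s\<^sub>2))"

text \<open>The angles of the curves of type CXC and SOS and of their sub-paths. The full path lives
  on \<open>{A..B}\<close>, which contains \<open>{0..T}\<close> and may be larger; the corners may thus lie outside of
  \<open>{0..T}\<close>, and then fewer than three pieces remain visible. The last line is the type SOS, the
  alternatives for \<open>m\<^sub>2\<close> are \<open>X = S\<close>, \<open>X = C\<close> and \<open>X = O\<close>.\<close>

definition three_piece_angle :: "real \<Rightarrow> real \<Rightarrow> (real \<Rightarrow> real) \<Rightarrow> bool" where
  "three_piece_angle K T \<theta> \<longleftrightarrow> (\<exists>c m\<^sub>1 m\<^sub>2 m\<^sub>3 s\<^sub>1 s\<^sub>2 A B.
     A \<le> 0 \<and> T \<le> B \<and> A < s\<^sub>1 \<and> s\<^sub>1 < s\<^sub>2 \<and> s\<^sub>2 < B \<and>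
     (\<forall>t\<in>{0..T}. \<theta> t = broken_line c m\<^sub>1 m\<^sub>2 m\<^sub>3 s\<^sub>1 s\<^sub>2 t) \<and>
     (m\<^sub>1 \<in> {K, - K} \<and> m\<^sub>3 \<in> {K, - K} \<and> K * (s\<^sub>1 - A) < 2 * pi \<and> K * (B - s\<^sub>2) < 2 * pi \<and>
        (m\<^sub>2 = 0 \<or> m\<^sub>2 = - m\<^sub>1 \<and> m\<^sub>3 = m\<^sub>1 \<and> K * (s\<^sub>2 - s\<^sub>1) < 2 * pi \<or>
         m\<^sub>2 \<in> {K, - K} \<and> K * (s\<^sub>2 - s\<^sub>1) = 2 * pi) \<or>
      m\<^sub>1 = 0 \<and> m\<^sub>3 = 0 \<and> m\<^sub>2 \<in> {K, - K} \<and> K * (s\<^sub>2 - s\<^sub>1) = 2 * pi))"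

lemma three_piece_angleI:
  assumes "A \<le> 0" "T \<le> B" "A < s\<^sub>1" "s\<^sub>1 < s\<^sub>2" "s\<^sub>2 < B"
    and "\<forall>t\<in>{0..T}. \<theta> t = broken_line c m\<^sub>1 m\<^sub>2 m\<^sub>3 s\<^sub>1 s\<^sub>2 t"
    and "m\<^sub>1 \<in> {K, - K}" "m\<^sub>3 \<in> {K, - K}" "K * (s\<^sub>1 - A) < 2 * pi" "K * (B - s\<^sub>2) < 2 * pi"
    and "m\<^sub>2 = 0 \<or> m\<^sub>2 = - m\<^sub>1 \<and> m\<^sub>3 = m\<^sub>1 \<and> K * (s\<^sub>2 - s\<^sub>1) < 2 * pi \<or>
       m\<^sub>2 \<in> {K, - K} \<and> K * (s\<^sub>2 - s\<^sub>1) = 2 * pi"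
  shows "three_piece_angle K T \<theta>"
  unfolding three_piece_angle_def using assms by blast

lemma broken_line_of_slopes:
  assumes "has_slope \<theta> m\<^sub>1 0 s\<^sub>1" "has_slope \<theta> m\<^sub>2 s\<^sub>1 s\<^sub>2" "has_slope \<theta> m\<^sub>3 s\<^sub>2 T"
    and "0 \<le> s\<^sub>1" "s\<^sub>1 \<le> s\<^sub>2" "s\<^sub>2 \<le> T" and t: "t \<in> {0..T}"
  shows "\<theta> t = broken_line (\<theta> s\<^sub>1) m\<^sub>1 m\<^sub>2 m\<^sub>3 s\<^sub>1 s\<^sub>2 t"
proof -
  consider "t \<le> s\<^sub>1" | "s\<^sub>1 < t" "t \<le> s\<^sub>2" | "s\<^sub>2 < t" by linarith
  then show ?thesis
  proof cases
    case 1
    then have "\<theta> t = \<theta> s\<^sub>1 + m\<^sub>1 * (t - s\<^sub>1)" using has_slope_diff[OF assms(1), of s\<^sub>1 t] assms t by auto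
    then show ?thesis using 1 by (simp add: broken_line_def)
  next
    case 2
    then have "\<theta> t = \<theta> s\<^sub>1 + m\<^sub>2 * (t - s\<^sub>1)" using has_slopeD[OF assms(2), of t] by auto
    then show ?thesis using 2 by (simp add: broken_line_def)
  next
    case 3
    then have "\<theta> t = \<theta> s\<^sub>2 + m\<^sub>3 * (t - s\<^sub>2)" using has_slopeD[OF assms(3), of t] t by auto
    moreover have "\<theta> s\<^sub>2 = \<theta> s\<^sub>1 + m\<^sub>2 * (s\<^sub>2 - s\<^sub>1)" using has_slopeD[OF assms(2), of s\<^sub>2] assms by auto
    ultimately show ?thesis using 3 assms by (simp add: broken_line_def)
  qed
qed

text \<open>An arc of less than a full turn is the beginning of a path CSC. A longer one turns less
  than twice, because double loops are excluded; it is a path COC whose three pieces turn in the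
  same sense.\<close>

lemma three_piece_single_arc:
  assumes \<theta>: "minimax_angle K T \<theta>" and \<sigma>: "\<sigma> \<in> {1, -1 :: int}" and s: "has_slope \<theta> (of_int \<sigma> * K) 0 T"
  shows "three_piece_angle K T \<theta>"
proof -
  have K: "0 < K" and T: "0 < T" using minimax_angleD[OF \<theta>] by auto
  define L where "L = 2 * pi / K"
  have L: "0 < L" "K * L = 2 * pi" using K by (auto simp: L_def)
  have m: "of_int \<sigma> * K \<in> {K, - K}" using \<sigma> by auto
  show ?thesis
  proof (cases "T < L")
    case True
    have KT: "K * T < 2 * pi" using mult_strict_left_mono[OF True K] L by simp
    \<comment> \<open>The segment on \<open>{T..T + 1}\<close> and the third piece, an arc of half a turn, lie beyond the
      curve.\<close>
    have "\<forall>t\<in>{0..T}. \<theta> t = broken_line (\<theta> T) (of_int \<sigma> * K) 0 K T (T + 1) t"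
    proof
      fix t assume t: "t \<in> {0..T}"
      show "\<theta> t = broken_line (\<theta> T) (of_int \<sigma> * K) 0 K T (T + 1) t"
        using has_slope_diff[OF s, of T t] t T by (simp add: broken_line_def)
    qed
    then show ?thesis
      by (rule three_piece_angleI[of 0 _ "T + 1 + L / 2", rotated 5]) (use m T L KT in auto)
  next
    case False
    have "T < 2 * L"
    proof (rule ccontr)
      assume "\<not> T < 2 * L"
      then have "has_slope \<theta> (of_int \<sigma> * K) 0 (2 * L)" "2 * L \<le> T"
        using has_slope_subset[OF s] by auto
      then show False using minimax_angle_no_double_loop[OF \<theta> order.refl, of "2 * L" \<sigma>] \<sigma> L by auto
    qed
    \<comment> \<open>A full circle in the middle leaves two arcs of equal length, each of less than half a
      turn.\<close>
    define x y where "x = (T - L) / 2" and "y = x + L"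
    have xy: "0 \<le> x" "x < y" "y \<le> T" "x < L / 2" "T - y < L / 2"
      using False L \<open>T < 2 * L\<close> by (auto simp: x_def y_def field_simps)
    have "\<forall>t\<in>{0..T}. \<theta> t = broken_line (\<theta> x) (of_int \<sigma> * K) (of_int \<sigma> * K) (of_int \<sigma> * K) x y t"
      by (intro ballI broken_line_of_slopes has_slope_subset[OF s]) (use xy in auto)
    then show ?thesis
      by (rule three_piece_angleI[of "x - L / 2" _ "y + L / 2", rotated 5])
        (use m xy L in \<open>auto simp: y_def\<close>)
  qed
qed

lemma real_sign_as_int:
  assumes "(\<sigma>::real) \<in> {1, -1}" obtains \<tau> :: int where "\<tau> \<in> {1, -1}" "\<sigma> = of_int \<tau>"
  using assms that[of 1] that[of "-1"] by auto

text \<open>The second corner is placed at \<open>T\<close>, so that the third piece lies beyond the curve.\<close>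

lemma three_piece_two_arcs:
  assumes K: "0 < K" and \<sigma>: "\<sigma> \<in> {1, -1}" and p: "0 < p" "p < T" "K * p < 2 * pi" "K * (T - p) < 2 * pi"
    and s: "has_slope \<theta> (\<sigma> * K) 0 p" "has_slope \<theta> (- \<sigma> * K) p T"
  shows "three_piece_angle K T \<theta>"
proof -
  have "has_slope \<theta> (\<sigma> * K) T T" by (simp add: has_slope_def)
  then have "\<forall>t\<in>{0..T}. \<theta> t = broken_line (\<theta> p) (\<sigma> * K) (- \<sigma> * K) (\<sigma> * K) p T t"
    using s p by (intro ballI broken_line_of_slopes) auto
  then show ?thesis
    by (rule three_piece_angleI[of 0 _ "T + pi / K", rotated 5]) (use \<sigma> p K in auto)
qed

lemma has_slope_reaches_crest:
  assumes K: "0 < K" and \<sigma>: "\<sigma> \<in> {1, -1}" and s: "has_slope \<theta> (\<sigma> * K) u v" and uv: "2 * pi \<le> K * (v - u)"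
  obtains t where "t \<in> {u..v}" "cos (\<theta> t - \<alpha>) = 1"
proof -
  define x where "x = \<sigma> * (\<theta> u - \<alpha>)"
  have "(cos x)\<^sup>2 + (- sin x)\<^sup>2 = 1" by simp
  then obtain \<tau> where \<tau>: "0 \<le> \<tau>" "\<tau> < 2 * pi" "cos x = cos \<tau>" "- sin x = sin \<tau>"
    using sincos_total_2pi by metis
  have "cos (x + \<tau>) = cos x * cos x + sin x * sin x"
    unfolding cos_add \<tau>(3,4)[symmetric] by simp
  then have one: "cos (x + \<tau>) = 1" using sin_cos_squared_add3[of x] by simp
  define t where "t = u + \<tau> / K"
  have "K * (t - u) = \<tau>" using K by (simp add: t_def)
  then have "K * (t - u) \<le> K * (v - u)" using \<tau> uv by simp
  then have "t \<le> v" using mult_le_cancel_left_pos[OF K, of "t - u" "v - u"] by simp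
  then have t: "t \<in> {u..v}" using K \<tau> by (auto simp: t_def)
  have "\<theta> t - \<alpha> = \<sigma> * (x + \<tau>)"
    using has_slopeD[OF s t] \<sigma> K by (auto simp: x_def t_def algebra_simps)
  then have "cos (\<theta> t - \<alpha>) = 1" using one \<sigma> by (auto simp: algebra_simps cos_add cos_diff)
  then show ?thesis using that t by blast
qed

lemma has_slope_full_turn:
  assumes K: "0 < K" and \<sigma>: "\<sigma> \<in> {1, -1}" and s: "has_slope \<theta> (\<sigma> * K) u v"
    and t: "u \<le> t" "t + 2 * pi / K \<le> v"
  shows "cos (\<theta> (t + 2 * pi / K) - \<alpha>) = cos (\<theta> t - \<alpha>)"
proof -
  have "0 < 2 * pi / K" using K by simp
  then have "\<theta> (t + 2 * pi / K) = \<theta> t + \<sigma> * K * (t + 2 * pi / K - t)"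
    using t by (intro has_slope_diff[OF s]; simp)
  then have "\<theta> (t + 2 * pi / K) - \<alpha> = \<theta> t - \<alpha> + \<sigma> * (2 * pi)" using K by simp
  moreover have "cos (x + \<sigma> * (2 * pi)) = cos x" for x using \<sigma> by (auto simp: cos_add cos_diff)
  ultimately show ?thesis by (simp only:)
qed

text \<open>Between two consecutive switches the cosine falls from \<open>h\<close> to its minimum \<open>-1\<close> and rises
  again to \<open>h\<close>, symmetrically about the minimum. For \<open>h = 1\<close> this is a full turn.\<close>

lemma bang_structure_gap:
  assumes K: "0 < K" and S: "bang_structure K T \<theta> \<alpha> h" and uv: "0 \<le> u" "u < v" "v \<le> T"
    and ends: "cos (\<theta> u - \<alpha>) = h" "cos (\<theta> v - \<alpha>) = h"
    and free: "\<forall>t\<in>{u<..<v}. cos (\<theta> t - \<alpha>) < h"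
  shows "K * (v - u) = 2 * arccos (- h)"
proof -
  obtain \<sigma> where \<sigma>: "\<sigma> \<in> {1, -1}" and s: "has_slope \<theta> (\<sigma> * K) u v"
    using bang_structureD(4)[OF S uv free] by blast
  define x y where "x = \<theta> u - \<alpha>" and "y = \<sigma> * K * (v - u)"
  have absy: "\<bar>y\<bar> = K * (v - u)" using \<sigma> K uv by (auto simp: y_def abs_mult)
  have "\<theta> v = \<theta> u + \<sigma> * K * (v - u)" using uv by (intro has_slopeD[OF s]) auto
  then have "x + y = \<theta> v - \<alpha>" by (simp add: x_def y_def)
  then have xy: "cos (x + y) = h" using ends by simp
  have x: "cos x = h" using ends by (simp add: x_def)
  have y0: "0 < \<bar>y\<bar>" using K uv by (simp add: absy)
  show ?thesis
  proof (cases "\<bar>y\<bar> < 2 * pi")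
    case True
    have "cos x = cos (x + y)" using x xy by simp
    from cos_eq_shift_imp[OF this y0 True] have s0: "sin (x + y / 2) = 0" .
    have "\<theta> ((u + v) / 2) = \<theta> u + \<sigma> * K * ((u + v) / 2 - u)" using uv by (intro has_slopeD[OF s]) auto
    then have "\<theta> ((u + v) / 2) - \<alpha> = x + y / 2" by (simp add: x_def y_def field_simps)
    then have "cos (x + y / 2) < h" using bspec[OF free, of "(u + v) / 2"] uv by auto
    then have "cos (x + y / 2) = - 1"
      using s0 bang_structureD(2)[OF S] sin_zero_abs_cos_one[of "x + y / 2"] by auto
    moreover have "cos x = cos ((x + y / 2) - y / 2)" by simp
    ultimately have "cos (y / 2) = - h" using x s0 unfolding cos_diff by simp
    then have "cos (\<bar>y\<bar> / 2) = - h" by (cases "0 \<le> y") auto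
    then have "arccos (- h) = \<bar>y\<bar> / 2" using arccos_cos[of "\<bar>y\<bar> / 2"] True y0 by simp
    then show ?thesis using absy by simp
  next
    case False
    then have "2 * pi \<le> K * (v - u)" using absy by simp
    then obtain t where t: "t \<in> {u..v}" "cos (\<theta> t - \<alpha>) = 1"
      by (rule has_slope_reaches_crest[OF K \<sigma> s])
    then have h: "h = 1" using bang_structureD(2)[OF S] bang_structureD(3)[OF S, of t] uv by auto
    have "\<not> 2 * pi / K < v - u"
    proof
      assume lt: "2 * pi / K < v - u"
      then have "cos (\<theta> (u + 2 * pi / K) - \<alpha>) = h"
        using has_slope_full_turn[OF K \<sigma> s order.refl, of \<alpha>] ends(1) by simp
      moreover have "u + 2 * pi / K \<in> {u<..<v}" using lt K by simp
      ultimately show False using free by fastforce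
    qed
    then have "K * (v - u) \<le> 2 * pi" using K by (simp add: field_simps)
    then show ?thesis using False absy h by simp
  qed
qed

text \<open>The cosine has a maximum at a switch. Without a change of slope it would be differentiable
  there, with a critical point, so its value would be \<open>1\<close> or \<open>-1\<close>.\<close>

lemma bang_structure_zero_switches:
  assumes K: "0 < K" and S: "bang_structure K T \<theta> \<alpha> h" and h: "h < 1"
    and t: "0 \<le> u" "u < t" "t < v" "v \<le> T" and zero: "cos (\<theta> t - \<alpha>) = h"
    and \<sigma>: "\<sigma> \<in> {1, -1}" "has_slope \<theta> (\<sigma> * K) u t" and \<tau>: "\<tau> \<in> {1, -1}" "has_slope \<theta> (\<tau> * K) t v"
  shows "\<tau> = - \<sigma>"
proof (rule ccontr)
  assume "\<tau> \<noteq> - \<sigma>"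
  then have "\<tau> = \<sigma>" using \<sigma>(1) \<tau>(1) by auto
  then have s: "has_slope \<theta> (\<sigma> * K) u v" using has_slope_join[OF \<sigma>(2)] \<tau>(2) t by auto
  define f where "f r = cos (\<theta> t + \<sigma> * K * (r - t) - \<alpha>)" for r
  have "(f has_real_derivative - sin (\<theta> t + \<sigma> * K * (t - t) - \<alpha>) * (\<sigma> * K)) (at t)"
    unfolding f_def by (auto intro!: derivative_eq_intros)
  moreover have "f r \<le> f t" if r: "\<bar>t - r\<bar> < min (t - u) (v - t)" for r
  proof -
    have r: "r \<in> {u..v}" "r \<in> {0..T}" using r t by auto
    have "\<theta> r = \<theta> t + \<sigma> * K * (r - t)" using r t by (intro has_slope_diff[OF s]) auto
    then have "f r = cos (\<theta> r - \<alpha>)" by (simp add: f_def)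
    then show ?thesis using bang_structureD(3)[OF S r(2)] zero by (simp add: f_def)
  qed
  ultimately have "- sin (\<theta> t + \<sigma> * K * (t - t) - \<alpha>) * (\<sigma> * K) = 0"
    using t by (intro DERIV_local_max[of f _ t "min (t - u) (v - t)"]) auto
  then have "sin (\<theta> t - \<alpha>) = 0" using K \<sigma>(1) by auto
  then have "\<bar>h\<bar> = 1" using zero sin_zero_abs_cos_one by metis
  then show False using h bang_structureD(1)[OF S] by auto
qed

text \<open>The gaps between consecutive switches have the same length \<open>g\<close>, so \<open>\<theta>\<close> has the same value
  at \<open>t\<^sub>1 - \<epsilon>\<close> and \<open>t\<^sub>3 - \<epsilon>\<close>. Reversing the stretch in between yields a minimizer with corners
  at the three angles \<open>\<theta> t\<^sub>1\<close>, \<open>\<theta> t\<^sub>1 - \<sigma> * K * \<epsilon>\<close> and \<open>\<theta> t\<^sub>1 - \<sigma> * K * g\<close>. At a corner the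
  shifted cosine attains its bound, but three different angles within less than a full turn
  cannot have the same cosine.\<close>

lemma minimax_angle_no_three_switches:
  assumes \<theta>: "minimax_angle K T \<theta>" and S: "bang_structure K T \<theta> \<alpha> h" and h: "h < 1"
    and t: "0 < t\<^sub>1" "t\<^sub>1 < t\<^sub>2" "t\<^sub>2 < t\<^sub>3" "t\<^sub>3 \<le> T"
    and zero: "cos (\<theta> t\<^sub>1 - \<alpha>) = h" "cos (\<theta> t\<^sub>2 - \<alpha>) = h" "cos (\<theta> t\<^sub>3 - \<alpha>) = h"
    and free: "\<forall>t\<in>{0<..<t\<^sub>1}. cos (\<theta> t - \<alpha>) < h" "\<forall>t\<in>{t\<^sub>1<..<t\<^sub>2}. cos (\<theta> t - \<alpha>) < h"
      "\<forall>t\<in>{t\<^sub>2<..<t\<^sub>3}. cos (\<theta> t - \<alpha>) < h"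
  shows False
proof -
  have K: "0 < K" by (rule minimax_angleD(2)[OF \<theta>])
  have tT: "t\<^sub>1 \<le> T" "t\<^sub>2 \<le> T" "0 \<le> t\<^sub>1" "0 \<le> t\<^sub>2" using t by auto
  obtain \<sigma> where \<sigma>: "\<sigma> \<in> {1, -1}" "has_slope \<theta> (\<sigma> * K) 0 t\<^sub>1"
    using bang_structureD(4)[OF S order.refl t(1) tT(1) free(1)] by blast
  obtain \<sigma>' where \<sigma>': "\<sigma>' \<in> {1, -1}" "has_slope \<theta> (\<sigma>' * K) t\<^sub>1 t\<^sub>2"
    using bang_structureD(4)[OF S tT(3) t(2) tT(2) free(2)] by blast
  obtain \<sigma>'' where \<sigma>'': "\<sigma>'' \<in> {1, -1}" "has_slope \<theta> (\<sigma>'' * K) t\<^sub>2 t\<^sub>3"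
    using bang_structureD(4)[OF S tT(4) t(3,4) free(3)] by blast
  have "\<sigma>' = - \<sigma>"
    using t by (intro bang_structure_zero_switches[OF K S h order.refl t(1,2) _ zero(1) \<sigma> \<sigma>']) auto
  then have s2: "has_slope \<theta> (- \<sigma> * K) t\<^sub>1 t\<^sub>2" using \<sigma>' by simp
  have "\<sigma>'' = - \<sigma>'"
    using t by (intro bang_structure_zero_switches[OF K S h _ t(2,3,4) zero(2) \<sigma>' \<sigma>'']) auto
  then have s3: "has_slope \<theta> (\<sigma> * K) t\<^sub>2 t\<^sub>3" using \<sigma>'' \<open>\<sigma>' = - \<sigma>\<close> by simp
  define g where "g = t\<^sub>2 - t\<^sub>1"
  have "K * (t\<^sub>2 - t\<^sub>1) = 2 * arccos (- h)" "K * (t\<^sub>3 - t\<^sub>2) = 2 * arccos (- h)"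
    using t by (intro bang_structure_gap[OF K S] zero free; simp)+
  then have "K * (t\<^sub>3 - t\<^sub>2) = K * g" and Kg: "K * g = 2 * arccos (- h)" by (auto simp: g_def)
  then have g: "t\<^sub>2 = t\<^sub>1 + g" "t\<^sub>3 = t\<^sub>1 + 2 * g" "0 < g" using K t by (auto simp: g_def)
  have "arccos (- h) < pi"
    using arccos_lt_bounded[of "- h"] h bang_structureD(1)[OF S] by simp
  then have Kg2: "K * g < 2 * pi" using Kg by simp
  \<comment> \<open>Both \<open>t\<^sub>1 - \<epsilon>\<close> and \<open>t\<^sub>3 - \<epsilon>\<close> have to lie inside the arcs that end at \<open>t\<^sub>1\<close> and \<open>t\<^sub>3\<close>.\<close>
  define \<epsilon> where "\<epsilon> = min t\<^sub>1 g / 2"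
  have \<epsilon>: "0 < \<epsilon>" "\<epsilon> < t\<^sub>1" "\<epsilon> < g" using t g by (auto simp: \<epsilon>_def)
  define a where "a = t\<^sub>1 - \<epsilon>"
  define b where "b = t\<^sub>3 - \<epsilon>"
  have ab: "0 \<le> a" "a \<le> b" "b \<le> T" "0 < a" using \<epsilon> t by (auto simp: a_def b_def)
  have va: "\<theta> a = \<theta> t\<^sub>1 - \<sigma> * (K * \<epsilon>)"
    using has_slope_diff[OF \<sigma>(2), of t\<^sub>1 a] \<epsilon> t by (auto simp: a_def algebra_simps)
  have v2: "\<theta> t\<^sub>2 = \<theta> t\<^sub>1 - \<sigma> * (K * g)"
    using has_slopeD[OF s2, of t\<^sub>2] t g by (auto simp: algebra_simps)
  have v3: "\<theta> r = \<theta> t\<^sub>2 + \<sigma> * K * (r - t\<^sub>2)" if "r \<in> {t\<^sub>2..t\<^sub>3}" for r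
    by (rule has_slopeD[OF s3 that])
  have vb: "\<theta> b = \<theta> a" using v3[of b] \<epsilon> t g v2 va by (auto simp: b_def algebra_simps)
  define \<eta> where "\<eta> t = (if t \<le> a then \<theta> t else if t \<le> b then \<theta> (a + b - t) else \<theta> t)" for t
  have \<eta>: "minimax_angle K T \<eta>"
    unfolding \<eta>_def by (rule minimax_angle_reverse_segment[OF \<theta> ab(1-3) vb[symmetric]])
  have \<eta>_ab: "\<eta> r = \<theta> (a + b - r)" if "r \<in> {a..b}" for r using that vb by (auto simp: \<eta>_def)
  define c\<^sub>2 where "c\<^sub>2 = a + b - t\<^sub>2"
  define c\<^sub>1 where "c\<^sub>1 = a + b - t\<^sub>1"
  have ord: "a < c\<^sub>2" "c\<^sub>2 < c\<^sub>1" "c\<^sub>1 < b" using \<epsilon> g by (auto simp: c\<^sub>1_def c\<^sub>2_def a_def b_def)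
  have e0: "has_slope \<eta> (\<sigma> * K) 0 a"
  proof (rule has_slopeI[where c="\<theta> 0"])
    fix r assume r: "r \<in> {0..a}"
    then have "\<eta> r = \<theta> r" by (simp add: \<eta>_def)
    also have "\<dots> = \<theta> 0 + \<sigma> * K * (r - 0)" using r \<epsilon> by (intro has_slopeD[OF \<sigma>(2)]) (auto simp: a_def)
    finally show "\<eta> r = \<theta> 0 + \<sigma> * K * (r - 0)" .
  qed
  have e1: "has_slope \<eta> (- \<sigma> * K) a c\<^sub>2"
  proof (rule has_slopeI[where c="\<theta> b"])
    fix r assume r: "r \<in> {a..c\<^sub>2}"
    then have "\<eta> r = \<theta> (a + b - r)" using ord by (intro \<eta>_ab) auto
    also have "\<dots> = \<theta> b + \<sigma> * K * (a + b - r - b)"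
      using r \<epsilon> g by (intro has_slope_diff[OF s3]) (auto simp: c\<^sub>2_def b_def a_def)
    finally show "\<eta> r = \<theta> b + - \<sigma> * K * (r - a)" by (simp add: algebra_simps)
  qed
  have e2: "has_slope \<eta> (\<sigma> * K) c\<^sub>2 c\<^sub>1"
  proof (rule has_slopeI[where c="\<theta> t\<^sub>2"])
    fix r assume r: "r \<in> {c\<^sub>2..c\<^sub>1}"
    then have "\<eta> r = \<theta> (a + b - r)" using ord by (intro \<eta>_ab) auto
    also have "\<dots> = \<theta> t\<^sub>2 + - \<sigma> * K * (a + b - r - t\<^sub>2)"
      using r t by (intro has_slope_diff[OF s2]) (auto simp: c\<^sub>2_def c\<^sub>1_def)
    finally show "\<eta> r = \<theta> t\<^sub>2 + \<sigma> * K * (r - c\<^sub>2)" by (simp add: c\<^sub>2_def algebra_simps)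
  qed
  have e3: "has_slope \<eta> (- \<sigma> * K) c\<^sub>1 b"
  proof (rule has_slopeI[where c="\<theta> t\<^sub>1"])
    fix r assume r: "r \<in> {c\<^sub>1..b}"
    then have "\<eta> r = \<theta> (a + b - r)" using ord by (intro \<eta>_ab) auto
    also have "\<dots> = \<theta> t\<^sub>1 + \<sigma> * K * (a + b - r - t\<^sub>1)"
      using r t \<epsilon> by (intro has_slope_diff[OF \<sigma>(2)]) (auto simp: c\<^sub>1_def a_def)
    finally show "\<eta> r = \<theta> t\<^sub>1 + - \<sigma> * K * (r - c\<^sub>1)" by (simp add: c\<^sub>1_def algebra_simps)
  qed
  have ne: "\<sigma> * K \<noteq> - \<sigma> * K" "- \<sigma> * K \<noteq> \<sigma> * K" using \<sigma>(1) K by auto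
  have bounds: "c\<^sub>2 \<le> T" "0 \<le> c\<^sub>2" "c\<^sub>1 \<le> T" using ord ab by auto
  obtain \<beta> k where S': "bang_structure K T \<eta> \<beta> k"
    by (rule minimax_angle_corner_structure[OF \<eta> order.refl ab(4) ord(1) bounds(1) e0 e1 ne(1)])
  have z0: "cos (\<eta> a - \<beta>) = k"
    by (rule bang_structure_corner[OF \<eta> S' order.refl ab(4) ord(1) bounds(1) e0 e1 ne(1)])
  have z2: "cos (\<eta> c\<^sub>2 - \<beta>) = k"
    by (rule bang_structure_corner[OF \<eta> S' ab(1) ord(1,2) bounds(3) e1 e2 ne(2)])
  have z1: "cos (\<eta> c\<^sub>1 - \<beta>) = k"
    by (rule bang_structure_corner[OF \<eta> S' bounds(2) ord(2,3) ab(3) e2 e3 ne(1)])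
  define x where "x = \<theta> t\<^sub>1 - \<beta>"
  have x1: "cos x = k" using z1 \<eta>_ab[of c\<^sub>1] ord by (simp add: x_def c\<^sub>1_def)
  have x0: "cos (x + - \<sigma> * (K * \<epsilon>)) = k"
    using z0 \<eta>_ab[of a] ab vb va by (simp add: x_def algebra_simps)
  have x2: "cos (x + - \<sigma> * (K * g)) = k"
  proof -
    have "\<eta> c\<^sub>2 = \<theta> t\<^sub>2" using \<eta>_ab[of c\<^sub>2] ord by (simp add: c\<^sub>2_def)
    then have "x + - \<sigma> * (K * g) = \<eta> c\<^sub>2 - \<beta>" by (simp add: x_def v2)
    then show ?thesis using z2 by simp
  qed
  have "K * \<epsilon> < K * g" "0 < K * \<epsilon>" using K \<epsilon> by auto
  moreover from this have "\<bar>- \<sigma> * (K * \<epsilon>)\<bar> = K * \<epsilon>" "\<bar>- \<sigma> * (K * g)\<bar> = K * g"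
    using \<sigma>(1) by auto
  ultimately have "sin (x + - \<sigma> * (K * \<epsilon>) / 2) = 0" "sin (x + - \<sigma> * (K * g) / 2) = 0"
    using Kg2 cos_eq_shift_imp[OF trans[OF x1 x0[symmetric]]] cos_eq_shift_imp[OF trans[OF x1 x2[symmetric]]]
    by linarith+
  then have "sin ((x + - \<sigma> * (K * \<epsilon>) / 2) - (x + - \<sigma> * (K * g) / 2)) = 0"
    unfolding sin_diff by simp
  moreover have "\<bar>(x + - \<sigma> * (K * \<epsilon>) / 2) - (x + - \<sigma> * (K * g) / 2)\<bar> = (K * g - K * \<epsilon>) / 2"
    using \<sigma>(1) \<open>K * \<epsilon> < K * g\<close> by (auto simp: field_simps abs_if)
  moreover have "(K * g - K * \<epsilon>) / 2 < pi" "0 < (K * g - K * \<epsilon>) / 2"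
    using Kg2 \<open>0 < K * \<epsilon>\<close> \<open>K * \<epsilon> < K * g\<close> by auto
  ultimately show False
    using sin_zero_pi_iff[of "(x + - \<sigma> * (K * \<epsilon>) / 2) - (x + - \<sigma> * (K * g) / 2)"] by auto
qed

section \<open>Minimizers have three pieces\<close>

lemma bang_structure_next_switch:
  assumes K: "0 < K" and S: "bang_structure K T \<theta> \<alpha> h" and h: "h < 1" and u: "0 \<le> u" "u < T"
  obtains v \<sigma> where "u < v" "v \<le> T" "v = T \<or> cos (\<theta> v - \<alpha>) = h"
    "\<forall>t\<in>{u<..<v}. cos (\<theta> t - \<alpha>) < h"
    "\<sigma> \<in> {1, -1}" "has_slope \<theta> (\<sigma> * K) u v" "K * (v - u) < 2 * pi"
proof -
  define Z where "Z = insert T {t \<in> {u<..<T}. cos (\<theta> t - \<alpha>) = h}"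
  have "finite {t \<in> {u<..<T}. cos (\<theta> t - \<alpha>) = h}"
    by (rule finite_subset[OF _ bang_structureD(5)[OF S h]]) (use u in auto)
  then have Z: "finite Z" "Z \<noteq> {}" by (auto simp: Z_def)
  define v where "v = Min Z"
  have "v \<in> Z" using Z unfolding v_def by (rule Min_in)
  then have v: "u < v" "v \<le> T" "v = T \<or> cos (\<theta> v - \<alpha>) = h" using u by (auto simp: Z_def)
  have free: "\<forall>t\<in>{u<..<v}. cos (\<theta> t - \<alpha>) < h"
  proof
    fix t assume t: "t \<in> {u<..<v}"
    then have "t \<notin> Z" using Min_le[OF Z(1), of t] by (auto simp: v_def)
    then have "cos (\<theta> t - \<alpha>) \<noteq> h" using t v by (auto simp: Z_def)
    then show "cos (\<theta> t - \<alpha>) < h" using bang_structureD(3)[OF S, of t] t u v by auto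
  qed
  then obtain \<sigma> where \<sigma>: "\<sigma> \<in> {1, -1}" "has_slope \<theta> (\<sigma> * K) u v"
    using bang_structureD(4)[OF S u(1) v(1,2)] by blast
  have "K * (v - u) < 2 * pi"
  proof (rule ccontr)
    assume "\<not> ?thesis"
    then have "2 * pi \<le> K * (v - u)" by simp
    then obtain t where t: "t \<in> {u..v}" "cos (\<theta> t - \<alpha>) = 1"
      by (rule has_slope_reaches_crest[OF K \<sigma>])
    then show False using bang_structureD(3)[OF S, of t] u v h by auto
  qed
  then show ?thesis using that v free \<sigma> by blast
qed

text \<open>For \<open>h < 1\<close> the sense of turning alternates from switch to switch, no arc makes a full
  turn, and there are at most two switches before \<open>T\<close>.\<close>

lemma three_piece_transversal:
  assumes \<theta>: "minimax_angle K T \<theta>" and S: "bang_structure K T \<theta> \<alpha> h" and h: "h < 1"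
  shows "three_piece_angle K T \<theta>"
proof -
  have K: "0 < K" and T: "0 < T" using minimax_angleD[OF \<theta>] by auto
  obtain p \<sigma> where p: "0 < p" "p \<le> T" "p = T \<or> cos (\<theta> p - \<alpha>) = h"
      and f1: "\<forall>t\<in>{0<..<p}. cos (\<theta> t - \<alpha>) < h"
      and \<sigma>: "\<sigma> \<in> {1, -1}" "has_slope \<theta> (\<sigma> * K) 0 p" and s1: "K * (p - 0) < 2 * pi"
    by (rule bang_structure_next_switch[OF K S h order.refl T])
  show ?thesis
  proof (cases "p = T")
    case True
    then show ?thesis using three_piece_single_arc[OF \<theta>] real_sign_as_int \<sigma> by metis
  next
    case False
    then have p': "0 \<le> p" "p < T" "cos (\<theta> p - \<alpha>) = h" using p by auto
    obtain q \<tau> where q: "p < q" "q \<le> T" "q = T \<or> cos (\<theta> q - \<alpha>) = h"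
        and f2: "\<forall>t\<in>{p<..<q}. cos (\<theta> t - \<alpha>) < h"
        and \<tau>: "\<tau> \<in> {1, -1}" "has_slope \<theta> (\<tau> * K) p q" and s2: "K * (q - p) < 2 * pi"
      by (rule bang_structure_next_switch[OF K S h p'(1,2)])
    have \<tau>\<sigma>: "\<tau> = - \<sigma>"
      by (rule bang_structure_zero_switches[OF K S h order.refl p(1) q(1,2) p'(3) \<sigma> \<tau>])
    show ?thesis
    proof (cases "q = T")
      case True
      then show ?thesis
        using three_piece_two_arcs[OF K \<sigma>(1) p(1) p'(2) _ _ \<sigma>(2)] \<tau>(2) \<tau>\<sigma> s1 s2 by simp
    next
      case False
      then have q': "0 \<le> q" "q < T" "cos (\<theta> q - \<alpha>) = h" using p q by auto
      obtain r \<rho> where r: "q < r" "r \<le> T" "r = T \<or> cos (\<theta> r - \<alpha>) = h"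
          and f3: "\<forall>t\<in>{q<..<r}. cos (\<theta> t - \<alpha>) < h"
          and \<rho>: "\<rho> \<in> {1, -1}" "has_slope \<theta> (\<rho> * K) q r" and s3: "K * (r - q) < 2 * pi"
        by (rule bang_structure_next_switch[OF K S h q'(1,2)])
      have "\<rho> = - \<tau>"
        by (rule bang_structure_zero_switches[OF K S h p'(1) q(1) r(1,2) q'(3) \<tau> \<rho>])
      then have \<rho>\<sigma>: "\<rho> = \<sigma>" using \<tau>\<sigma> by simp
      have "r = T"
        using minimax_angle_no_three_switches[OF \<theta> S h p(1) q(1) r(1,2) p'(3) q'(3) _ f1 f2 f3] r(3)
        by blast
      then have line: "\<forall>t\<in>{0..T}. \<theta> t = broken_line (\<theta> p) (\<sigma> * K) (- \<sigma> * K) (\<sigma> * K) p q t"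
        using \<sigma> \<tau> \<tau>\<sigma> \<rho> \<rho>\<sigma> p q by (intro ballI broken_line_of_slopes) auto
      have m: "\<sigma> * K \<in> {K, - K}" using \<sigma>(1) by auto
      show ?thesis
        using three_piece_angleI[OF order.refl order.refl p(1) q(1) q'(2) line m m s1] s2 s3 \<open>r = T\<close>
        by simp
    qed
  qed
qed

text \<open>The nearest crests on both sides of \<open>t\<close> bound a gap, and the gaps are full turns for \<open>h =
  1\<close>.\<close>

lemma bang_structure_loop_around:
  assumes K: "0 < K" and \<theta>: "continuous_on {0..T} \<theta>" and S: "bang_structure K T \<theta> \<alpha> 1"
    and pq: "0 \<le> p" "p < t" "t < q" "q \<le> T"
    and crest: "cos (\<theta> p - \<alpha>) = 1" "cos (\<theta> q - \<alpha>) = 1" "cos (\<theta> t - \<alpha>) \<noteq> 1"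
  obtains a b \<tau> where "p \<le> a" "a < t" "t < b" "b \<le> q" "cos (\<theta> a - \<alpha>) = 1" "cos (\<theta> b - \<alpha>) = 1"
    "K * (b - a) = 2 * pi" "\<tau> \<in> {1, -1 :: int}" "has_slope \<theta> (of_int \<tau> * K) a b"
proof -
  have comp: "compact {s \<in> {c..d}. cos (\<theta> s - \<alpha>) = 1}" if "0 \<le> c" "d \<le> T" for c d
  proof -
    have "continuous_on {c..d} (\<lambda>s. cos (\<theta> s - \<alpha>))"
      using that by (intro continuous_intros continuous_on_subset[OF \<theta>]) auto
    then have "closed {s \<in> {c..d}. cos (\<theta> s - \<alpha>) = 1}"
      by (rule continuous_closed_preimage_constant) simp
    moreover have "bounded {s \<in> {c..d}. cos (\<theta> s - \<alpha>) = 1}"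
      by (rule bounded_subset[of "{c..d}"]) auto
    ultimately show ?thesis unfolding compact_eq_bounded_closed by blast
  qed
  let ?A = "{s \<in> {p..t}. cos (\<theta> s - \<alpha>) = 1}"
  let ?B = "{s \<in> {t..q}. cos (\<theta> s - \<alpha>) = 1}"
  have "p \<in> ?A" "q \<in> ?B" using pq crest by auto
  then have ne: "?A \<noteq> {}" "?B \<noteq> {}" by blast+
  have cmp: "compact ?A" "compact ?B" using pq by (intro comp; simp)+
  obtain a where a: "a \<in> ?A" "\<And>s. s \<in> ?A \<Longrightarrow> s \<le> a"
    using compact_attains_sup[OF cmp(1) ne(1)] by blast
  obtain b where b: "b \<in> ?B" "\<And>s. s \<in> ?B \<Longrightarrow> b \<le> s"
    using compact_attains_inf[OF cmp(2) ne(2)] by blast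
  have ab: "p \<le> a" "a < t" "t < b" "b \<le> q" "cos (\<theta> a - \<alpha>) = 1" "cos (\<theta> b - \<alpha>) = 1"
    using a(1) b(1) crest(3) by (auto simp: less_le)
  have free: "\<forall>s\<in>{a<..<b}. cos (\<theta> s - \<alpha>) < 1"
  proof
    fix s assume s: "s \<in> {a<..<b}"
    have "cos (\<theta> s - \<alpha>) \<noteq> 1"
    proof
      assume "cos (\<theta> s - \<alpha>) = 1"
      then show False using a(2)[of s] b(2)[of s] s ab by (cases "s \<le> t") auto
    qed
    then show "cos (\<theta> s - \<alpha>) < 1" using cos_le_one[of "\<theta> s - \<alpha>"] by linarith
  qed
  have b0: "0 \<le> a" "a < b" "b \<le> T" using ab pq by auto
  have gap: "K * (b - a) = 2 * pi"
    using bang_structure_gap[OF K S b0 ab(5,6) free] by simp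
  obtain \<sigma> where \<sigma>: "\<sigma> \<in> {1, -1}" "has_slope \<theta> (\<sigma> * K) a b"
    using bang_structureD(4)[OF S b0 free] by blast
  obtain \<tau> where "\<tau> \<in> {1, -1 :: int}" "\<sigma> = of_int \<tau>" by (rule real_sign_as_int[OF \<sigma>(1)])
  then show ?thesis using that[OF ab gap] \<sigma>(2) by blast
qed

lemma has_slope_reverse:
  assumes s: "has_slope \<theta> m u v" and uv: "u \<le> v"
  shows "has_slope (\<lambda>t. \<theta> (T - t)) (- m) (T - v) (T - u)"
proof (rule has_slopeI[where c="\<theta> v"])
  fix t assume "t \<in> {T - v..T - u}"
  then have "\<theta> (T - t) = \<theta> v + m * (T - t - v)" using uv by (intro has_slope_diff[OF s]) auto
  then show "\<theta> (T - t) = \<theta> v + - m * (t - (T - v))" by (simp add: algebra_simps)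
qed

text \<open>If the curve never has the direction \<open>\<alpha>\<close>, it is a single arc. Otherwise let \<open>p\<close> and \<open>q\<close> be
  the first and the last time at which it has this direction. Before \<open>p\<close> and after \<open>q\<close> it turns
  by less than a full turn each. In between it is either straight, or it contains a loop; as
  there is at most one loop, all the rest of \<open>{p..q}\<close> is straight. An arc at one of the ends,
  the loop and a line cannot occur together, which leaves SOS and COC.\<close>

lemma three_piece_tangential:
  assumes \<theta>: "minimax_angle K T \<theta>" and S: "bang_structure K T \<theta> \<alpha> 1"
  shows "three_piece_angle K T \<theta>"
proof -
  note \<theta>D = minimax_angleD[OF \<theta>]
  have K: "0 < K" and T: "0 < T" by (fact \<theta>D)+
  let ?crest = "\<lambda>t. cos (\<theta> t - \<alpha>) = 1"
  have less: "cos (\<theta> t - \<alpha>) < 1" if "\<not> ?crest t" for t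
    using that cos_le_one[of "\<theta> t - \<alpha>"] by linarith
  have single: ?thesis if free: "\<forall>t\<in>{0<..<T}. \<not> ?crest t"
  proof -
    have "\<forall>t\<in>{0<..<T}. cos (\<theta> t - \<alpha>) < 1" using free less by blast
    then obtain \<sigma> where \<sigma>: "\<sigma> \<in> {1, -1}" "has_slope \<theta> (\<sigma> * K) 0 T"
      using bang_structureD(4)[OF S order.refl T order.refl] by blast
    then show ?thesis using three_piece_single_arc[OF \<theta>] real_sign_as_int by metis
  qed
  show ?thesis
  proof (cases "\<exists>t\<in>{0..T}. ?crest t")
    case False
    then show ?thesis using single by auto
  next
    case True
    define N where "N = {t \<in> {0..T}. ?crest t}"
    have "closed N" unfolding N_def
      by (intro continuous_closed_preimage_constant continuous_intros \<theta>D; simp)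
    moreover have "bounded N" by (rule bounded_subset[of "{0..T}"]) (auto simp: N_def)
    ultimately have "compact N" unfolding compact_eq_bounded_closed by blast
    moreover have "N \<noteq> {}" using True by (auto simp: N_def)
    ultimately obtain p q where pN: "p \<in> N" "\<And>t. t \<in> N \<Longrightarrow> p \<le> t" and qN: "q \<in> N" "\<And>t. t \<in> N \<Longrightarrow> t \<le> q"
      using compact_attains_inf[of N] compact_attains_sup[of N] by blast
    have pq: "0 \<le> p" "p \<le> q" "q \<le> T" "?crest p" "?crest q" using pN qN by (auto simp: N_def)
    have pre: "\<not> ?crest t" if "0 \<le> t" "t < p" for t using pN(2)[of t] that pq by (auto simp: N_def)
    have post: "\<not> ?crest t" if "q < t" "t \<le> T" for t using qN(2)[of t] that pq by (auto simp: N_def)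
    have "\<exists>\<sigma>\<in>{1, -1 :: int}. has_slope \<theta> (of_int \<sigma> * K) 0 p \<and> K * p < 2 * pi"
    proof (cases "p = 0")
      case True
      then show ?thesis by (intro bexI[of _ 1]) (auto simp: has_slope_def)
    next
      case False
      then have p0: "0 < p" "p \<le> T" using pq by auto
      have "\<forall>t\<in>{0<..<p}. cos (\<theta> t - \<alpha>) < 1" using pre less by auto
      then obtain \<sigma> where \<sigma>: "\<sigma> \<in> {1, -1}" "has_slope \<theta> (\<sigma> * K) 0 p"
        using bang_structureD(4)[OF S order.refl p0] by blast
      have "K * p < 2 * pi"
      proof (rule ccontr)
        assume "\<not> K * p < 2 * pi"
        then have "0 \<le> p - 2 * pi / K" using K by (simp add: field_simps)
        then have "?crest (p - 2 * pi / K)"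
          using has_slope_full_turn[OF K \<sigma>, of "p - 2 * pi / K" \<alpha>] pq(4) by simp
        then show False using pre \<open>0 \<le> p - 2 * pi / K\<close> K by simp
      qed
      then show ?thesis using \<sigma> by (elim real_sign_as_int) auto
    qed
    then obtain \<sigma> :: int where \<sigma>: "\<sigma> \<in> {1, -1}" "has_slope \<theta> (of_int \<sigma> * K) 0 p" "K * p < 2 * pi"
      by blast
    have "\<exists>\<sigma>\<in>{1, -1 :: int}. has_slope \<theta> (of_int \<sigma> * K) q T \<and> K * (T - q) < 2 * pi"
    proof (cases "q = T")
      case True
      then show ?thesis by (intro bexI[of _ 1]) (auto simp: has_slope_def)
    next
      case False
      then have q0: "0 \<le> q" "q < T" using pq by auto
      have "\<forall>t\<in>{q<..<T}. cos (\<theta> t - \<alpha>) < 1" using post less by auto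
      then obtain \<sigma> where \<sigma>: "\<sigma> \<in> {1, -1}" "has_slope \<theta> (\<sigma> * K) q T"
        using bang_structureD(4)[OF S q0 order.refl] by blast
      have "K * (T - q) < 2 * pi"
      proof (rule ccontr)
        assume "\<not> K * (T - q) < 2 * pi"
        then have le: "q + 2 * pi / K \<le> T" using K by (simp add: field_simps)
        then have "?crest (q + 2 * pi / K)"
          using has_slope_full_turn[OF K \<sigma> order.refl, of \<alpha>] pq(5) by simp
        then show False using post le K by simp
      qed
      then show ?thesis using \<sigma> by (elim real_sign_as_int) auto
    qed
    then obtain \<tau> :: int where \<tau>: "\<tau> \<in> {1, -1}" "has_slope \<theta> (of_int \<tau> * K) q T" "K * (T - q) < 2 * pi"
      by blast
    have m: "of_int \<sigma> * K \<in> {K, - K}" "of_int \<tau> * K \<in> {K, - K}" using \<sigma>(1) \<tau>(1) by auto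
    \<comment> \<open>Prolong the outer arcs to positive length but to less than a full turn, as they may be
      empty.\<close>
    define A where "A = (p - 2 * pi / K) / 2"
    define B where "B = q + (T - q + 2 * pi / K) / 2"
    have "p < 2 * pi / K" "T - q < 2 * pi / K" using \<sigma>(3) \<tau>(3) K by (auto simp: field_simps)
    then have A: "A \<le> 0" "A < p" and B: "T \<le> B" "q < B" using pq by (auto simp: A_def B_def field_simps)
    have "K * (p - A) = (K * p + 2 * pi) / 2" "K * (B - q) = (K * (T - q) + 2 * pi) / 2"
      using K by (auto simp: A_def B_def field_simps)
    then have AB: "K * (p - A) < 2 * pi" "K * (B - q) < 2 * pi" using \<sigma>(3) \<tau>(3) by auto
    have flat: "has_slope \<theta> 0 u v" if "0 \<le> u" "v \<le> T" "\<And>t. t \<in> {u..v} \<Longrightarrow> ?crest t" for u v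
      using that by (intro has_slope_at_crest[where \<alpha>=\<alpha>] continuous_on_subset[OF \<theta>D(4)]) auto
    show ?thesis
    proof (cases "\<forall>t\<in>{p..q}. ?crest t")
      case True
      then have line: "has_slope \<theta> 0 p q" using pq by (intro flat) auto
      show ?thesis
      proof (cases "p < q")
        case True
        have "\<forall>t\<in>{0..T}. \<theta> t = broken_line (\<theta> p) (of_int \<sigma> * K) 0 (of_int \<tau> * K) p q t"
          using \<sigma>(2) line \<tau>(2) pq by (intro ballI broken_line_of_slopes) auto
        then show ?thesis
          by (rule three_piece_angleI[OF A(1) B(1) A(2) True B(2) _ m AB]) simp
      next
        case False
        then have q: "q = p" using pq by simp
        show ?thesis
        proof (cases "p = 0 \<or> p = T")
          case True
          then show ?thesis using pre post q by (intro single) auto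
        next
          case False
          then have p: "0 < p" "p < T" using pq by auto
          show ?thesis
          proof (cases "\<tau> = \<sigma>")
            case True
            then have "has_slope \<theta> (of_int \<sigma> * K) 0 T"
              using has_slope_join[OF \<sigma>(2)] \<tau>(2) p q by auto
            then show ?thesis by (rule three_piece_single_arc[OF \<theta> \<sigma>(1)])
          next
            case False
            then have "\<tau> = - \<sigma>" using \<sigma>(1) \<tau>(1) by auto
            then show ?thesis
              using three_piece_two_arcs[OF K _ p \<sigma>(3) _ \<sigma>(2)] \<tau>(2,3) \<sigma>(1) q by auto
          qed
        qed
      qed
    next
      case False
      then obtain t where t: "t \<in> {p..q}" "\<not> ?crest t" by blast
      then have "p < t" "t < q" using pq by (auto simp: less_le)
      then obtain a b \<rho> where ab: "p \<le> a" "a < t" "t < b" "b \<le> q" "?crest a" "?crest b"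
          "K * (b - a) = 2 * pi" "\<rho> \<in> {1, -1 :: int}" "has_slope \<theta> (of_int \<rho> * K) a b"
        using bang_structure_loop_around[OF K \<theta>D(4) S pq(1) _ _ pq(3,4,5) t(2)] by metis
      have "a < b" "0 \<le> a" "b \<le> T" "0 \<le> b" "a \<le> b" using ab pq by auto
      have crest_pa: "?crest u" if u: "u \<in> {p..a}" for u
      proof (rule ccontr)
        assume nc: "\<not> ?crest u"
        then have "p < u" "u < a" using u pq ab by (auto simp: less_le)
        obtain c d \<rho>' where cd: "p \<le> c" "c < u" "u < d" "d \<le> a" "K * (d - c) = 2 * pi"
            "\<rho>' \<in> {1, -1 :: int}" "has_slope \<theta> (of_int \<rho>' * K) c d"
          using bang_structure_loop_around[OF K \<theta>D(4) S pq(1) \<open>p < u\<close> \<open>u < a\<close> _ pq(4) ab(5) nc]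
            \<open>a < b\<close> \<open>b \<le> T\<close> by (metis less_imp_le order.trans)
        have "0 \<le> c" "c \<le> d" using cd pq by auto
        then show False
          using minimax_angle_no_two_loops[OF \<theta> _ _ cd(4) \<open>a \<le> b\<close> \<open>b \<le> T\<close> cd(5) ab(7) cd(6,7) ab(8,9)] by blast
      qed
      have crest_bq: "?crest u" if u: "u \<in> {b..q}" for u
      proof (rule ccontr)
        assume nc: "\<not> ?crest u"
        then have "b < u" "u < q" using u pq ab by (auto simp: less_le)
        obtain c d \<rho>' where cd: "b \<le> c" "c < u" "u < d" "d \<le> q" "K * (d - c) = 2 * pi"
            "\<rho>' \<in> {1, -1 :: int}" "has_slope \<theta> (of_int \<rho>' * K) c d"
          using bang_structure_loop_around[OF K \<theta>D(4) S \<open>0 \<le> b\<close> \<open>b < u\<close> \<open>u < q\<close> pq(3) ab(6) pq(5) nc] by metis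
        have "c \<le> d" "d \<le> T" using cd pq by auto
        then show False
          using minimax_angle_no_two_loops[OF \<theta> \<open>0 \<le> a\<close> \<open>a \<le> b\<close> cd(1) _ _ ab(7) cd(5) ab(8,9) cd(6,7)] by blast
      qed
      have line1: "has_slope \<theta> 0 p a" using ab pq by (intro flat crest_pa) auto
      have line2: "has_slope \<theta> 0 b q" using ab pq by (intro flat crest_bq) auto
      have cis_eq: "cis (\<theta> x) = cis (\<theta> y)" if "?crest x" "?crest y" for x y
        by (rule cis_eq_of_crests[OF that])
      have mid: "of_int \<rho> * K \<in> {K, - K}" using ab(8) by auto
      consider (SOS) "p = 0" "q = T" | (COC) "p = a" "q = b"
        | (start) "0 < p" "p < a \<or> b < q" | (finish) "q < T" "p < a \<or> b < q"
        using pq ab by fastforce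
      then show ?thesis
      proof cases
        case SOS
        have "\<forall>t\<in>{0..T}. \<theta> t = broken_line (\<theta> a) 0 (of_int \<rho> * K) 0 a b t"
          using line1 line2 ab SOS \<open>a \<le> b\<close> by (intro ballI broken_line_of_slopes) auto
        moreover have "- 1 \<le> (0::real)" "T \<le> T + 1" "- 1 < a" "b < T + 1" using \<open>0 \<le> a\<close> \<open>b \<le> T\<close> by auto
        ultimately show ?thesis
          unfolding three_piece_angle_def using mid \<open>a < b\<close> ab(7) by blast
      next
        case COC
        have line: "\<forall>t\<in>{0..T}. \<theta> t = broken_line (\<theta> p) (of_int \<sigma> * K) (of_int \<rho> * K) (of_int \<tau> * K) p q t"
          using \<sigma>(2) ab(9) \<tau>(2) COC pq by (intro ballI broken_line_of_slopes) auto
        have "p < q" using COC \<open>a < b\<close> by simp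
        from three_piece_angleI[OF A(1) B(1) A(2) this B(2) line m AB]
        show ?thesis using mid ab(7) COC by blast
      next
        case start
        show ?thesis
        proof (cases "p < a")
          case True
          then show ?thesis
            using minimax_angle_no_arc_loop_line[OF \<theta> start(1) ab(1) \<open>a \<le> b\<close> \<open>b \<le> T\<close> ab(7) \<sigma>(3,1,2)
                ab(8,9) line1 order.refl] \<open>b \<le> T\<close> \<open>a \<le> b\<close> by auto
        next
          case False
          then have "b < q" using start by simp
          then show ?thesis
            using minimax_angle_no_arc_loop_line[OF \<theta> start(1) ab(1) \<open>a \<le> b\<close> \<open>b \<le> T\<close> ab(7) \<sigma>(3,1,2)
                ab(8,9) line2] ab cis_eq[OF ab(6) pq(4)] pq by auto
        qed
      next
        case finish
        \<comment> \<open>Time reversal turns the final arc into an initial one.\<close>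
        let ?\<eta> = "\<lambda>t. \<theta> (T - t)"
        have \<eta>: "minimax_angle K T ?\<eta>" by (rule minimax_angle_reverse[OF \<theta>])
        have arc: "has_slope ?\<eta> (of_int (- \<tau>) * K) 0 (T - q)" "- \<tau> \<in> {1, -1}"
          using has_slope_reverse[OF \<tau>(2) pq(3), of T] \<tau>(1) by auto
        have loop: "has_slope ?\<eta> (of_int (- \<rho>) * K) (T - b) (T - a)" "- \<rho> \<in> {1, -1}"
          using has_slope_reverse[OF ab(9) \<open>a \<le> b\<close>, of T] ab(8) by auto
        have l1: "has_slope ?\<eta> 0 (T - a) (T - p)" and l2: "has_slope ?\<eta> 0 (T - q) (T - b)"
          using has_slope_reverse[OF line1 ab(1), of T] has_slope_reverse[OF line2 ab(4), of T] by auto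
        have o: "0 < T - q" "T - q \<le> T - b" "T - b \<le> T - a" "T - a \<le> T" "K * (T - a - (T - b)) = 2 * pi"
          using finish ab pq \<open>0 \<le> a\<close> by auto
        show ?thesis
        proof (cases "p < a")
          case True
          then show ?thesis
            using minimax_angle_no_arc_loop_line[OF \<eta> o \<tau>(3) arc(2,1) loop(2,1) l1] o pq ab
              cis_eq[OF ab(5) pq(5)] by auto
        next
          case False
          then have "b < q" using finish by simp
          then show ?thesis
            using minimax_angle_no_arc_loop_line[OF \<eta> o \<tau>(3) arc(2,1) loop(2,1) l2 order.refl] o pq ab by auto
        qed
      qed
    qed
  qed
qed

theorem minimax_angle_three_piece:
  assumes \<theta>: "minimax_angle K T \<theta>"
  shows "three_piece_angle K T \<theta>"
  using minimax_angle_bang_structure[OF \<theta>]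
proof (elim disjE exE bexE)
  fix \<sigma> :: real assume "\<sigma> \<in> {1, -1}" "has_slope \<theta> (\<sigma> * K) 0 T"
  then show ?thesis using three_piece_single_arc[OF \<theta>] real_sign_as_int by metis
next
  fix \<alpha> h assume S: "bang_structure K T \<theta> \<alpha> h"
  show ?thesis
  proof (cases "h < 1")
    case True
    then show ?thesis by (rule three_piece_transversal[OF \<theta> S])
  next
    case False
    then have "h = 1" using bang_structureD(2)[OF S] by simp
    then show ?thesis using three_piece_tangential[OF \<theta>] S by simp
  qed
qed

section \<open>Weak derivatives and Lipschitz constants\<close>

lemma DERIV_self_times_abs: "((\<lambda>x::real. x * \<bar>x\<bar>) has_real_derivative 2 * \<bar>x\<bar>) (at x)"
proof -
  consider "x = 0" | "0 < x" | "x < 0" by linarith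
  then show ?thesis
  proof cases
    case 1
    have "((\<lambda>y::real. \<bar>y\<bar>) \<longlongrightarrow> 0) (at 0)" by (rule tendsto_rabs_zero[OF tendsto_ident_at])
    then have "((\<lambda>y::real. (y * \<bar>y\<bar> - 0 * \<bar>0\<bar>) / (y - 0)) \<longlongrightarrow> 0) (at 0)"
      by (rule Lim_transform_eventually) (simp add: eventually_at_filter)
    then show ?thesis using 1 by (simp add: has_field_derivative_iff)
  next
    case 2
    have "((\<lambda>x::real. x * x) has_real_derivative 2 * \<bar>x\<bar>) (at x)"
      using 2 by (auto intro!: derivative_eq_intros)
    then show ?thesis
      by (rule has_field_derivative_transform_within_open[of _ _ _ "{0<..}"]) (use 2 in auto)
  next
    case 3
    have "((\<lambda>x::real. - (x * x)) has_real_derivative 2 * \<bar>x\<bar>) (at x)"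
      using 3 by (auto intro!: derivative_eq_intros)
    then show ?thesis
      by (rule has_field_derivative_transform_within_open[of _ _ _ "{..<0}"]) (use 3 in auto)
  qed
qed

text \<open>The hat function of mass \<open>1\<close> with support \<open>{-1..1}\<close>, used as a smoothing kernel.\<close>

definition tent :: "real \<Rightarrow> real" where
  "tent x = (\<bar>x + 1\<bar> - 2 * \<bar>x\<bar> + \<bar>x - 1\<bar>) / 2"

text \<open>The primitive of the hat function that runs from \<open>-1/2\<close> to \<open>1/2\<close>; it is continuously
  differentiable because \<open>x * \<bar>x\<bar>\<close> is.\<close>

definition ramp :: "real \<Rightarrow> real" where
  "ramp x = ((x + 1) * \<bar>x + 1\<bar> - 2 * (x * \<bar>x\<bar>) + (x - 1) * \<bar>x - 1\<bar>) / 4"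

lemma tent_nonneg: "0 \<le> tent x"
  by (auto simp: tent_def abs_if)

lemma tent_outside: "1 \<le> \<bar>x\<bar> \<Longrightarrow> tent x = 0"
  by (auto simp: tent_def abs_if split: if_splits)

lemma continuous_on_tent [continuous_intros]:
  "continuous_on S f \<Longrightarrow> continuous_on S (\<lambda>x. tent (f x))"
  unfolding tent_def by (intro continuous_intros; simp)

lemma DERIV_ramp: "(ramp has_real_derivative tent x) (at x)"
proof -
  have l: "((\<lambda>x. (x + 1) * \<bar>x + 1\<bar>) has_real_derivative 2 * \<bar>x + 1\<bar>) (at x)"
    using DERIV_shift[of "\<lambda>x. x * \<bar>x\<bar>" "2 * \<bar>x + 1\<bar>" x 1] DERIV_self_times_abs by blast
  have r: "((\<lambda>x. (x + -1) * \<bar>x + -1\<bar>) has_real_derivative 2 * \<bar>x + -1\<bar>) (at x)"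
    using DERIV_shift[of "\<lambda>x. x * \<bar>x\<bar>" "2 * \<bar>x + -1\<bar>" x "-1"] DERIV_self_times_abs by blast
  have eq: "tent x = (2 * \<bar>x + 1\<bar> - 2 * (2 * \<bar>x\<bar>) + 2 * \<bar>x + -1\<bar>) / 4" by (simp add: tent_def)
  have ramp: "ramp = (\<lambda>x. ((x + 1) * \<bar>x + 1\<bar> - 2 * (x * \<bar>x\<bar>) + (x + -1) * \<bar>x + -1\<bar>) / 4)"
    by (simp add: ramp_def fun_eq_iff)
  show ?thesis
    unfolding eq ramp
    by (intro DERIV_cdivide DERIV_add DERIV_diff DERIV_cmult DERIV_self_times_abs l r)
qed

lemma ramp_left: "x \<le> - 1 \<Longrightarrow> ramp x = - 1 / 2"
  by (cases "x = - 1") (simp_all add: ramp_def abs_if algebra_simps)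

lemma ramp_right: "1 \<le> x \<Longrightarrow> ramp x = 1 / 2"
  by (cases "x = 1") (simp_all add: ramp_def abs_if algebra_simps)

lemma ramp_mono:
  assumes "x \<le> y" shows "ramp x \<le> ramp y"
proof (rule DERIV_nonneg_imp_nondecreasing[OF assms])
  show "\<exists>y. (ramp has_real_derivative y) (at x) \<and> 0 \<le> y" for x
    using DERIV_ramp tent_nonneg by blast
qed

lemma ramp_bounds: "- 1 / 2 \<le> ramp x" "ramp x \<le> 1 / 2"
  using ramp_mono[of "min x (- 1)" x] ramp_mono[of x "max x 1"]
    ramp_left[of "min x (- 1)"] ramp_right[of "max x 1"] by auto

lemma DERIV_ramp_scaled:
  assumes "0 < h"
  shows "((\<lambda>x. ramp ((x - s) / h)) has_real_derivative tent ((x - s) / h) / h) (at x)"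
proof -
  have "((\<lambda>x. (x - s) / h) has_real_derivative 1 / h) (at x)"
    using assms by (auto intro!: derivative_eq_intros)
  from DERIV_chain2[OF DERIV_ramp this] show ?thesis by simp
qed

text \<open>A smoothed indicator function of \<open>{s..t}\<close>.\<close>

lemma test_function_ramps:
  assumes h: "0 < h" and st: "s \<le> t" "a < s - h" "t + h < b"
  shows "test_function a b (\<lambda>x. ramp ((x - s) / h) - ramp ((x - t) / h))
     (\<lambda>x. tent ((x - s) / h) / h - tent ((x - t) / h) / h)"
  unfolding test_function_def
proof (intro conjI allI exI[of _ "{s - h..t + h}"] impI)
  show "((\<lambda>x. ramp ((x - s) / h) - ramp ((x - t) / h)) has_real_derivative
      tent ((x - s) / h) / h - tent ((x - t) / h) / h) (at x)" for x
    by (intro DERIV_diff DERIV_ramp_scaled h)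
  show "continuous_on UNIV (\<lambda>x. tent ((x - s) / h) / h - tent ((x - t) / h) / h)"
    using h by (intro continuous_intros) auto
  fix x assume "x \<notin> {s - h..t + h}"
  then have "((x - s) / h \<le> - 1 \<and> (x - t) / h \<le> - 1) \<or> (1 \<le> (x - s) / h \<and> 1 \<le> (x - t) / h)"
    using h st by (auto simp: field_simps)
  then show "ramp ((x - s) / h) - ramp ((x - t) / h) = 0" by (auto simp: ramp_left ramp_right)
qed (use st h in auto)

lemma tent_average:
  fixes u :: "real \<Rightarrow> 'a::euclidean_space"
  assumes u: "continuous_on {a..b} u" and h: "0 < h" and s: "a < s - h" "s + h < b"
    and osc: "\<And>x. \<bar>x - s\<bar> \<le> h \<Longrightarrow> norm (u x - u s) \<le> e"
  shows "norm (integral {a..b} (\<lambda>x. (tent ((x - s) / h) / h) *\<^sub>R u x) - u s) \<le> e"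
proof -
  define k where "k x = tent ((x - s) / h) / h" for x
  have ck: "continuous_on {a..b} k" unfolding k_def using h by (intro continuous_intros) auto
  have k: "(k has_integral 1) {a..b}"
  proof -
    have "(k has_integral ramp ((b - s) / h) - ramp ((a - s) / h)) {a..b}"
    proof (rule fundamental_theorem_of_calculus)
      show "((\<lambda>x. ramp ((x - s) / h)) has_vector_derivative k x) (at x within {a..b})" for x
        using DERIV_ramp_scaled[OF h, of s x]
        by (simp add: k_def has_real_derivative_iff_has_vector_derivative has_vector_derivative_at_within)
    qed (use s h in auto)
    moreover have "ramp ((b - s) / h) = 1 / 2" "ramp ((a - s) / h) = - 1 / 2"
      using ramp_right[of "(b - s) / h"] ramp_left[of "(a - s) / h"] h s
      by (auto simp: pos_le_divide_eq pos_divide_le_eq)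
    ultimately show ?thesis by simp
  qed
  have "integral {a..b} (\<lambda>x. k x *\<^sub>R u x) - u s = integral {a..b} (\<lambda>x. k x *\<^sub>R (u x - u s))"
  proof -
    have "integral {a..b} (\<lambda>x. k x *\<^sub>R u s) = u s"
      using has_integral_scaleR_left[OF k, of "u s"] by (simp add: integral_unique)
    moreover have "integral {a..b} (\<lambda>x. k x *\<^sub>R (u x - u s))
        = integral {a..b} (\<lambda>x. k x *\<^sub>R u x) - integral {a..b} (\<lambda>x. k x *\<^sub>R u s)"
      by (subst integral_diff[symmetric])
        (auto intro!: integrable_continuous_real continuous_intros ck u simp: scaleR_diff_right)
    ultimately show ?thesis by simp
  qed
  also have "norm \<dots> \<le> integral {a..b} (\<lambda>x. k x * e)"
  proof (rule integral_norm_bound_integral)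
    fix x
    have "0 \<le> k x" using tent_nonneg h by (simp add: k_def)
    moreover have "k x = 0 \<or> norm (u x - u s) \<le> e"
    proof (cases "\<bar>x - s\<bar> \<le> h")
      case False
      then have "1 \<le> \<bar>(x - s) / h\<bar>" using h by (simp add: abs_divide)
      then show ?thesis using tent_outside by (simp add: k_def)
    qed (use osc in auto)
    ultimately show "norm (k x *\<^sub>R (u x - u s)) \<le> k x * e" by (auto intro: mult_left_mono)
  qed (auto intro!: integrable_continuous_real continuous_intros ck u)
  also have "\<dots> = e" using integral_unique[OF has_integral_mult_left[OF k, of e]] by simp
  finally show ?thesis unfolding k_def .
qed

lemma LINT_Ioo_eq_integral:
  fixes f :: "real \<Rightarrow> 'a::euclidean_space"
  assumes "f absolutely_integrable_on {a..b}"
  shows "integrable (lebesgue_on {a<..<b}) f" "(LINT t|lebesgue_on {a<..<b}. f t) = integral {a..b} f"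
proof -
  have "f absolutely_integrable_on {a<..<b}"
    using assms by (rule set_integrable_subset) auto
  then show i: "integrable (lebesgue_on {a<..<b}) f"
    by (simp add: integrable_restrict_space set_integrable_def)
  have "(LINT t|lebesgue_on {a<..<b}. f t) = integral {a<..<b} f"
    by (rule lebesgue_integral_eq_integral[OF i]) auto
  then show "(LINT t|lebesgue_on {a<..<b}. f t) = integral {a..b} f"
    by (simp add: integral_open_interval_real)
qed

lemma LINT_continuous_eq_integral:
  fixes f :: "real \<Rightarrow> 'a::euclidean_space"
  assumes "continuous_on {a..b} f"
  shows "(LINT t|lebesgue_on {a<..<b}. f t) = integral {a..b} f"
  by (rule LINT_Ioo_eq_integral[OF absolutely_integrable_continuous_real[OF assms]])

text \<open>Test the weak derivative with a smoothed indicator function of \<open>{s..t}\<close>. Its derivative is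
  the difference of two kernels, so one side of the defining identity is close to \<open>u s - u t\<close>;
  the other is at most \<open>M\<close> times the length of the support of the test function.\<close>

lemma weak_derivative_bound:
  assumes wd: "weak_derivative a b u g" and u: "continuous_on {a..b} u" and g: "Linf_on {a<..<b} g"
    and st: "a < s" "s \<le> t" "t < b"
    and M: "AE x in lebesgue_on {a<..<b}. norm (g x) \<le> M" and M0: "0 \<le> M"
  shows "norm (u t - u s) \<le> M * (t - s)"
proof (rule field_le_epsilon)
  fix e :: real assume e: "0 < e"
  have s_in: "s \<in> {a..b}" "t \<in> {a..b}" using st by auto
  obtain d1 where d1: "0 < d1" "\<And>x. x \<in> {a..b} \<Longrightarrow> dist x s < d1 \<Longrightarrow> dist (u x) (u s) < e / 4"
    using u[unfolded continuous_on_iff] s_in(1) e by (metis divide_pos_pos zero_less_numeral)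
  obtain d2 where d2: "0 < d2" "\<And>x. x \<in> {a..b} \<Longrightarrow> dist x t < d2 \<Longrightarrow> dist (u x) (u t) < e / 4"
    using u[unfolded continuous_on_iff] s_in(2) e by (metis divide_pos_pos zero_less_numeral)
  \<comment> \<open>Apart from keeping the support inside the interval, \<open>h\<close> makes \<open>u\<close> oscillate by at most \<open>e /
    4\<close> under the kernels, and the overlap \<open>2 * h\<close> of the support adds at most \<open>e / 2\<close>.\<close>
  define h where "h = Min {d1 / 2, d2 / 2, (s - a) / 2, (b - t) / 2, e / (4 * M + 1)}"
  have pos: "0 < h" using d1 d2 st e M0 by (simp add: h_def)
  have hle: "h \<le> d1 / 2" "h \<le> d2 / 2" "h \<le> (s - a) / 2" "h \<le> (b - t) / 2" "h \<le> e / (4 * M + 1)"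
    unfolding h_def by (rule Min_le; simp)+
  have h: "h < d1" "h < d2" "a < s - h" "t + h < b" using hle pos d1 d2 st by auto
  have "h * (4 * M + 1) \<le> e" using hle(5) M0 by (simp add: pos_le_divide_eq)
  then have hM: "M * (2 * h) \<le> e / 2" using pos by (simp add: algebra_simps)
  have bounds: "a < s - h" "s + h < b" "a < t - h" "t + h < b" using h st pos by auto
  define \<phi> where "\<phi> x = ramp ((x - s) / h) - ramp ((x - t) / h)" for x
  define ks where "ks x = tent ((x - s) / h) / h" for x
  define kt where "kt x = tent ((x - t) / h) / h" for x
  have tf: "test_function a b \<phi> (\<lambda>x. ks x - kt x)"
    unfolding \<phi>_def ks_def kt_def using bounds pos st by (intro test_function_ramps) auto
  have ck: "continuous_on {a..b} ks" "continuous_on {a..b} kt"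
    unfolding ks_def kt_def using pos by (intro continuous_intros; simp)+
  have "(LINT x|lebesgue_on {a<..<b}. (ks x - kt x) *\<^sub>R u x)
      = integral {a..b} (\<lambda>x. (ks x - kt x) *\<^sub>R u x)"
    by (intro LINT_continuous_eq_integral continuous_intros ck u)
  also have "\<dots> = integral {a..b} (\<lambda>x. ks x *\<^sub>R u x) - integral {a..b} (\<lambda>x. kt x *\<^sub>R u x)"
    by (subst integral_diff[symmetric])
      (auto intro!: integrable_continuous_real continuous_intros ck u simp: scaleR_diff_left)
  finally have lhs: "(LINT x|lebesgue_on {a<..<b}. (ks x - kt x) *\<^sub>R u x) = \<dots>" .
  have as: "norm (integral {a..b} (\<lambda>x. ks x *\<^sub>R u x) - u s) \<le> e / 4"
    unfolding ks_def
  proof (rule tent_average[OF u pos bounds(1,2)])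
    fix x assume "\<bar>x - s\<bar> \<le> h"
    then have "x \<in> {a..b}" "dist x s < d1" using h bounds by (auto simp: dist_real_def abs_le_iff)
    then show "norm (u x - u s) \<le> e / 4" using d1(2)[of x] by (simp add: dist_norm)
  qed
  have at: "norm (integral {a..b} (\<lambda>x. kt x *\<^sub>R u x) - u t) \<le> e / 4"
    unfolding kt_def
  proof (rule tent_average[OF u pos bounds(3,4)])
    fix x assume "\<bar>x - t\<bar> \<le> h"
    then have "x \<in> {a..b}" "dist x t < d2" using h bounds by (auto simp: dist_real_def abs_le_iff)
    then show "norm (u x - u t) \<le> e / 4" using d2(2)[of x] by (simp add: dist_norm)
  qed
  have \<phi>01: "0 \<le> \<phi> x" "\<phi> x \<le> 1" for x
    using ramp_mono[of "(x - t) / h" "(x - s) / h"] ramp_bounds[of "(x - t) / h"]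
      ramp_bounds[of "(x - s) / h"] pos st by (auto simp: \<phi>_def divide_right_mono)
  have \<phi>0: "\<phi> x = 0" if "x \<notin> {s - h..t + h}" for x
  proof -
    have "((x - s) / h \<le> - 1 \<and> (x - t) / h \<le> - 1) \<or> (1 \<le> (x - s) / h \<and> 1 \<le> (x - t) / h)"
      using that pos st by (auto simp: field_simps)
    then show ?thesis by (auto simp: \<phi>_def ramp_left ramp_right)
  qed
  have c\<phi>: "\<phi> \<in> borel_measurable (lebesgue_on {a<..<b})"
  proof -
    have "continuous_on UNIV \<phi>"
      using tf unfolding test_function_def by (meson DERIV_isCont continuous_at_imp_continuous_on)
    then have "\<phi> \<in> borel_measurable borel" by (rule borel_measurable_continuous_onI)
    then show ?thesis by (simp add: measurable_completion measurable_restrict_space1)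
  qed
  have "norm (LINT x|lebesgue_on {a<..<b}. \<phi> x *\<^sub>R g x) \<le> M * (t - s + 2 * h)"
  proof -
    have ae: "AE x in lebesgue_on {a<..<b}. norm (\<phi> x *\<^sub>R g x) \<le> M * indicator {s - h..t + h} x"
      using M
    proof eventually_elim
      fix x assume "norm (g x) \<le> M"
      show "norm (\<phi> x *\<^sub>R g x) \<le> M * indicator {s - h..t + h} x"
      proof (cases "x \<in> {s - h..t + h}")
        case True
        then show ?thesis using \<open>norm (g x) \<le> M\<close> \<phi>01[of x] mult_mono[of "\<bar>\<phi> x\<bar>" 1 "norm (g x)" M] by simp
      qed (use \<phi>0 in simp)
    qed
    have sub: "{s - h..t + h} \<subseteq> {a<..<b}" using bounds by auto
    have set: "{s - h..t + h} \<in> sets (lebesgue_on {a<..<b})"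
      using sub by (simp add: sets_restrict_space_iff)
    have "emeasure (lebesgue_on {a<..<b}) {s - h..t + h} = emeasure lebesgue {s - h..t + h}"
      using sub by (intro emeasure_restrict_space) auto
    then have fin: "emeasure (lebesgue_on {a<..<b}) {s - h..t + h} < \<infinity>" using pos st by simp
    have ind: "integrable (lebesgue_on {a<..<b}) (\<lambda>x. M * indicator {s - h..t + h} x)"
      by (intro integrable_mult_right integrable_real_indicator set fin)
    have "norm (LINT x|lebesgue_on {a<..<b}. \<phi> x *\<^sub>R g x)
        \<le> (LINT x|lebesgue_on {a<..<b}. norm (\<phi> x *\<^sub>R g x))"
      by (rule integral_norm_bound)
    also have "\<dots> \<le> (LINT x|lebesgue_on {a<..<b}. M * indicator {s - h..t + h} x)"
    proof (rule integral_mono_AE[OF _ ind ae])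
      have "g \<in> borel_measurable (lebesgue_on {a<..<b})" using g by (simp add: Linf_on_def)
      then have "(\<lambda>x. \<phi> x *\<^sub>R g x) \<in> borel_measurable (lebesgue_on {a<..<b})" using c\<phi> by measurable
      then show "integrable (lebesgue_on {a<..<b}) (\<lambda>x. norm (\<phi> x *\<^sub>R g x))"
        by (intro integrable_norm Bochner_Integration.integrable_bound[OF ind]) (use ae M0 in auto)
    qed
    also have "\<dots> = M * measure (lebesgue_on {a<..<b}) {s - h..t + h}"
    proof -
      have "{s - h..t + h} \<inter> {a<..<b} = {s - h..t + h}" using bounds by auto
      then show ?thesis by simp
    qed
    also have "measure (lebesgue_on {a<..<b}) {s - h..t + h} = t - s + 2 * h"
      using bounds st pos by (subst measure_restrict_space) auto
    finally show ?thesis .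
  qed
  moreover have "(LINT x|lebesgue_on {a<..<b}. (ks x - kt x) *\<^sub>R u x)
      = - (LINT x|lebesgue_on {a<..<b}. \<phi> x *\<^sub>R g x)"
    using wd tf unfolding weak_derivative_def by blast
  ultimately have "norm (integral {a..b} (\<lambda>x. ks x *\<^sub>R u x) - integral {a..b} (\<lambda>x. kt x *\<^sub>R u x))
      \<le> M * (t - s + 2 * h)"
    unfolding lhs[symmetric] by simp
  moreover have "norm (u s - u t) \<le> norm (A - u s) + norm (A - B) + norm (B - u t)" for A B
    using norm_triangle_ineq[of "(A - B) - (A - u s)" "B - u t"]
      norm_triangle_ineq4[of "A - B" "A - u s"] by simp
  ultimately have "norm (u s - u t) \<le> M * (t - s + 2 * h) + e / 4 + e / 4"
    using as at by (smt (verit))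
  also have "\<dots> \<le> M * (t - s) + e" using hM by (simp add: algebra_simps)
  finally show "norm (u t - u s) \<le> M * (t - s) + e" by (simp add: norm_minus_commute)
qed

lemma weak_derivative_lipschitz:
  assumes ab: "a < b" and wd: "weak_derivative a b u g" and u: "continuous_on {a..b} u"
    and g: "Linf_on {a<..<b} g" and M: "AE x in lebesgue_on {a<..<b}. norm (g x) \<le> M" "0 \<le> M"
  shows "M-lipschitz_on {a..b} u"
proof -
  have "norm (u t - u s) \<le> M * (t - s)" if "a < s" "s \<le> t" "t < b" for s t
    by (rule weak_derivative_bound[OF wd u g that M])
  then have "M-lipschitz_on {a<..<b} u"
    by (intro lipschitz_on_leI M) (auto simp: dist_norm norm_minus_commute)
  then have "M-lipschitz_on (closure {a<..<b}) u" using u ab by (intro lipschitz_on_closure) auto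
  then show ?thesis using ab by simp
qed

section \<open>Densities of Lipschitz functions\<close>

lemma emeasure_interval_measure_box:
  fixes F :: "real \<Rightarrow> real"
  assumes F: "mono F" "continuous_on UNIV F" and "a \<le> b"
  shows "emeasure (interval_measure F) {a<..<b} = ennreal (F b - F a)"
proof (cases "a = b")
  case False
  have m: "F x \<le> F y" if "x \<le> y" for x y using monoD[OF F(1) that] .
  have "emeasure (interval_measure F) {b..b} = ennreal (F b - F b)"
    using F(2) m by (intro emeasure_interval_measure_Icc) auto
  then have "emeasure (interval_measure F) {b} = 0" by simp
  moreover have "emeasure (interval_measure F) {a<..b} = ennreal (F b - F a)"
    using F(2) m \<open>a \<le> b\<close>
    by (intro emeasure_interval_measure_Ioc) (auto intro: continuous_on_subset simp: continuous_at_imp_continuous_at_within continuous_on_eq_continuous_at)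
  moreover have "{a<..b} = {a<..<b} \<union> {b}" using \<open>a \<le> b\<close> False by auto
  then have "emeasure (interval_measure F) {a<..b}
      = emeasure (interval_measure F) {a<..<b} + emeasure (interval_measure F) {b}"
    by (simp only:) (intro plus_emeasure[symmetric]; simp)
  ultimately show ?thesis by simp
qed simp

text \<open>Both \<open>F\<close> and \<open>\<lambda>x. x - F x\<close> are nondecreasing, and their Stieltjes measures add up to the
  Lebesgue measure. So the measure of \<open>F\<close> is bounded by the Lebesgue measure, and by the
  Radon-Nikodym theorem it has a density with values in \<open>{0..1}\<close>.\<close>

lemma monotone_lipschitz_has_density:
  fixes F :: "real \<Rightarrow> real"
  assumes F: "\<And>x y. x \<le> y \<Longrightarrow> F x \<le> F y \<and> F y - F x \<le> y - x"
  obtains f where "f \<in> borel_measurable borel" "\<And>x. 0 \<le> f x" "\<And>x. f x \<le> (1::real)"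
    "\<And>a b. a \<le> b \<Longrightarrow> (f has_integral F b - F a) {a..b}"
proof -
  define G where "G x = x - F x" for x
  have lipF: "1-lipschitz_on UNIV F"
  proof (rule lipschitz_on_leI)
    fix x y :: real assume "x \<le> y"
    from F[OF this] show "dist (F x) (F y) \<le> 1 * dist x y" by (simp add: dist_real_def)
  qed simp
  have cF: "continuous_on UNIV F" by (rule lipschitz_on_continuous_on[OF lipF])
  then have cG: "continuous_on UNIV G" unfolding G_def by (intro continuous_intros)
  have mF: "mono F" by (rule monoI) (use F in blast)
  have mG: "mono G"
  proof (rule monoI)
    fix x y :: real assume "x \<le> y"
    from F[OF this] show "G x \<le> G y" by (simp add: G_def)
  qed
  define MF MG where "MF = interval_measure F" and "MG = interval_measure G"
  have sets: "sets MF = sets borel" "sets MG = sets borel" by (simp_all add: MF_def MG_def)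
  define N where "N = measure_of UNIV (sets borel) (\<lambda>A. emeasure MF A + emeasure MG A)"
  have setsN: "sets N = sets borel"
    using sets.sigma_sets_eq[of "borel :: real measure"] by (simp add: N_def)
  have emN: "emeasure N A = emeasure MF A + emeasure MG A" if "A \<in> sets borel" for A
  proof (rule emeasure_measure_of[OF N_def])
    show "positive (sets N) (\<lambda>A. emeasure MF A + emeasure MG A)"
      by (simp add: positive_def)
    show "countably_additive (sets N) (\<lambda>A. emeasure MF A + emeasure MG A)"
      unfolding countably_additive_def setsN
    proof (intro allI impI)
      fix A :: "nat \<Rightarrow> real set"
      assume A: "range A \<subseteq> sets borel" "disjoint_family A"
      have "(\<Sum>i. emeasure MF (A i) + emeasure MG (A i))
          = (\<Sum>i. emeasure MF (A i)) + (\<Sum>i. emeasure MG (A i))"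
        by (rule suminf_add[symmetric]) auto
      then show "(\<Sum>i. emeasure MF (A i) + emeasure MG (A i))
          = emeasure MF (\<Union>i. A i) + emeasure MG (\<Union>i. A i)"
        using A sets by (simp add: suminf_emeasure)
    qed
  qed (use that setsN in auto)
  have N: "lborel = N"
  proof (rule lborel_eqI)
    fix l u :: real assume "\<And>b. b \<in> Basis \<Longrightarrow> l \<bullet> b \<le> u \<bullet> b"
    then have lu: "l \<le> u" by simp
    have "emeasure N {l<..<u} = ennreal (F u - F l) + ennreal (G u - G l)"
      using emeasure_interval_measure_box[OF mF cF lu] emeasure_interval_measure_box[OF mG cG lu]
      by (simp add: emN MF_def MG_def)
    also have "\<dots> = ennreal (u - l)"
      using F[OF lu] by (subst ennreal_plus[symmetric]) (auto simp: G_def)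
    finally show "emeasure N (box l u) = ennreal (prod ((\<bullet>) (u - l)) Basis)" by (simp add: box_real)
  qed (rule setsN)
  have le: "emeasure MF A \<le> emeasure lborel A" if "A \<in> sets borel" for A
    unfolding N emN[OF that] by simp
  have "absolutely_continuous lborel MF"
    unfolding absolutely_continuous_def null_sets_def using le sets by (auto simp: le_zero_eq) (metis le le_zero_eq)
  then obtain f where f: "f \<in> borel_measurable lborel" "density lborel f = MF"
    using sigma_finite_measure.Radon_Nikodym[OF sigma_finite_lborel, of MF] sets by auto
  have "AE x in lborel. f x \<le> 1"
  proof (rule AE_upper_bound_inf_ennreal)
    fix e :: real assume e: "0 < e"
    define B where "B = {x. 1 + ennreal e < f x}"
    have B: "B \<in> sets borel" using f(1) unfolding B_def by measurable
    have nul: "emeasure lborel (B \<inter> {-n..n}) = 0" for n :: real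
    proof (rule ccontr)
      let ?C = "B \<inter> {-n..n}"
      assume ne: "emeasure lborel ?C \<noteq> 0"
      have C: "?C \<in> sets borel" using B by simp
      have "emeasure lborel ?C \<le> emeasure lborel {-n..n}" by (rule emeasure_mono) auto
      also have "\<dots> < \<infinity>" by (simp add: emeasure_lborel_Icc_eq)
      finally have fin: "emeasure lborel ?C < \<infinity>" .
      have "(1 + ennreal e) * emeasure lborel ?C = (\<integral>\<^sup>+x. (1 + ennreal e) * indicator ?C x \<partial>lborel)"
        using C by (simp add: nn_integral_cmult_indicator)
      also have "\<dots> \<le> (\<integral>\<^sup>+x. f x * indicator ?C x \<partial>lborel)"
        by (intro nn_integral_mono) (auto simp: B_def indicator_def less_imp_le)
      also have "\<dots> = emeasure MF ?C" using f C by (simp add: emeasure_density flip: f(2))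
      also have "\<dots> \<le> emeasure lborel ?C" by (rule le[OF C])
      finally have "emeasure lborel ?C + ennreal e * emeasure lborel ?C \<le> emeasure lborel ?C + 0"
        by (simp add: distrib_right)
      then have "ennreal e * emeasure lborel ?C \<le> 0"
        using fin by (subst (asm) ennreal_add_left_cancel_le) auto
      then show False using ne e by simp
    qed
    have "B = (\<Union>n::nat. B \<inter> {- real n..real n})"
    proof -
      have "\<exists>n::nat. x \<in> {- real n..real n}" for x
      proof -
        obtain n :: nat where "\<bar>x\<bar> \<le> real n" using real_arch_simple by blast
        then have "x \<in> {- real n..real n}" by auto
        then show ?thesis ..
      qed
      then show ?thesis by auto
    qed
    moreover have "emeasure lborel (\<Union>n::nat. B \<inter> {- real n..real n}) = 0"
      using B nul by (intro emeasure_UN_eq_0) auto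
    ultimately have "emeasure lborel B = 0" by simp
    then show "AE x in lborel. f x \<le> 1 + ennreal e"
      using B by (intro AE_I[of _ _ B]) (auto simp: B_def not_le)
  qed
  define k where "k x = min 1 (enn2real (f x))" for x
  have k01: "0 \<le> k x" "k x \<le> 1" for x by (auto simp: k_def)
  have km: "k \<in> borel_measurable borel" using f(1) unfolding k_def by measurable
  have fk: "AE x in lborel. f x = ennreal (k x)"
    using \<open>AE x in lborel. f x \<le> 1\<close>
  proof eventually_elim
    fix x assume "f x \<le> 1"
    then have "f x = ennreal (enn2real (f x))" "enn2real (f x) \<le> 1"
      by (auto simp: ennreal_enn2real_if top_unique enn2real_leI)
    then show "f x = ennreal (k x)" by (simp add: k_def)
  qed
  have "(k has_integral F b - F a) {a..b}" if ab: "a \<le> b" for a b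
  proof -
    have "(\<integral>\<^sup>+x. ennreal (k x * indicator {a<..<b} x) \<partial>lborel) = (\<integral>\<^sup>+x. f x * indicator {a<..<b} x \<partial>lborel)"
      using fk by (intro nn_integral_cong_AE) (auto elim!: eventually_mono simp: indicator_def)
    also have "\<dots> = emeasure MF {a<..<b}" using f by (simp add: emeasure_density flip: f(2))
    also have "\<dots> = ennreal (F b - F a)" using emeasure_interval_measure_box[OF mF cF ab] by (simp add: MF_def)
    finally have "((\<lambda>x. k x * indicator {a<..<b} x) has_integral F b - F a) UNIV"
      using k01 km F[OF ab] by (intro nn_integral_has_integral) auto
    moreover have "(\<lambda>x. k x * indicator {a<..<b} x) = (\<lambda>x. if x \<in> {a<..<b} then k x else 0)"
      by (auto simp: indicator_def)
    ultimately have "(k has_integral F b - F a) {a<..<b}" by (simp only: has_integral_restrict_UNIV)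
    then show ?thesis by (simp add: has_integral_Icc_iff_Ioo)
  qed
  then show ?thesis using that km k01 by blast
qed

text \<open>Rescaling by \<open>L\<close> and adding the identity makes \<open>\<eta>\<close> monotone with slopes in \<open>{0..1}\<close>.\<close>

lemma lipschitz_has_density:
  fixes \<eta> :: "real \<Rightarrow> real"
  assumes \<eta>: "L-lipschitz_on {0..T} \<eta>" and T: "0 \<le> T"
  obtains \<kappa> where "\<kappa> \<in> borel_measurable borel" "\<And>x. \<bar>\<kappa> x\<bar> \<le> L"
    "\<And>a b. 0 \<le> a \<Longrightarrow> a \<le> b \<Longrightarrow> b \<le> T \<Longrightarrow> (\<kappa> has_integral \<eta> b - \<eta> a) {a..b}"
proof (cases "L = 0")
  case True
  have const: "\<eta> b = \<eta> a" if "0 \<le> a" "a \<le> b" "b \<le> T" for a b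
    using lipschitz_onD[OF \<eta>, of a b] that True by simp
  show ?thesis
  proof (rule that[of "\<lambda>_. 0"])
    fix a b assume "0 \<le> a" "a \<le> b" "b \<le> T"
    then have "\<eta> b - \<eta> a = 0" using const[of a b] by simp
    then show "((\<lambda>_. 0) has_integral \<eta> b - \<eta> a) {a..b}" by simp
  qed (use True in auto)
next
  case False
  then have L: "0 < L" using lipschitz_on_nonneg[OF \<eta>] by simp
  \<comment> \<open>Outside of \<open>{0..T}\<close> the function is continued by constants.\<close>
  define c where "c x = max 0 (min T x)" for x :: real
  define F where "F x = (\<eta> (c x) / L + x) / 2" for x
  have c: "c x \<in> {0..T}" "\<bar>c y - c x\<bar> \<le> \<bar>y - x\<bar>" for x y using T by (auto simp: c_def)
  have F: "F x \<le> F y \<and> F y - F x \<le> y - x" if "x \<le> y" for x y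
  proof -
    have "\<bar>\<eta> (c y) - \<eta> (c x)\<bar> \<le> L * \<bar>c y - c x\<bar>"
      using lipschitz_onD[OF \<eta> c(1)[of y] c(1)[of x]] by (simp add: dist_real_def)
    also have "\<dots> \<le> L * (y - x)" using L c(2)[of y x] that by simp
    finally have "\<bar>\<eta> (c y) / L - \<eta> (c x) / L\<bar> \<le> y - x"
      using L by (simp add: abs_divide pos_divide_le_eq mult.commute flip: diff_divide_distrib)
    moreover have "(q + x) / 2 \<le> (p + y) / 2 \<and> (p + y) / 2 - (q + x) / 2 \<le> y - x"
      if "\<bar>p - q\<bar> \<le> y - x" for p q using that by (auto simp: abs_le_iff field_simps)
    ultimately show ?thesis unfolding F_def by blast
  qed
  obtain f where f: "f \<in> borel_measurable borel" "\<And>x. 0 \<le> f x" "\<And>x. f x \<le> (1::real)"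
    "\<And>a b. a \<le> b \<Longrightarrow> (f has_integral F b - F a) {a..b}"
    using monotone_lipschitz_has_density[of F] F by blast
  show ?thesis
  proof (rule that[of "\<lambda>x. L * (2 * f x - 1)"])
    show "(\<lambda>x. L * (2 * f x - 1)) \<in> borel_measurable borel" using f(1) by measurable
    fix x
    have "\<bar>2 * f x - 1\<bar> \<le> 1" using f(2,3)[of x] by auto
    then show "\<bar>L * (2 * f x - 1)\<bar> \<le> L" using L by (simp add: abs_mult mult_left_le)
  next
    fix a b assume ab: "0 \<le> a" "a \<le> b" "b \<le> T"
    have "((\<lambda>x. L * (2 * f x - 1)) has_integral L * (2 * (F b - F a) - (b - a))) {a..b}"
      using f(4)[OF ab(2)] has_integral_const_real[of "1::real" a b] ab
      by (intro has_integral_mult_right has_integral_diff) auto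
    moreover have "L * (2 * (F b - F a) - (b - a)) = \<eta> b - \<eta> a"
      using ab L by (simp add: F_def c_def field_simps)
    ultimately show "((\<lambda>x. L * (2 * f x - 1)) has_integral \<eta> b - \<eta> a) {a..b}" by simp
  qed
qed

section \<open>Primitives and weak derivatives\<close>

lemma bounded_measurable_scaleR_integrable:
  fixes g :: "real \<Rightarrow> 'a::euclidean_space"
  assumes g: "g \<in> borel_measurable (lebesgue_on {a..b})" "\<And>x. x \<in> {a..b} \<Longrightarrow> norm (g x) \<le> M"
    and \<phi>: "continuous_on {a..b} \<phi>"
  shows "(\<lambda>t. \<phi> t *\<^sub>R g t) absolutely_integrable_on {a..b}"
proof (rule absolutely_integrable_bounded_measurable_product[where h="\<lambda>x r. r *\<^sub>R x"])
  show "bilinear (\<lambda>(x::'a) r. r *\<^sub>R x)"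
    unfolding bilinear_conv_bounded_bilinear by (rule bounded_bilinear.flip[OF bounded_bilinear_scaleR])
  show "bounded (g ` {a..b})" using g(2) unfolding bounded_iff by blast
  show "\<phi> absolutely_integrable_on {a..b}" by (rule absolutely_integrable_continuous_real[OF \<phi>])
qed (use g in auto)

lemma has_integral_norm_le:
  fixes f :: "real \<Rightarrow> 'a::euclidean_space"
  assumes "(f has_integral I) {a..b}" "a \<le> b" "0 \<le> B" "\<And>x. x \<in> {a..b} \<Longrightarrow> norm (f x) \<le> B"
  shows "norm I \<le> B * (b - a)"
  using has_integral_bound[of B f I a b] assms by (simp add: cbox_interval)

text \<open>The chain rule for an angle that is differentiable only almost everywhere. The difference
  of both sides, as a function of \<open>b\<close>, has increments of second order.\<close>

lemma cis_increment_of_density: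
  fixes \<eta> \<kappa> :: "real \<Rightarrow> real"
  assumes \<eta>: "L-lipschitz_on {0..T} \<eta>" and \<kappa>: "\<kappa> \<in> borel_measurable borel" "\<And>x. \<bar>\<kappa> x\<bar> \<le> L"
    and inc: "\<And>a b. 0 \<le> a \<Longrightarrow> a \<le> b \<Longrightarrow> b \<le> T \<Longrightarrow> (\<kappa> has_integral \<eta> b - \<eta> a) {a..b}"
    and ab: "0 \<le> a" "a \<le> b" "b \<le> T"
  shows "((\<lambda>t. \<kappa> t *\<^sub>R (\<i> * cis (\<eta> t))) has_integral cis (\<eta> b) - cis (\<eta> a)) {a..b}"
proof -
  have L: "0 \<le> L" by (rule lipschitz_on_nonneg[OF \<eta>])
  define c where "c t = \<kappa> t *\<^sub>R (\<i> * cis (\<eta> t))" for t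
  have c\<eta>: "continuous_on {s..t} (\<lambda>t. \<i> * cis (\<eta> t))" if "0 \<le> s" "t \<le> T" for s t
    using that by (intro continuous_intros continuous_on_cis_comp
        continuous_on_subset[OF lipschitz_on_continuous_on[OF \<eta>]]) auto
  have ci: "c integrable_on {s..t}" if "0 \<le> s" "t \<le> T" for s t
  proof -
    have "\<kappa> \<in> borel_measurable (lebesgue_on {s..t})"
      using \<kappa>(1) by (simp add: measurable_completion measurable_restrict_space1)
    moreover have "(\<lambda>t. \<i> * cis (\<eta> t)) \<in> borel_measurable (lebesgue_on {s..t})"
      by (rule continuous_imp_measurable_on_sets_lebesgue[OF c\<eta>[OF that]]) simp
    ultimately have "c \<in> borel_measurable (lebesgue_on {s..t})" unfolding c_def by measurable
    moreover have "norm (c x) \<le> L" for x using \<kappa>(2)[of x] by (simp add: c_def norm_mult)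
    ultimately have "(\<lambda>t. 1 *\<^sub>R c t) absolutely_integrable_on {s..t}"
      by (intro bounded_measurable_scaleR_integrable) auto
    then show ?thesis by (simp add: absolutely_integrable_on_def)
  qed
  define f where "f x = cis (\<eta> x) - integral {a..x} c" for x
  have "f b = f a"
  proof (rule quadratic_increments_imp_constant[of a b f "2 * L\<^sup>2"])
    fix s t assume st: "a \<le> s" "s \<le> t" "t \<le> b"
    have st': "0 \<le> s" "t \<le> T" using st ab by auto
    define D where "D = \<eta> t - \<eta> s"
    have lip: "\<bar>\<eta> x - \<eta> s\<bar> \<le> L * (x - s)" if "x \<in> {s..t}" for x
      using lipschitz_onD[OF \<eta>, of x s] that st ab by (auto simp: dist_real_def)
    have "integral {a..s} c + integral {s..t} c = integral {a..t} c"
      using st ab by (intro Henstock_Kurzweil_Integration.integral_combine ci) auto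
    then have inc_f: "f t - f s = cis (\<eta> t) - cis (\<eta> s) - integral {s..t} c"
      by (simp add: f_def algebra_simps)
    have hi: "((\<lambda>x. \<kappa> x *\<^sub>R (\<i> * cis (\<eta> s))) has_integral D *\<^sub>R (\<i> * cis (\<eta> s))) {s..t}"
      unfolding D_def using st ab by (intro has_integral_scaleR_left inc) auto
    have "((\<lambda>x. \<kappa> x *\<^sub>R (\<i> * cis (\<eta> s)) - c x) has_integral
        D *\<^sub>R (\<i> * cis (\<eta> s)) - integral {s..t} c) {s..t}"
      by (intro has_integral_diff hi integrable_integral ci st')
    then have b1: "norm (D *\<^sub>R (\<i> * cis (\<eta> s)) - integral {s..t} c) \<le> (L * (L * (t - s))) * (t - s)"
    proof (rule has_integral_norm_le)
      fix x assume x: "x \<in> {s..t}"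
      have "norm (cis (\<eta> s) - cis (\<eta> x)) \<le> L * (t - s)"
      proof -
        have "norm (cis (\<eta> s) - cis (\<eta> x)) \<le> \<bar>\<eta> s - \<eta> x\<bar>" by (rule norm_cis_diff_le)
        also have "\<dots> \<le> L * (x - s)" using lip[of x] x by (simp add: abs_minus_commute)
        also have "\<dots> \<le> L * (t - s)" using x L by (intro mult_left_mono) auto
        finally show ?thesis .
      qed
      moreover have "\<kappa> x *\<^sub>R (\<i> * cis (\<eta> s)) - c x = \<kappa> x *\<^sub>R (\<i> * (cis (\<eta> s) - cis (\<eta> x)))"
        by (simp add: c_def algebra_simps)
      ultimately show "norm (\<kappa> x *\<^sub>R (\<i> * cis (\<eta> s)) - c x) \<le> L * (L * (t - s))"
        using \<kappa>(2)[of x] L by (auto simp: norm_mult intro!: mult_mono)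
    qed (use L st in auto)
    have e: "cis (\<eta> t) = cis (\<eta> s) * cis D" by (simp add: D_def cis_mult)
    have "cis (\<eta> t) - cis (\<eta> s) - D *\<^sub>R (\<i> * cis (\<eta> s)) = cis (\<eta> s) * (cis D - 1 - \<i> * of_real D)"
      unfolding e by (simp add: algebra_simps scaleR_conv_of_real)
    then have "norm (cis (\<eta> t) - cis (\<eta> s) - D *\<^sub>R (\<i> * cis (\<eta> s))) \<le> D\<^sup>2"
      using norm_cis_linearisation[of D] by (simp add: norm_mult)
    also have "D\<^sup>2 \<le> (L * (t - s))\<^sup>2"
      using lip[of t] st L by (intro power2_le_iff_abs_le[THEN iffD2]) (auto simp: D_def)
    finally have b2: "norm (cis (\<eta> t) - cis (\<eta> s) - D *\<^sub>R (\<i> * cis (\<eta> s))) \<le> L\<^sup>2 * (t - s)\<^sup>2"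
      by (simp add: power_mult_distrib)
    have b1': "norm (D *\<^sub>R (\<i> * cis (\<eta> s)) - integral {s..t} c) \<le> L\<^sup>2 * (t - s)\<^sup>2"
      using b1 st by (simp add: power2_eq_square algebra_simps)
    have "f t - f s = (cis (\<eta> t) - cis (\<eta> s) - D *\<^sub>R (\<i> * cis (\<eta> s))) + (D *\<^sub>R (\<i> * cis (\<eta> s)) - integral {s..t} c)"
      by (simp add: inc_f)
    then have "norm (f t - f s) \<le> L\<^sup>2 * (t - s)\<^sup>2 + L\<^sup>2 * (t - s)\<^sup>2"
      using norm_triangle_mono[OF b2 b1'] by simp
    then show "norm (f t - f s) \<le> 2 * L\<^sup>2 * (t - s)\<^sup>2" by simp
  qed (rule ab)
  then have "integral {a..b} c = cis (\<eta> b) - cis (\<eta> a)" by (simp add: f_def algebra_simps)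
  then show ?thesis using integrable_integral[OF ci[OF ab(1,3)]] unfolding c_def by simp
qed

text \<open>Integration by parts for functions that are differentiable only almost everywhere: \<open>\<phi> x
  *\<^sub>R u x\<close> and the integral of the formal derivative of this product differ by a function with
  increments of second order.\<close>

lemma weak_derivative_of_primitive:
  fixes u g :: "real \<Rightarrow> real ^ 2"
  assumes T: "0 < T" and g: "g \<in> borel_measurable (lebesgue_on {0..T})" "\<And>x. x \<in> {0..T} \<Longrightarrow> norm (g x) \<le> M"
    and inc: "\<And>a b. 0 \<le> a \<Longrightarrow> a \<le> b \<Longrightarrow> b \<le> T \<Longrightarrow> (g has_integral u b - u a) {a..b}"
  shows "weak_derivative 0 T u g" "continuous_on {0..T} u"
proof -
  have M: "0 \<le> M" using g(2)[of 0] T norm_ge_zero order.trans by (metis atLeastAtMost_iff less_imp_le order.refl)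
  have ulip: "norm (u t - u s) \<le> M * (t - s)" if st: "0 \<le> s" "s \<le> t" "t \<le> T" for s t
    by (rule has_integral_norm_le[OF inc[OF st] st(2) M]) (use g(2) st in auto)
  have "M-lipschitz_on {0..T} u"
    by (rule lipschitz_on_leI[OF _ M]) (use ulip in \<open>auto simp: dist_norm norm_minus_commute\<close>)
  then show cu: "continuous_on {0..T} u" by (rule lipschitz_on_continuous_on)
  show "weak_derivative 0 T u g"
    unfolding weak_derivative_def
  proof (intro allI impI)
    fix \<phi> \<phi>' assume tf: "test_function 0 T \<phi> \<phi>'"
    have d: "(\<phi> has_real_derivative \<phi>' t) (at t)" for t using tf by (simp add: test_function_def)
    have c\<phi>': "continuous_on S \<phi>'" for S
      using tf continuous_on_subset by (auto simp: test_function_def)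
    have c\<phi>: "continuous_on S \<phi>" for S by (meson DERIV_isCont continuous_at_imp_continuous_on d)
    have ends: "\<phi> 0 = 0" "\<phi> T = 0" using tf unfolding test_function_def by force+
    have \<phi>inc: "(\<phi>' has_integral \<phi> t - \<phi> s) {s..t}" if "s \<le> t" for s t
      using that d by (intro fundamental_theorem_of_calculus)
        (auto simp: has_vector_derivative_at_within has_real_derivative_iff_has_vector_derivative)
    have "bounded (\<phi>' ` {0..T})" by (intro compact_imp_bounded compact_continuous_image c\<phi>') simp
    then obtain N where "\<forall>x\<in>{0..T}. \<bar>\<phi>' x\<bar> \<le> N" unfolding bounded_iff by auto
    then have N: "\<bar>\<phi>' x\<bar> \<le> N" if "x \<in> {0..T}" for x using that by blast
    have N0: "0 \<le> N" using N[of 0] T by auto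
    have \<phi>lip: "\<bar>\<phi> t - \<phi> s\<bar> \<le> N * (t - s)" if st: "0 \<le> s" "s \<le> t" "t \<le> T" for s t
    proof -
      have "norm (\<phi> t - \<phi> s) \<le> N * (t - s)"
        by (rule has_integral_norm_le[OF \<phi>inc[OF st(2)] st(2) N0]) (use N st in auto)
      then show ?thesis by simp
    qed
    define p where "p x = \<phi>' x *\<^sub>R u x + \<phi> x *\<^sub>R g x" for x
    have a1: "(\<lambda>x. \<phi>' x *\<^sub>R u x) absolutely_integrable_on {0..T}"
      by (intro absolutely_integrable_continuous_real continuous_intros c\<phi>' cu)
    have a2: "(\<lambda>x. \<phi> x *\<^sub>R g x) absolutely_integrable_on {0..T}"
      by (rule bounded_measurable_scaleR_integrable[OF g c\<phi>])
    have pi: "p integrable_on {s..t}" if "0 \<le> s" "t \<le> T" for s t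
    proof -
      have "p integrable_on {0..T}"
        unfolding p_def using a1 a2 by (intro integrable_add) (auto simp: absolutely_integrable_on_def)
      then show ?thesis by (rule integrable_on_subinterval) (use that in auto)
    qed
    define f where "f x = \<phi> x *\<^sub>R u x - integral {0..x} p" for x
    have "f T = f 0"
    proof (rule quadratic_increments_imp_constant[of 0 T f "2 * N * M"])
      fix s t assume st: "0 \<le> s" "s \<le> t" "t \<le> T"
      have "integral {0..s} p + integral {s..t} p = integral {0..t} p"
        using st by (intro Henstock_Kurzweil_Integration.integral_combine pi) auto
      then have inc_f: "f t - f s = \<phi> t *\<^sub>R (u t - u s) + (\<phi> t - \<phi> s) *\<^sub>R u s - integral {s..t} p"
        by (simp add: f_def algebra_simps)
      have "((\<lambda>x. \<phi> t *\<^sub>R g x + \<phi>' x *\<^sub>R u s - p x) has_integral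
          \<phi> t *\<^sub>R (u t - u s) + (\<phi> t - \<phi> s) *\<^sub>R u s - integral {s..t} p) {s..t}"
        by (intro has_integral_diff has_integral_add has_integral_cmul has_integral_scaleR_left
            integrable_integral inc pi \<phi>inc st)
      then have "norm (f t - f s) \<le> (2 * N * M * (t - s)) * (t - s)"
        unfolding inc_f
      proof (rule has_integral_norm_le)
        fix x assume "x \<in> {s..t}"
        then have x: "s \<le> x" "x \<le> t" "0 \<le> x" "x \<le> T" using st by auto
        have "\<phi> t *\<^sub>R g x + \<phi>' x *\<^sub>R u s - p x = (\<phi> t - \<phi> x) *\<^sub>R g x + \<phi>' x *\<^sub>R (u s - u x)"
          by (simp add: p_def algebra_simps)
        also have "norm \<dots> \<le> norm ((\<phi> t - \<phi> x) *\<^sub>R g x) + norm (\<phi>' x *\<^sub>R (u s - u x))"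
          by (rule norm_triangle_ineq)
        also have "norm ((\<phi> t - \<phi> x) *\<^sub>R g x) \<le> (N * (t - s)) * M"
        proof -
          have "\<bar>\<phi> t - \<phi> x\<bar> \<le> N * (t - x)" using \<phi>lip x st by auto
          also have "\<dots> \<le> N * (t - s)" using N0 x by (intro mult_left_mono) auto
          finally show ?thesis using g(2)[of x] x N0 st by (auto intro!: mult_mono)
        qed
        also have "norm (\<phi>' x *\<^sub>R (u s - u x)) \<le> N * (M * (t - s))"
        proof -
          have "norm (u s - u x) \<le> M * (x - s)" using ulip[of s x] x st by (simp add: norm_minus_commute)
          also have "\<dots> \<le> M * (t - s)" using M x by (intro mult_left_mono) auto
          finally show ?thesis using N[of x] x N0 by (auto intro!: mult_mono)
        qed
        finally show "norm (\<phi> t *\<^sub>R g x + \<phi>' x *\<^sub>R u s - p x) \<le> 2 * N * M * (t - s)"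
          by (simp add: algebra_simps)
      qed (use N0 M st in auto)
      then show "norm (f t - f s) \<le> 2 * N * M * (t - s)\<^sup>2"
        using st by (simp add: power2_eq_square algebra_simps)
    qed (use T in simp)
    then have "integral {0..T} p = 0" using ends by (simp add: f_def)
    then have "integral {0..T} (\<lambda>x. \<phi>' x *\<^sub>R u x) + integral {0..T} (\<lambda>x. \<phi> x *\<^sub>R g x) = 0"
      unfolding p_def using a1 a2
      by (subst (asm) integral_add) (auto simp: absolutely_integrable_on_def)
    then show "(LINT t|lebesgue_on {0<..<T}. \<phi>' t *\<^sub>R u t) = - (LINT t|lebesgue_on {0<..<T}. \<phi> t *\<^sub>R g t)"
      unfolding LINT_Ioo_eq_integral(2)[OF a1] LINT_Ioo_eq_integral(2)[OF a2]
      by (simp add: eq_neg_iff_add_eq_0)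
  qed
qed

section \<open>Curves and their angle functions\<close>

definition plane_of :: "complex \<Rightarrow> real ^ 2" where
  "plane_of w = vector [Re w, Im w]"

lemma plane_of_nth [simp]: "plane_of w $ 1 = Re w" "plane_of w $ 2 = Im w"
  by (simp_all add: plane_of_def)

lemma norm_plane_of [simp]: "norm (plane_of w) = norm w"
  by (simp add: norm_vec_def L2_set_def sum_2 cmod_def)

lemma bounded_linear_plane_of: "bounded_linear plane_of"
proof (rule bounded_linear_intro[where K=1])
  show "plane_of (x + y) = plane_of x + plane_of y" for x y
    by (simp add: vec_eq_iff forall_2)
  show "plane_of (r *\<^sub>R x) = r *\<^sub>R plane_of x" for r x
    by (simp add: vec_eq_iff forall_2)
qed simp

lemmas continuous_on_plane_of [continuous_intros] =
  bounded_linear.continuous_on[OF bounded_linear_plane_of]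

lemma plane_of_inject: "plane_of w = plane_of w' \<longleftrightarrow> w = w'"
  by (simp add: vec_eq_iff forall_2 complex_eq_iff)

lemma has_integral_primitive:
  fixes f :: "real \<Rightarrow> 'a::euclidean_space"
  assumes f: "continuous_on {0..T} f" and ab: "0 \<le> a" "a \<le> b" "b \<le> T"
  shows "(f has_integral integral {0..b} f - integral {0..a} f) {a..b}"
proof -
  have i: "f integrable_on {x..y}" if "0 \<le> x" "y \<le> T" for x y
    using that by (intro integrable_continuous_real continuous_on_subset[OF f]) auto
  have "integral {0..a} f + integral {a..b} f = integral {0..b} f"
    using ab by (intro Henstock_Kurzweil_Integration.integral_combine i) auto
  then have "integral {a..b} f = integral {0..b} f - integral {0..a} f" by (simp add: algebra_simps)
  then show ?thesis using integrable_integral[OF i[OF ab(1,3)]] by simp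
qed

definition curve_of_angle :: "real ^ 2 \<Rightarrow> (real \<Rightarrow> real) \<Rightarrow> real \<Rightarrow> real ^ 2" where
  "curve_of_angle p \<theta> t = p + plane_of (integral {0..t} (\<lambda>s. cis (\<theta> s)))"

lemma curve_of_angle_increment:
  assumes "continuous_on {0..T} \<theta>" "0 \<le> a" "a \<le> b" "b \<le> T"
  shows "((\<lambda>t. plane_of (cis (\<theta> t))) has_integral curve_of_angle p \<theta> b - curve_of_angle p \<theta> a) {a..b}"
  using has_integral_linear[OF has_integral_primitive[OF continuous_on_cis_comp] bounded_linear_plane_of, OF assms]
  by (simp add: o_def curve_of_angle_def linear_simps[OF bounded_linear_plane_of])

lemma curve_of_angle_derivative:
  assumes "continuous_on {0..L} \<Theta>" and t: "0 < t" "t < L"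
  shows "(curve_of_angle p \<Theta> has_vector_derivative plane_of (cis (\<Theta> t))) (at t)"
proof -
  have "((\<lambda>u. integral {0..u} (\<lambda>t. cis (\<Theta> t))) has_vector_derivative cis (\<Theta> t)) (at t within {0..L})"
    using t by (intro integral_has_vector_derivative continuous_on_cis_comp assms) auto
  then have "((\<lambda>u. integral {0..u} (\<lambda>t. cis (\<Theta> t))) has_vector_derivative cis (\<Theta> t)) (at t)"
    using t by (simp add: at_within_Icc_at)
  from bounded_linear.has_vector_derivative[OF bounded_linear_plane_of this]
  show ?thesis unfolding curve_of_angle_def[abs_def] by (auto intro!: derivative_eq_intros)
qed

lemma continuous_Linf_on:
  assumes "continuous_on {a..b} u"
  shows "Linf_on {a<..<b} u"
  unfolding Linf_on_def
proof
  have "u \<in> borel_measurable (lebesgue_on {a..b})"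
    by (rule continuous_imp_measurable_on_sets_lebesgue[OF assms]) simp
  then show "u \<in> borel_measurable (lebesgue_on {a<..<b})"
    by (rule measurable_restrict_mono) auto
  have "bounded (u ` {a..b})" by (intro compact_imp_bounded compact_continuous_image assms) simp
  then obtain M where "\<forall>t\<in>{a..b}. norm (u t) \<le> M" unfolding bounded_iff by auto
  then show "\<exists>M. AE t in lebesgue_on {a<..<b}. norm (u t) \<le> M"
    by (intro exI[of _ M] AE_I2) auto
qed

text \<open>Every Lipschitz angle yields a competitor in the variational problem, with the density of
  the angle as its signed curvature.\<close>

lemma angle_gives_admissible_curve:
  assumes T: "0 < T" and \<eta>: "L-lipschitz_on {0..T} \<eta>"
  obtains d where "admissible p (plane_of (cis (\<eta> 0))) (curve_of_angle p \<eta> T) (plane_of (cis (\<eta> T))) T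
      (curve_of_angle p \<eta>) (\<lambda>t. plane_of (cis (\<eta> t))) d" "max_curvature T d \<le> ereal L"
proof -
  obtain \<kappa> where \<kappa>: "\<kappa> \<in> borel_measurable borel" "\<And>x. \<bar>\<kappa> x\<bar> \<le> L"
    and inc: "\<And>a b. 0 \<le> a \<Longrightarrow> a \<le> b \<Longrightarrow> b \<le> T \<Longrightarrow> (\<kappa> has_integral \<eta> b - \<eta> a) {a..b}"
    using lipschitz_has_density[OF \<eta>] T by (metis less_imp_le)
  define v where "v t = plane_of (cis (\<eta> t))" for t
  define d where "d t = plane_of (\<kappa> t *\<^sub>R (\<i> * cis (\<eta> t)))" for t
  have ccis: "continuous_on {0..T} (\<lambda>t. cis (\<eta> t))"
    by (intro continuous_on_cis_comp lipschitz_on_continuous_on[OF \<eta>])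
  have cv: "continuous_on {0..T} v" unfolding v_def by (intro continuous_intros ccis)
  have mv: "v \<in> borel_measurable (lebesgue_on {0..T})"
    by (rule continuous_imp_measurable_on_sets_lebesgue[OF cv]) simp
  have "(\<lambda>t. plane_of (\<i> * cis (\<eta> t))) \<in> borel_measurable (lebesgue_on {0..T})"
    by (rule continuous_imp_measurable_on_sets_lebesgue) (intro continuous_intros ccis, simp)
  moreover have "\<kappa> \<in> borel_measurable (lebesgue_on {0..T})"
    using \<kappa>(1) by (simp add: measurable_completion measurable_restrict_space1)
  ultimately have "(\<lambda>t. \<kappa> t *\<^sub>R plane_of (\<i> * cis (\<eta> t))) \<in> borel_measurable (lebesgue_on {0..T})"
    by measurable
  moreover have "d = (\<lambda>t. \<kappa> t *\<^sub>R plane_of (\<i> * cis (\<eta> t)))"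
    by (simp add: d_def fun_eq_iff linear_simps[OF bounded_linear_plane_of])
  ultimately have md: "d \<in> borel_measurable (lebesgue_on {0..T})" by simp
  have bd: "norm (d t) \<le> L" for t using \<kappa>(2)[of t] by (simp add: d_def norm_mult)
  have bv: "norm (v t) \<le> 1" for t by (simp add: v_def)
  have inc_v: "(d has_integral v b - v a) {a..b}" if ab: "0 \<le> a" "a \<le> b" "b \<le> T" for a b
    using has_integral_linear[OF cis_increment_of_density[OF \<eta> \<kappa> inc ab] bounded_linear_plane_of]
    by (simp add: d_def[abs_def] v_def o_def linear_simps[OF bounded_linear_plane_of])
  have inc_z: "(v has_integral curve_of_angle p \<eta> b - curve_of_angle p \<eta> a) {a..b}"
    if "0 \<le> a" "a \<le> b" "b \<le> T" for a b
    unfolding v_def[abs_def] by (rule curve_of_angle_increment[OF lipschitz_on_continuous_on[OF \<eta>] that])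
  have wv: "weak_derivative 0 T (curve_of_angle p \<eta>) v" and cz: "continuous_on {0..T} (curve_of_angle p \<eta>)"
    using weak_derivative_of_primitive[OF T mv bv inc_z] by blast+
  have wd: "weak_derivative 0 T v d"
    using weak_derivative_of_primitive[OF T md bd inc_v] by blast
  have "d \<in> borel_measurable (lebesgue_on {0<..<T})" by (rule measurable_restrict_mono[OF md]) auto
  then have Ld: "Linf_on {0<..<T} d" unfolding Linf_on_def using bd by (auto intro!: exI[of _ L])
  have "W2inf 0 T (curve_of_angle p \<eta>) v d"
    unfolding W2inf_def W1inf_def
    using wv wd Ld continuous_Linf_on[OF cz] continuous_Linf_on[OF cv] cz cv by blast
  moreover have "AE t in lebesgue_on {0..T}. norm (v t) = 1" by (simp add: v_def)
  ultimately have "admissible p (plane_of (cis (\<eta> 0))) (curve_of_angle p \<eta> T) (plane_of (cis (\<eta> T))) T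
      (curve_of_angle p \<eta>) v d"
    unfolding admissible_def
    by (simp add: v_def curve_of_angle_def linear_simps[OF bounded_linear_plane_of])
  moreover have "max_curvature T d \<le> ereal L"
    unfolding max_curvature_def
  proof (rule esssup_I)
    show "(\<lambda>t. ereal (norm (d t))) \<in> borel_measurable (lebesgue_on {0..T})" using md by measurable
  qed (use bd in simp)
  ultimately show ?thesis using that unfolding v_def by blast
qed

text \<open>The set of exceptions in the interior is open and of measure zero.\<close>

lemma AE_continuous_norm_one:
  fixes v :: "real \<Rightarrow> 'a::real_normed_vector"
  assumes T: "0 < T" and v: "continuous_on {0..T} v" and ae: "AE t in lebesgue_on {0..T}. norm (v t) = 1"
    and t: "t \<in> {0..T}"
  shows "norm (v t) = 1"
proof -
  define U where "U = {t \<in> {0<..<T}. norm (v t) \<noteq> 1}"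
  have "open ({0<..<T} \<inter> (\<lambda>t. norm (v t)) -` (- {1}))"
    by (rule continuous_open_preimage)
      (auto intro!: continuous_intros continuous_on_subset[OF v])
  then have "open U" by (simp add: U_def vimage_def Int_def)
  have "AE t in lebesgue. t \<in> {0..T} \<longrightarrow> norm (v t) = 1"
    using ae by (simp add: AE_restrict_space_iff)
  then have "AE t in lebesgue. t \<notin> U" by eventually_elim (auto simp: U_def)
  then have "negligible U"
    using \<open>open U\<close> by (simp add: negligible_iff_null_sets AE_iff_null)
  then have "U = {}" using \<open>open U\<close> open_not_negligible by blast
  then have "norm (v t) = 1" if "t \<in> {0<..<T}" for t using that by (auto simp: U_def)
  moreover have "continuous_on (closure {0<..<T}) (\<lambda>t. norm (v t))"
    using T v by (auto intro!: continuous_intros)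
  ultimately show ?thesis
    using continuous_constant_on_closure[of "{0<..<T}" "\<lambda>t. norm (v t)" 1 t] T t by simp
qed

text \<open>A continuous angle exists because an interval is contractible. Its increments are those of
  the arc length on the unit circle, which are controlled by the chords only up to a factor that
  tends to \<open>1\<close> for short chords. So the angle is locally Lipschitz with every constant above
  \<open>K\<close>, which suffices on an interval.\<close>

lemma lipschitz_angle_lift:
  fixes w :: "real \<Rightarrow> complex"
  assumes T: "0 < T" and w: "K-lipschitz_on {0..T} w" and unit: "\<And>t. t \<in> {0..T} \<Longrightarrow> cmod (w t) = 1"
  obtains \<theta> where "K-lipschitz_on {0..T} \<theta>" "\<And>t. t \<in> {0..T} \<Longrightarrow> w t = cis (\<theta> t)"
proof -
  have "contractible {0..T}" by (simp add: convex_imp_contractible)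
  moreover have "w t \<noteq> 0" if "t \<in> {0..T}" for t using unit[OF that] by auto
  ultimately obtain g where g: "continuous_on {0..T} g" "\<And>t. t \<in> {0..T} \<Longrightarrow> w t = exp (g t)"
    using continuous_logarithm_on_contractible[OF lipschitz_on_continuous_on[OF w]] by blast
  define \<theta> where "\<theta> t = Im (g t)" for t
  have c\<theta>: "continuous_on {0..T} \<theta>" unfolding \<theta>_def by (intro continuous_intros g)
  have w\<theta>: "w t = cis (\<theta> t)" if "t \<in> {0..T}" for t
  proof -
    have "exp (Re (g t)) = 1" using unit[OF that] unfolding g(2)[OF that] norm_exp_eq_Re .
    then show ?thesis using g(2)[OF that] exp_eq_polar[of "g t"] by (simp add: \<theta>_def)
  qed
  have K: "0 \<le> K" by (rule lipschitz_on_nonneg[OF w])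
  have lip: "(K + e)-lipschitz_on {0..T} \<theta>" if e: "0 < e" for e
  proof (rule locally_lipschitz_imp_lipschitz[OF c\<theta>])
    fix x y assume x: "x \<in> {0..<T}" and "x < y"
    \<comment> \<open>On angles less than \<open>r\<close> the sine loses at most the factor \<open>q\<close> against the identity.\<close>
    define q where "q = K / (K + e)"
    have q: "q < 1" "0 \<le> q" using K e by (auto simp: q_def)
    have "(sin has_real_derivative 1) (at 0)" using DERIV_sin[of 0] by simp
    then have "((\<lambda>r. sin r / r) \<longlongrightarrow> 1) (at (0::real))" by (simp add: has_field_derivative_iff)
    then have "eventually (\<lambda>r. q < sin r / r) (at (0::real))" using q(1) by (rule order_tendstoD)
    then obtain r where r: "0 < r" "\<And>u. u \<noteq> 0 \<Longrightarrow> \<bar>u\<bar> < r \<Longrightarrow> q < sin u / u"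
      unfolding eventually_at by (auto simp: dist_real_def)
    have qs: "q * \<bar>u\<bar> \<le> \<bar>sin u\<bar>" if "\<bar>u\<bar> < r" for u
    proof (cases "u = 0")
      case False
      have "q < sin u / u" by (rule r(2)[OF False that])
      also have "\<dots> \<le> \<bar>sin u\<bar> / \<bar>u\<bar>" by (metis abs_divide abs_ge_self)
      finally show ?thesis using False by (simp add: pos_less_divide_eq)
    qed simp
    have "x \<in> {0..T}" using x by auto
    then obtain \<delta> where \<delta>: "0 < \<delta>" "\<And>z. z \<in> {0..T} \<Longrightarrow> dist z x < \<delta> \<Longrightarrow> dist (\<theta> z) (\<theta> x) < 2 * r"
      using c\<theta> r(1) unfolding continuous_on_iff by (metis zero_less_mult_iff zero_less_numeral)
    define z where "z = x + min (\<delta> / 2) (min (y - x) (T - x))"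
    have z: "x < z" "z \<le> y" "z \<le> T" "z - x < \<delta>" using \<delta>(1) \<open>x < y\<close> x by (auto simp: z_def)
    have "\<bar>(\<theta> z - \<theta> x) / 2\<bar> < r" using \<delta>(2)[of z] z x by (auto simp: dist_real_def)
    then have "q * \<bar>(\<theta> z - \<theta> x) / 2\<bar> \<le> \<bar>sin ((\<theta> z - \<theta> x) / 2)\<bar>" by (rule qs)
    then have "q * \<bar>\<theta> z - \<theta> x\<bar> \<le> cmod (cis (\<theta> z) - cis (\<theta> x))"
      by (simp add: norm_cis_diff)
    also have "\<dots> \<le> K * (z - x)"
      using lipschitz_onD[OF w, of z x] w\<theta>[of z] w\<theta>[of x] z x by (auto simp: dist_norm)
    finally have le: "q * \<bar>\<theta> z - \<theta> x\<bar> \<le> K * (z - x)" .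
    have "\<bar>\<theta> z - \<theta> x\<bar> \<le> (K + e) * (z - x)"
    proof (cases "K = 0")
      case False
      then have "0 < K" using K by simp
      have "K * \<bar>\<theta> z - \<theta> x\<bar> = (K + e) * (q * \<bar>\<theta> z - \<theta> x\<bar>)" using K e by (simp add: q_def)
      also have "\<dots> \<le> (K + e) * (K * (z - x))" using K e le by (intro mult_left_mono) auto
      finally have "K * \<bar>\<theta> z - \<theta> x\<bar> \<le> K * ((K + e) * (z - x))" by (simp add: algebra_simps)
      then show ?thesis using \<open>0 < K\<close> by simp
    next
      case True
      have "cmod (cis (\<theta> z) - cis (\<theta> x)) \<le> 0"
        using lipschitz_onD[OF w, of z x] w\<theta>[of z] w\<theta>[of x] z x True by (auto simp: dist_norm)
      then have "sin ((\<theta> z - \<theta> x) / 2) = 0" by (simp add: norm_cis_diff)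
      moreover have "(\<theta> z - \<theta> x) / 2 = 0"
      proof (rule ccontr)
        assume n: "(\<theta> z - \<theta> x) / 2 \<noteq> 0"
        have "q < sin ((\<theta> z - \<theta> x) / 2) / ((\<theta> z - \<theta> x) / 2)"
          by (rule r(2)[OF n]) fact
        then show False using calculation q by simp
      qed
      ultimately show ?thesis using True e z by simp
    qed
    then show "\<exists>z\<in>{x<..y}. dist (\<theta> z) (\<theta> x) \<le> (K + e) * (z - x)"
      using z by (intro bexI[of _ z]) (auto simp: dist_real_def)
  qed (use K e in simp)
  have "K-lipschitz_on {0..T} \<theta>"
  proof (rule lipschitz_onI[OF _ K])
    fix s t assume st: "s \<in> {0..T}" "t \<in> {0..T}"
    show "dist (\<theta> s) (\<theta> t) \<le> K * dist s t"
    proof (rule field_le_epsilon)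
      fix e :: real assume e: "0 < e"
      have "0 < dist s t + 1" by (simp add: add_nonneg_pos)
      then have "0 < e / (dist s t + 1)" using e by simp
      from lipschitz_onD[OF lip[OF this] st]
      have "dist (\<theta> s) (\<theta> t) \<le> K * dist s t + e / (dist s t + 1) * dist s t" by (simp add: distrib_right)
      also have "e / (dist s t + 1) * dist s t \<le> e"
        using e \<open>0 < dist s t + 1\<close> by (simp add: pos_divide_le_eq)
      finally show "dist (\<theta> s) (\<theta> t) \<le> K * dist s t + e" by simp
    qed
  qed
  then show ?thesis using that w\<theta> by blast
qed

section \<open>Solutions of the curvature problem\<close>

text \<open>The curve and the primitive of \<open>v\<close> have the same weak derivative. Their difference has
  weak derivative \<open>0\<close> and is therefore Lipschitz with constant \<open>0\<close>.\<close>

lemma weakly_differentiable_curve_is_primitive: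
  assumes T: "0 < T" and wd: "weak_derivative 0 T z v"
    and z: "continuous_on {0..T} z" and v: "continuous_on {0..T} v" and t: "t \<in> {0..T}"
  shows "z t = z 0 + integral {0..t} v"
proof -
  define y where "y t = integral {0..t} v" for t
  have "bounded (v ` {0..T})" by (intro compact_imp_bounded compact_continuous_image v) simp
  then obtain M where M: "\<forall>t\<in>{0..T}. norm (v t) \<le> M" unfolding bounded_iff by auto
  have inc: "(v has_integral y b - y a) {a..b}" if "0 \<le> a" "a \<le> b" "b \<le> T" for a b
    unfolding y_def by (rule has_integral_primitive[OF v that])
  have mv: "v \<in> borel_measurable (lebesgue_on {0..T})"
    by (rule continuous_imp_measurable_on_sets_lebesgue[OF v]) simp
  have wy: "weak_derivative 0 T y v" and y: "continuous_on {0..T} y"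
    using weak_derivative_of_primitive[OF T mv _ inc] M by blast+
  define u where "u t = z t - y t" for t
  have u: "continuous_on {0..T} u" unfolding u_def by (intro continuous_intros z y)
  have wu: "weak_derivative 0 T u (\<lambda>_. 0)"
    unfolding weak_derivative_def
  proof (intro allI impI)
    fix \<phi> \<phi>' assume tf: "test_function 0 T \<phi> \<phi>'"
    have c: "continuous_on {0..T} \<phi>'"
      using tf continuous_on_subset by (auto simp: test_function_def)
    have iz: "integrable (lebesgue_on {0<..<T}) (\<lambda>t. \<phi>' t *\<^sub>R z t)"
      by (intro LINT_Ioo_eq_integral(1) absolutely_integrable_continuous_real continuous_intros c z)
    have iy: "integrable (lebesgue_on {0<..<T}) (\<lambda>t. \<phi>' t *\<^sub>R y t)"
      by (intro LINT_Ioo_eq_integral(1) absolutely_integrable_continuous_real continuous_intros c y)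
    have "(LINT t|lebesgue_on {0<..<T}. \<phi>' t *\<^sub>R u t)
        = (LINT t|lebesgue_on {0<..<T}. \<phi>' t *\<^sub>R z t) - (LINT t|lebesgue_on {0<..<T}. \<phi>' t *\<^sub>R y t)"
      unfolding u_def scaleR_diff_right by (rule Bochner_Integration.integral_diff[OF iz iy])
    also have "\<dots> = 0" using wd wy tf by (simp add: weak_derivative_def)
    finally show "(LINT t|lebesgue_on {0<..<T}. \<phi>' t *\<^sub>R u t) = - (LINT t|lebesgue_on {0<..<T}. \<phi> t *\<^sub>R 0)"
      by simp
  qed
  have "0-lipschitz_on {0..T} u"
    by (rule weak_derivative_lipschitz[OF T wu u]) (auto intro: continuous_Linf_on)
  then have "u t = u 0" using lipschitz_onD[of 0 "{0..T}" u t 0] t T by auto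
  then show ?thesis by (simp add: u_def y_def algebra_simps)
qed

lemma admissible_curve_has_angle:
  assumes T: "0 < T" and adm: "admissible z0 v0 zf vf T z v c"
    and M: "AE t in lebesgue_on {0<..<T}. norm (c t) \<le> M" and M0: "0 \<le> M"
  obtains \<theta> where "M-lipschitz_on {0..T} \<theta>" "\<And>t. t \<in> {0..T} \<Longrightarrow> v t = plane_of (cis (\<theta> t))"
    "\<And>t. t \<in> {0..T} \<Longrightarrow> z t = curve_of_angle z0 \<theta> t"
proof -
  have W: "weak_derivative 0 T z v" "weak_derivative 0 T v c" "Linf_on {0<..<T} c"
    and z: "continuous_on {0..T} z" and v: "continuous_on {0..T} v" and z0: "z 0 = z0"
    and unit: "AE t in lebesgue_on {0..T}. norm (v t) = 1"
    using adm unfolding admissible_def W2inf_def W1inf_def by auto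
  have lip: "M-lipschitz_on {0..T} v" by (rule weak_derivative_lipschitz[OF T W(2) v W(3) M M0])
  define w where "w t = Complex (v t $ 1) (v t $ 2)" for t
  have vw: "v t = plane_of (w t)" for t by (simp add: w_def vec_eq_iff forall_2)
  have "M-lipschitz_on {0..T} w"
  proof (rule lipschitz_onI[OF _ M0])
    fix s t assume st: "s \<in> {0..T}" "t \<in> {0..T}"
    have "dist (w s) (w t) = norm (plane_of (w s - w t))" by (simp add: dist_norm)
    also have "\<dots> = dist (v s) (v t)" by (simp add: dist_norm vw linear_simps[OF bounded_linear_plane_of])
    finally show "dist (w s) (w t) \<le> M * dist s t" using lipschitz_onD[OF lip st] by simp
  qed
  moreover have "cmod (w t) = 1" if "t \<in> {0..T}" for t
    using AE_continuous_norm_one[OF T v unit that] by (simp add: vw)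
  ultimately obtain \<theta> where \<theta>: "M-lipschitz_on {0..T} \<theta>" "\<And>t. t \<in> {0..T} \<Longrightarrow> w t = cis (\<theta> t)"
    using lipschitz_angle_lift[OF T] by blast
  have "z t = curve_of_angle z0 \<theta> t" if t: "t \<in> {0..T}" for t
  proof -
    have i: "(\<lambda>s. cis (\<theta> s)) integrable_on {0..t}"
      using t by (intro integrable_continuous_real continuous_on_cis_comp
          continuous_on_subset[OF lipschitz_on_continuous_on[OF \<theta>(1)]]) auto
    have "integral {0..t} v = integral {0..t} (\<lambda>s. plane_of (cis (\<theta> s)))"
      using t \<theta>(2) by (intro integral_cong) (auto simp: vw)
    also have "\<dots> = plane_of (integral {0..t} (\<lambda>s. cis (\<theta> s)))"
      using integral_linear[OF i bounded_linear_plane_of] by (simp add: o_def)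
    finally show ?thesis
      using weakly_differentiable_curve_is_primitive[OF T W(1) z v t] z0 by (simp add: curve_of_angle_def)
  qed
  then show ?thesis using that \<theta> vw by metis
qed

text \<open>The number \<open>K\<close> is the least value of the maximal curvature. It is positive since a curve
  of curvature zero is a segment, whose end points would have distance \<open>tf\<close>.\<close>

theorem solution_has_minimax_angle:
  fixes z0 zf v0 vf :: "real ^ 2"
  assumes T: "tf > 0" and far: "tf > norm (z0 - zf)" and sol: "solves_P z0 v0 zf vf tf z"
  obtains K \<theta> where "minimax_angle K tf \<theta>" "\<And>t. t \<in> {0..tf} \<Longrightarrow> z t = curve_of_angle z0 \<theta> t"
proof -
  obtain v c where adm: "admissible z0 v0 zf vf tf z v c"
    and opt: "\<And>y w d. admissible z0 v0 zf vf tf y w d \<Longrightarrow> max_curvature tf c \<le> max_curvature tf d"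
    using sol unfolding solves_P_def by blast
  have ends: "z 0 = z0" "z tf = zf" "v 0 = v0" "v tf = vf" using adm by (auto simp: admissible_def)
  have compete: "max_curvature tf c \<le> ereal L"
    if \<eta>: "L-lipschitz_on {0..tf} \<eta>" and e: "plane_of (cis (\<eta> 0)) = v0" "plane_of (cis (\<eta> tf)) = vf"
      "curve_of_angle z0 \<eta> tf = zf" for L \<eta>
    using angle_gives_admissible_curve[OF T \<eta>, of z0] opt unfolding e by (metis order.trans)
  define E where "E = max_curvature tf c"
  have "\<exists>M. AE t in lebesgue_on {0<..<tf}. norm (c t) \<le> M"
    using adm unfolding admissible_def W2inf_def W1inf_def Linf_on_def by auto
  then obtain M0 where M0: "AE t in lebesgue_on {0<..<tf}. norm (c t) \<le> M0" ..
  define M where "M = max 0 M0"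
  have M: "AE t in lebesgue_on {0<..<tf}. norm (c t) \<le> M"
    using M0 by eventually_elim (simp add: M_def)
  obtain \<theta>\<^sub>0 where t0: "M-lipschitz_on {0..tf} \<theta>\<^sub>0" "\<And>t. t \<in> {0..tf} \<Longrightarrow> v t = plane_of (cis (\<theta>\<^sub>0 t))"
    "\<And>t. t \<in> {0..tf} \<Longrightarrow> z t = curve_of_angle z0 \<theta>\<^sub>0 t"
    using admissible_curve_has_angle[OF T adm M] by (auto simp: M_def)
  have "E \<le> ereal M" unfolding E_def
    using t0(2)[of 0] t0(2)[of tf] t0(3)[of tf] T ends by (intro compete[OF t0(1)]) auto
  \<comment> \<open>The maximal curvature is finite and nonnegative, so \<open>K\<close> is its value as a real number; the
    maximum spares a separate proof of the sign.\<close>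
  define K where "K = max 0 (real_of_ereal E)"
  have EK: "E \<le> ereal K" using \<open>E \<le> ereal M\<close> by (cases E) (auto simp: K_def)
  have "AE t in lebesgue_on {0..tf}. ereal (norm (c t)) \<le> E"
    unfolding E_def max_curvature_def by (rule esssup_AE)
  then have "AE t in lebesgue_on {0..tf}. norm (c t) \<le> K"
    by eventually_elim (use EK in \<open>metis ereal_less_eq(3) order.trans\<close>)
  then have "AE t in lebesgue. t \<in> {0..tf} \<longrightarrow> norm (c t) \<le> K"
    by (simp add: AE_restrict_space_iff)
  then have "AE t in lebesgue. t \<in> {0<..<tf} \<longrightarrow> norm (c t) \<le> K" by eventually_elim auto
  then have AEK: "AE t in lebesgue_on {0<..<tf}. norm (c t) \<le> K"
    by (simp add: AE_restrict_space_iff)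
  have K0: "0 \<le> K" by (simp add: K_def)
  obtain \<theta> where \<theta>: "K-lipschitz_on {0..tf} \<theta>" "\<And>t. t \<in> {0..tf} \<Longrightarrow> v t = plane_of (cis (\<theta> t))"
    "\<And>t. t \<in> {0..tf} \<Longrightarrow> z t = curve_of_angle z0 \<theta> t"
    using admissible_curve_has_angle[OF T adm AEK K0] by blast
  have th_ends: "plane_of (cis (\<theta> 0)) = v0" "plane_of (cis (\<theta> tf)) = vf" "curve_of_angle z0 \<theta> tf = zf"
    using \<theta>(2)[of 0] \<theta>(2)[of tf] \<theta>(3)[of tf] T ends by auto
  have "K \<noteq> 0"
  proof
    assume "K = 0"
    then have "\<theta> t = \<theta> 0" if "t \<in> {0..tf}" for t
      using lipschitz_onD[OF \<theta>(1), of t 0] that T by auto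
    then have "integral {0..tf} (\<lambda>s. cis (\<theta> s)) = integral {0..tf} (\<lambda>s. cis (\<theta> 0))"
      by (intro integral_cong) (metis (no_types))
    also have "\<dots> = tf *\<^sub>R cis (\<theta> 0)" using T by simp
    finally have "zf - z0 = plane_of (tf *\<^sub>R cis (\<theta> 0))"
      using th_ends(3) by (simp add: curve_of_angle_def algebra_simps)
    then have "norm (zf - z0) = tf" using T by simp
    then show False using far by (simp add: norm_minus_commute)
  qed
  then have K: "0 < K" using K0 by simp
  then have E: "E = ereal K"
    using EK by (cases E) (auto simp: K_def max_def split: if_splits)
  have "minimax_angle K tf \<theta>"
    unfolding minimax_angle_def
  proof (intro conjI allI impI notI T K \<theta>(1))
    fix K' \<eta> assume K': "K' < K" and \<eta>: "K'-lipschitz_on {0..tf} \<eta>" and se: "same_ends tf \<eta> \<theta>"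
    have "E \<le> ereal K'"
      unfolding E_def using se th_ends
      by (intro compete[OF \<eta>]) (auto simp: same_ends_def curve_of_angle_def)
    then show False using K' E by simp
  qed
  then show ?thesis using that \<theta>(3) by blast
qed

lemma curve_of_angle_slope:
  assumes c\<Theta>: "continuous_on {0..L} \<Theta>" and ab: "0 \<le> a" "a \<le> b" "b \<le> L" and s: "has_slope \<Theta> m a b"
    and t: "t \<in> {a..b}"
  shows "curve_of_angle p \<Theta> t = curve_of_angle p \<Theta> a
    + plane_of (integral {a..t} (\<lambda>r. cis (\<Theta> a + m * (r - a))))"
proof -
  have "integral {0..t} (\<lambda>s. cis (\<Theta> s)) - integral {0..a} (\<lambda>s. cis (\<Theta> s)) = integral {a..t} (\<lambda>s. cis (\<Theta> s))"
    using integral_unique[OF has_integral_primitive[OF continuous_on_cis_comp[OF c\<Theta>] ab(1), of t]] t ab by simp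
  also have "\<dots> = integral {a..t} (\<lambda>r. cis (\<Theta> a + m * (r - a)))"
  proof (rule integral_cong)
    fix r assume "r \<in> {a..t}"
    then have "\<Theta> r = \<Theta> a + m * (r - a)" using t by (intro has_slopeD[OF s]) auto
    then show "cis (\<Theta> r) = cis (\<Theta> a + m * (r - a))" by (rule arg_cong)
  qed
  finally have e: "integral {0..t} (\<lambda>s. cis (\<Theta> s)) = integral {0..a} (\<lambda>s. cis (\<Theta> s))
      + integral {a..t} (\<lambda>r. cis (\<Theta> a + m * (r - a)))" by (simp only: diff_eq_eq add.commute)
  show ?thesis unfolding curve_of_angle_def e by (simp add: linear_simps[OF bounded_linear_plane_of])
qed

lemma slope_zero_line_piece:
  assumes c\<Theta>: "continuous_on {0..L} \<Theta>" and ab: "0 \<le> a" "a \<le> b" "b \<le> L" and s: "has_slope \<Theta> 0 a b"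
  shows "line_piece (curve_of_angle p \<Theta>) a b"
  unfolding line_piece_def
proof (intro exI conjI ballI)
  fix t assume t: "t \<in> {a..b}"
  then have "plane_of (integral {a..t} (\<lambda>r. cis (\<Theta> a + 0 * (r - a)))) = (t - a) *\<^sub>R plane_of (cis (\<Theta> a))"
    by (simp add: linear_simps[OF bounded_linear_plane_of])
  then show "curve_of_angle p \<Theta> t = curve_of_angle p \<Theta> a + (t - a) *\<^sub>R plane_of (cis (\<Theta> a))"
    using curve_of_angle_slope[OF c\<Theta> ab s t, of p] by simp
qed simp

text \<open>In the sense of rotation, the position on the circle is a quarter turn behind the
  velocity.\<close>

lemma slope_circle_piece:
  assumes K: "0 < K" and \<sigma>: "\<sigma> \<in> {1, -1}"
    and c\<Theta>: "continuous_on {0..L} \<Theta>" and ab: "0 \<le> a" "a \<le> b" "b \<le> L" and s: "has_slope \<Theta> (\<sigma> * K) a b"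
  shows "circle_piece (curve_of_angle p \<Theta>) \<sigma> (1 / K) a b"
  unfolding circle_piece_def
proof (intro conjI exI ballI)
  fix t assume t: "t \<in> {a..b}"
  \<comment> \<open>The angular position on the circle at the time \<open>a\<close>.\<close>
  define q where "q = \<Theta> a - \<sigma> * (pi / 2)"
  have rot: "(- \<i> / of_real (\<sigma> * K)) * cis (\<Theta> a + x) = (1 / K) *\<^sub>R cis (q + x)" for x
  proof -
    have "cis (q + x) = cis (\<Theta> a + x) * cis (- (\<sigma> * (pi / 2)))" by (simp add: q_def cis_mult algebra_simps)
    also have "cis (- (\<sigma> * (pi / 2))) = - \<i> * of_real \<sigma>" using \<sigma> by (auto simp: complex_eq_iff)
    finally show ?thesis using \<sigma> K by (auto simp: scaleR_conv_of_real field_simps)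
  qed
  have m: "\<sigma> * K \<noteq> 0" using \<sigma> K by auto
  have arg: "\<sigma> * (t - a) / (1 / K) = \<sigma> * K * (t - a)" by simp
  have "curve_of_angle p \<Theta> t = curve_of_angle p \<Theta> a
      + plane_of ((- \<i> / of_real (\<sigma> * K)) * (cis (\<Theta> a + \<sigma> * K * (t - a)) - cis (\<Theta> a)))"
    using curve_of_angle_slope[OF c\<Theta> ab s t, of p] integral_cis_linear[OF m, of a t] t by simp
  also have "(- \<i> / of_real (\<sigma> * K)) * (cis (\<Theta> a + \<sigma> * K * (t - a)) - cis (\<Theta> a))
      = (1 / K) *\<^sub>R cis (q + \<sigma> * K * (t - a)) - (1 / K) *\<^sub>R cis q"
    unfolding right_diff_distrib rot[symmetric] using rot[of 0] by simp
  finally have "curve_of_angle p \<Theta> t = (curve_of_angle p \<Theta> a - (1 / K) *\<^sub>R plane_of (cis q))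
      + (1 / K) *\<^sub>R plane_of (cis (q + \<sigma> * K * (t - a)))"
    by (simp add: linear_simps[OF bounded_linear_plane_of])
  then show "curve_of_angle p \<Theta> t = (curve_of_angle p \<Theta> a - (1 / K) *\<^sub>R plane_of (cis q))
      + (1 / K) *\<^sub>R vector [cos (q + \<sigma> * (t - a) / (1 / K)), sin (q + \<sigma> * (t - a) / (1 / K))]"
    unfolding arg by (simp add: plane_of_def)
qed (use \<sigma> K in auto)

lemma curve_of_angle_C1:
  assumes "continuous_on {0..L} \<Theta>"
  shows "curve_of_angle p \<Theta> C1_differentiable_on {0<..<L}"
  unfolding C1_differentiable_on_def
proof (intro exI conjI ballI)
  have c: "continuous_on {0..L} (\<lambda>t. cis (\<Theta> t))" by (rule continuous_on_cis_comp[OF assms])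
  then show "continuous_on {0<..<L} (\<lambda>t. plane_of (cis (\<Theta> t)))"
    by (intro continuous_intros continuous_on_subset[OF c]) auto
  fix t assume "t \<in> {0<..<L}"
  then show "(curve_of_angle p \<Theta> has_vector_derivative plane_of (cis (\<Theta> t))) (at t)"
    by (intro curve_of_angle_derivative[OF assms]) auto
qed

section \<open>Types of paths and radii of arcs\<close>

lemma continuous_on_broken_line:
  assumes "s\<^sub>1 \<le> s\<^sub>2"
  shows "continuous_on S (broken_line c m\<^sub>1 m\<^sub>2 m\<^sub>3 s\<^sub>1 s\<^sub>2)"
proof -
  have "broken_line c m\<^sub>1 m\<^sub>2 m\<^sub>3 s\<^sub>1 s\<^sub>2
      = (\<lambda>t. c + m\<^sub>1 * min 0 (t - s\<^sub>1) + m\<^sub>2 * (min (max t s\<^sub>1) s\<^sub>2 - s\<^sub>1) + m\<^sub>3 * max 0 (t - s\<^sub>2))"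
    using assms by (auto simp: broken_line_def fun_eq_iff min_def max_def)
  then show ?thesis by (simp only:) (intro continuous_intros)
qed

lemma piece_of_slope:
  assumes K: "0 < K" and c\<Theta>: "continuous_on {0..L} \<Theta>" and ab: "0 \<le> a" "a < b" "b \<le> L"
    and s: "has_slope \<Theta> m a b"
    and X: "X = LetterS \<and> m = 0 \<or> X = LetterC \<and> m \<in> {K, - K} \<and> K * (b - a) < 2 * pi \<or>
      X = LetterO \<and> m \<in> {K, - K} \<and> K * (b - a) = 2 * pi"
  shows "piece X (curve_of_angle p \<Theta>) (m / K) (1 / K) a b"
proof -
  have line: "line_piece (curve_of_angle p \<Theta>) a b" if "m = 0"
    using slope_zero_line_piece[OF c\<Theta> ab(1) less_imp_le[OF ab(2)] ab(3)] s that by simp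
  have circle: "circle_piece (curve_of_angle p \<Theta>) (m / K) (1 / K) a b" if "m \<in> {K, - K}"
  proof (rule slope_circle_piece[OF K _ c\<Theta> ab(1) less_imp_le[OF ab(2)] ab(3)])
    show "m / K \<in> {1, - 1}" using that K by auto
    show "has_slope \<Theta> (m / K * K) a b" using s K by simp
  qed
  show ?thesis using X line circle ab(2) by (auto simp: mult.commute)
qed

text \<open>Replacing \<open>t\<close> by \<open>t + A\<close> moves the full path to a parameter interval that starts at \<open>0\<close>.\<close>

lemma broken_line_path_of_type:
  assumes K: "0 < K" and ord: "A < s\<^sub>1" "s\<^sub>1 < s\<^sub>2" "s\<^sub>2 < B"
    and X: "\<And>X m a b. (X, m, a, b) \<in> {(X\<^sub>1, m\<^sub>1, A, s\<^sub>1), (X\<^sub>2, m\<^sub>2, s\<^sub>1, s\<^sub>2), (X\<^sub>3, m\<^sub>3, s\<^sub>2, B)} \<Longrightarrow>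
      X = LetterS \<and> m = 0 \<or> X = LetterC \<and> m \<in> {K, - K} \<and> K * (b - a) < 2 * pi \<or>
      X = LetterO \<and> m \<in> {K, - K} \<and> K * (b - a) = 2 * pi"
    and CC: "X\<^sub>1 = LetterC \<Longrightarrow> X\<^sub>2 = LetterC \<Longrightarrow> m\<^sub>2 = - m\<^sub>1" "X\<^sub>2 = LetterC \<Longrightarrow> X\<^sub>3 = LetterC \<Longrightarrow> m\<^sub>3 = - m\<^sub>2"
  shows "path_of_type [X\<^sub>1, X\<^sub>2, X\<^sub>3] (B - A)
    (curve_of_angle p (\<lambda>t. broken_line c m\<^sub>1 m\<^sub>2 m\<^sub>3 s\<^sub>1 s\<^sub>2 (t + A)))"
proof -
  define \<Theta> where "\<Theta> t = broken_line c m\<^sub>1 m\<^sub>2 m\<^sub>3 s\<^sub>1 s\<^sub>2 (t + A)" for t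
  have c\<Theta>: "continuous_on {0..B - A} \<Theta>"
    unfolding \<Theta>_def
    by (rule continuous_on_compose2[OF continuous_on_broken_line[of s\<^sub>1 s\<^sub>2 UNIV]])
      (use ord in \<open>auto intro!: continuous_intros\<close>)
  define s :: "nat \<Rightarrow> real" where "s i = [0, s\<^sub>1 - A, s\<^sub>2 - A, B - A] ! i" for i
  define \<sigma> :: "nat \<Rightarrow> real" where "\<sigma> i = [m\<^sub>1 / K, m\<^sub>2 / K, m\<^sub>3 / K] ! i" for i
  have sl1: "has_slope \<Theta> m\<^sub>1 0 (s\<^sub>1 - A)"
    by (rule has_slopeI[where c="c + m\<^sub>1 * (A - s\<^sub>1)"]) (auto simp: \<Theta>_def broken_line_def algebra_simps)
  have sl2: "has_slope \<Theta> m\<^sub>2 (s\<^sub>1 - A) (s\<^sub>2 - A)"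
    by (rule has_slopeI[where c=c]) (auto simp: \<Theta>_def broken_line_def algebra_simps)
  have sl3: "has_slope \<Theta> m\<^sub>3 (s\<^sub>2 - A) (B - A)"
    by (rule has_slopeI[where c="c + m\<^sub>2 * (s\<^sub>2 - s\<^sub>1)"])
      (use ord in \<open>auto simp: \<Theta>_def broken_line_def algebra_simps\<close>)
  have "piece X\<^sub>1 (curve_of_angle p \<Theta>) (m\<^sub>1 / K) (1 / K) 0 (s\<^sub>1 - A)"
    by (rule piece_of_slope[OF K c\<Theta> _ _ _ sl1]) (use ord X[of X\<^sub>1 m\<^sub>1 A s\<^sub>1] in auto)
  moreover have "piece X\<^sub>2 (curve_of_angle p \<Theta>) (m\<^sub>2 / K) (1 / K) (s\<^sub>1 - A) (s\<^sub>2 - A)"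
    by (rule piece_of_slope[OF K c\<Theta> _ _ _ sl2]) (use ord X[of X\<^sub>2 m\<^sub>2 s\<^sub>1 s\<^sub>2] in auto)
  moreover have "piece X\<^sub>3 (curve_of_angle p \<Theta>) (m\<^sub>3 / K) (1 / K) (s\<^sub>2 - A) (B - A)"
    by (rule piece_of_slope[OF K c\<Theta> _ _ _ sl3]) (use ord X[of X\<^sub>3 m\<^sub>3 s\<^sub>2 B] in auto)
  ultimately have pieces: "\<forall>i < length [X\<^sub>1, X\<^sub>2, X\<^sub>3].
      piece ([X\<^sub>1, X\<^sub>2, X\<^sub>3] ! i) (curve_of_angle p \<Theta>) (\<sigma> i) (1 / K) (s i) (s (Suc i))"
    by (auto simp: less_Suc_eq numeral_3_eq_3 s_def \<sigma>_def)
  have turns: "\<forall>i. Suc i < length [X\<^sub>1, X\<^sub>2, X\<^sub>3] \<and> [X\<^sub>1, X\<^sub>2, X\<^sub>3] ! i = LetterC \<and>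
      [X\<^sub>1, X\<^sub>2, X\<^sub>3] ! Suc i = LetterC \<longrightarrow> \<sigma> (Suc i) = - \<sigma> i"
    using CC by (auto simp: less_Suc_eq numeral_3_eq_3 \<sigma>_def)
  have "s 0 = 0" "s (length [X\<^sub>1, X\<^sub>2, X\<^sub>3]) = B - A" by (auto simp: s_def)
  then have "path_of_type [X\<^sub>1, X\<^sub>2, X\<^sub>3] (B - A) (curve_of_angle p \<Theta>)"
    unfolding path_of_type_def using pieces turns curve_of_angle_C1[OF c\<Theta>, of p]
    by (intro conjI exI[of _ s] exI[of _ \<sigma>] exI[of _ "\<lambda>_. 1 / K"]) assumption+
  then show ?thesis unfolding \<Theta>_def .
qed

lemma curve_of_angle_shift:
  assumes c\<Theta>: "continuous_on {0..L} \<Theta>" and \<alpha>: "0 \<le> \<alpha>" "\<alpha> + T \<le> L"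
    and eq: "\<And>t. t \<in> {0..T} \<Longrightarrow> \<theta> t = \<Theta> (\<alpha> + t)" and t: "t \<in> {0..T}"
  shows "curve_of_angle p \<theta> t
    = curve_of_angle (p - plane_of (integral {0..\<alpha>} (\<lambda>s. cis (\<Theta> s)))) \<Theta> (\<alpha> + t)"
proof -
  have "integral {\<alpha>..\<alpha> + t} (\<lambda>s. cis (\<Theta> s))
      = integral {0..\<alpha> + t} (\<lambda>s. cis (\<Theta> s)) - integral {0..\<alpha>} (\<lambda>s. cis (\<Theta> s))"
    using t \<alpha> by (intro integral_unique has_integral_primitive[OF continuous_on_cis_comp[OF c\<Theta>]]) auto
  moreover have "integral {\<alpha>..\<alpha> + t} (\<lambda>s. cis (\<Theta> s)) = integral {0..t} (\<lambda>s. cis (\<theta> s))"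
  proof -
    have "integral {\<alpha> - \<alpha>..\<alpha> + t - \<alpha>} (\<lambda>s. cis (\<Theta> (s + \<alpha>))) = integral {\<alpha>..\<alpha> + t} (\<lambda>s. cis (\<Theta> s))"
      by (rule integral_shift_real_ivl)
    moreover have "integral {0..t} (\<lambda>s. cis (\<theta> s)) = integral {0..t} (\<lambda>s. cis (\<Theta> (s + \<alpha>)))"
      using eq t by (intro integral_cong) (auto simp: add.commute)
    ultimately show ?thesis by simp
  qed
  ultimately have e: "integral {0..\<alpha> + t} (\<lambda>s. cis (\<Theta> s))
      = integral {0..\<alpha>} (\<lambda>s. cis (\<Theta> s)) + integral {0..t} (\<lambda>s. cis (\<theta> s))" by simp
  show ?thesis unfolding curve_of_angle_def e by (simp add: linear_simps[OF bounded_linear_plane_of])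
qed

lemma broken_line_subpath:
  assumes ord: "s\<^sub>1 \<le> s\<^sub>2" and AB: "A \<le> 0" "T \<le> B"
    and \<theta>: "\<forall>t\<in>{0..T}. \<theta> t = broken_line c m\<^sub>1 m\<^sub>2 m\<^sub>3 s\<^sub>1 s\<^sub>2 t"
    and z: "\<And>t. t \<in> {0..T} \<Longrightarrow> z t = curve_of_angle p \<theta> t"
    and path: "\<And>p. path_of_type w (B - A) (curve_of_angle p (\<lambda>t. broken_line c m\<^sub>1 m\<^sub>2 m\<^sub>3 s\<^sub>1 s\<^sub>2 (t + A)))"
  shows "type_or_subpath w T z"
proof -
  define \<Theta> where "\<Theta> t = broken_line c m\<^sub>1 m\<^sub>2 m\<^sub>3 s\<^sub>1 s\<^sub>2 (t + A)" for t
  have c\<Theta>: "continuous_on {0..B - A} \<Theta>"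
    unfolding \<Theta>_def
    by (rule continuous_on_compose2[OF continuous_on_broken_line[OF ord, of UNIV]])
      (auto intro!: continuous_intros)
  define Z where "Z = curve_of_angle (p - plane_of (integral {0..- A} (\<lambda>s. cis (\<Theta> s)))) \<Theta>"
  have "z t = Z (- A + t)" if t: "t \<in> {0..T}" for t
  proof -
    have "\<theta> t = \<Theta> (- A + t)" if "t \<in> {0..T}" for t using \<theta> that by (simp add: \<Theta>_def)
    from curve_of_angle_shift[OF c\<Theta> _ _ this t] show ?thesis
      using AB z[OF t] by (simp add: Z_def)
  qed
  then have "subpath T z (B - A) Z" unfolding subpath_def using AB by (intro exI[of _ "- A"]) auto
  moreover have "path_of_type w (B - A) Z" unfolding Z_def \<Theta>_def by (rule path)
  ultimately show ?thesis unfolding type_or_subpath_def by blast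
qed

lemma three_piece_angle_type:
  assumes K: "0 < K" and three: "three_piece_angle K T \<theta>"
    and z: "\<And>t. t \<in> {0..T} \<Longrightarrow> z t = curve_of_angle p \<theta> t"
  shows "(\<exists>X\<in>{LetterS, LetterC, LetterO}. type_or_subpath [LetterC, X, LetterC] T z) \<or>
    type_or_subpath [LetterS, LetterO, LetterS] T z"
proof -
  obtain c m\<^sub>1 m\<^sub>2 m\<^sub>3 s\<^sub>1 s\<^sub>2 A B where AB: "A \<le> 0" "T \<le> B" and ord: "A < s\<^sub>1" "s\<^sub>1 < s\<^sub>2" "s\<^sub>2 < B"
    and line: "\<forall>t\<in>{0..T}. \<theta> t = broken_line c m\<^sub>1 m\<^sub>2 m\<^sub>3 s\<^sub>1 s\<^sub>2 t"
    and cases: "m\<^sub>1 \<in> {K, - K} \<and> m\<^sub>3 \<in> {K, - K} \<and> K * (s\<^sub>1 - A) < 2 * pi \<and> K * (B - s\<^sub>2) < 2 * pi \<and>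
        (m\<^sub>2 = 0 \<or> m\<^sub>2 = - m\<^sub>1 \<and> m\<^sub>3 = m\<^sub>1 \<and> K * (s\<^sub>2 - s\<^sub>1) < 2 * pi \<or>
         m\<^sub>2 \<in> {K, - K} \<and> K * (s\<^sub>2 - s\<^sub>1) = 2 * pi) \<or>
      m\<^sub>1 = 0 \<and> m\<^sub>3 = 0 \<and> m\<^sub>2 \<in> {K, - K} \<and> K * (s\<^sub>2 - s\<^sub>1) = 2 * pi"
    using three unfolding three_piece_angle_def by blast
  note path = broken_line_path_of_type[OF K ord]
  note sub = broken_line_subpath[OF less_imp_le[OF ord(2)] AB line z]
  consider (CSC) "m\<^sub>1 \<in> {K, - K}" "m\<^sub>3 \<in> {K, - K}" "K * (s\<^sub>1 - A) < 2 * pi" "K * (B - s\<^sub>2) < 2 * pi" "m\<^sub>2 = 0"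
    | (CCC) "m\<^sub>1 \<in> {K, - K}" "m\<^sub>3 = m\<^sub>1" "K * (s\<^sub>1 - A) < 2 * pi" "K * (B - s\<^sub>2) < 2 * pi" "m\<^sub>2 = - m\<^sub>1"
      "K * (s\<^sub>2 - s\<^sub>1) < 2 * pi"
    | (COC) "m\<^sub>1 \<in> {K, - K}" "m\<^sub>3 \<in> {K, - K}" "K * (s\<^sub>1 - A) < 2 * pi" "K * (B - s\<^sub>2) < 2 * pi"
      "m\<^sub>2 \<in> {K, - K}" "K * (s\<^sub>2 - s\<^sub>1) = 2 * pi"
    | (SOS) "m\<^sub>1 = 0" "m\<^sub>3 = 0" "m\<^sub>2 \<in> {K, - K}" "K * (s\<^sub>2 - s\<^sub>1) = 2 * pi"
    using cases by blast
  then show ?thesis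
  proof cases
    case CSC
    have "type_or_subpath [LetterC, LetterS, LetterC] T z"
      by (intro sub path) (use CSC in auto)
    then show ?thesis by blast
  next
    case CCC
    have "type_or_subpath [LetterC, LetterC, LetterC] T z"
      by (intro sub path) (use CCC in auto)
    then show ?thesis by blast
  next
    case COC
    have "type_or_subpath [LetterC, LetterO, LetterC] T z"
      by (intro sub path) (use COC in auto)
    then show ?thesis by blast
  next
    case SOS
    have "type_or_subpath [LetterS, LetterO, LetterS] T z"
      by (intro sub path) (use SOS in auto)
    then show ?thesis by blast
  qed
qed

text \<open>The velocity of the circular motion has an explicit angle of slope \<open>\<sigma> / r\<close>, and two
  continuous angles of the same velocity differ by a constant.\<close>

lemma circle_piece_slope:
  assumes \<theta>: "continuous_on {0..T} \<theta>" and ab: "0 \<le> a" "a < b" "b \<le> T"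
    and circle: "circle_piece (curve_of_angle p \<theta>) \<sigma> r a b"
  shows "has_slope \<theta> (\<sigma> / r) a b"
proof -
  obtain q \<psi> where \<sigma>: "\<sigma> \<in> {1, -1}" and r: "0 < r"
    and z: "\<And>t. t \<in> {a..b} \<Longrightarrow> curve_of_angle p \<theta> t
      = q + r *\<^sub>R vector [cos (\<psi> + \<sigma> * (t - a) / r), sin (\<psi> + \<sigma> * (t - a) / r)]"
    using circle unfolding circle_piece_def by blast
  define g where "g t = \<psi> + \<sigma> * (t - a) / r + \<sigma> * (pi / 2)" for t
  have eq: "cis (\<theta> t) = cis (g t)" if t: "t \<in> {a<..<b}" for t
  proof -
    define x where "x = \<psi> + \<sigma> * (t - a) / r"
    have d1: "(curve_of_angle p \<theta> has_vector_derivative plane_of (cis (\<theta> t))) (at t)"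
      using t ab by (intro curve_of_angle_derivative[OF \<theta>]) auto
    have "((\<lambda>t. cos (\<psi> + \<sigma> * (t - a) / r)) has_real_derivative - sin x * (\<sigma> / r)) (at t)"
      "((\<lambda>t. sin (\<psi> + \<sigma> * (t - a) / r)) has_real_derivative cos x * (\<sigma> / r)) (at t)"
      unfolding x_def using r by (auto intro!: derivative_eq_intros)
    then have "((\<lambda>t. Complex (cos (\<psi> + \<sigma> * (t - a) / r)) (sin (\<psi> + \<sigma> * (t - a) / r))) has_vector_derivative
        Complex (- sin x * (\<sigma> / r)) (cos x * (\<sigma> / r))) (at t)"
      by (simp add: has_vector_derivative_complex_iff has_real_derivative_iff_has_vector_derivative)
    from bounded_linear.has_vector_derivative[OF bounded_linear_plane_of this]
    have "((\<lambda>t. q + r *\<^sub>R vector [cos (\<psi> + \<sigma> * (t - a) / r), sin (\<psi> + \<sigma> * (t - a) / r)])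
        has_vector_derivative r *\<^sub>R plane_of (Complex (- sin x * (\<sigma> / r)) (cos x * (\<sigma> / r)))) (at t)"
      unfolding plane_of_def by (auto intro!: derivative_eq_intros)
    then have "(curve_of_angle p \<theta> has_vector_derivative
        r *\<^sub>R plane_of (Complex (- sin x * (\<sigma> / r)) (cos x * (\<sigma> / r)))) (at t)"
      by (rule has_vector_derivative_transform_within_open[of _ _ _ "{a<..<b}"]) (use t z in auto)
    from vector_derivative_unique_at[OF d1 this]
    have "plane_of (cis (\<theta> t)) = plane_of (r *\<^sub>R Complex (- sin x * (\<sigma> / r)) (cos x * (\<sigma> / r)))"
      by (simp add: linear_simps[OF bounded_linear_plane_of])
    then have "cis (\<theta> t) = r *\<^sub>R Complex (- sin x * (\<sigma> / r)) (cos x * (\<sigma> / r))"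
      by (simp only: plane_of_inject)
    also have "\<dots> = cis (x + \<sigma> * (pi / 2))"
      using r \<sigma> by (auto simp: complex_eq_iff cos_add sin_add)
    finally show ?thesis by (simp add: g_def x_def)
  qed
  have diff: "\<theta> t - g t = \<theta> a - g a" if "t \<in> {a..b}" for t
  proof (rule cis_eq_imp_constant_difference[OF _ _ eq ab(2) that])
    show "continuous_on {a..b} \<theta>" using ab by (intro continuous_on_subset[OF \<theta>]) auto
    show "continuous_on {a..b} g" unfolding g_def using r by (intro continuous_intros) auto
  qed
  show ?thesis
    unfolding has_slope_def
  proof
    fix t assume "t \<in> {a..b}"
    from diff[OF this] show "\<theta> t = \<theta> a + \<sigma> / r * (t - a)" by (simp add: g_def)
  qed
qed

text \<open>An arc of radius \<open>r\<close> shows as the slope \<open>1 / r\<close> or \<open>-1 / r\<close> of the angle, and the only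
  nonzero slopes that a minimizer has are \<open>K\<close> and \<open>-K\<close>. This makes all radii equal, without
  reference to a decomposition of the curve.\<close>

lemma minimax_arc_radius:
  assumes \<theta>: "minimax_angle K T \<theta>" and z: "\<And>t. t \<in> {0..T} \<Longrightarrow> z t = curve_of_angle p \<theta> t"
    and arc: "arc_radius T z r"
  shows "r = 1 / K"
proof -
  obtain a b \<sigma> where ab: "0 \<le> a" "b \<le> T" "piece LetterC z \<sigma> r a b \<or> piece LetterO z \<sigma> r a b"
    using arc unfolding arc_radius_def by blast
  then have "a < b" and circle: "circle_piece z \<sigma> r a b" by auto
  obtain q \<psi> where "\<sigma> \<in> {1, -1}" "0 < r" and q: "\<forall>t\<in>{a..b}.
      z t = q + r *\<^sub>R vector [cos (\<psi> + \<sigma> * (t - a) / r), sin (\<psi> + \<sigma> * (t - a) / r)]"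
    using circle unfolding circle_piece_def by blast
  moreover have "\<forall>t\<in>{a..b}. curve_of_angle p \<theta> t
      = q + r *\<^sub>R vector [cos (\<psi> + \<sigma> * (t - a) / r), sin (\<psi> + \<sigma> * (t - a) / r)]"
  proof
    fix t assume t: "t \<in> {a..b}"
    then have "curve_of_angle p \<theta> t = z t" using z[of t] ab by simp
    then show "curve_of_angle p \<theta> t
        = q + r *\<^sub>R vector [cos (\<psi> + \<sigma> * (t - a) / r), sin (\<psi> + \<sigma> * (t - a) / r)]"
      using bspec[OF q t] by (rule trans)
  qed
  ultimately have "circle_piece (curve_of_angle p \<theta>) \<sigma> r a b"
    unfolding circle_piece_def by blast
  from circle_piece_slope[OF minimax_angleD(4)[OF \<theta>] ab(1) \<open>a < b\<close> ab(2) this]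
  have "\<sigma> / r \<in> {0, K, - K}" by (rule minimax_angle_slope_values[OF \<theta> ab(1) \<open>a < b\<close> ab(2)])
  moreover define i where "i = 1 / r"
  ultimately have "\<sigma> * i \<in> {0, K, - K}" by simp
  moreover have "\<sigma> \<in> {1, -1}" "0 < r" using circle by (auto simp: circle_piece_def)
  moreover from this have "0 < i" by (simp add: i_def)
  ultimately have "i = K" using minimax_angleD(2)[OF \<theta>] by auto
  moreover have "r = 1 / i" by (simp add: i_def)
  ultimately show ?thesis by simp
qed

theorem theorem21:
  fixes z0 zf v0 vf :: "real ^ 2" and tf :: real and z :: "real \<Rightarrow> real ^ 2"
  assumes "norm v0 = 1" and "norm vf = 1" and "tf > 0" and "tf > norm (z0 - zf)"
    and "solves_P z0 v0 zf vf tf z"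
  shows "((\<exists>X \<in> {LetterS, LetterC, LetterO}. type_or_subpath [LetterC, X, LetterC] tf z)
           \<or> type_or_subpath [LetterS, LetterO, LetterS] tf z)
         \<and> (\<forall>r r'. arc_radius tf z r \<longrightarrow> arc_radius tf z r' \<longrightarrow> r = r')"
proof -
  obtain K \<theta> where \<theta>: "minimax_angle K tf \<theta>" and z: "\<And>t. t \<in> {0..tf} \<Longrightarrow> z t = curve_of_angle z0 \<theta> t"
    using solution_has_minimax_angle[OF assms(3-5)] by blast
  have "three_piece_angle K tf \<theta>" by (rule minimax_angle_three_piece[OF \<theta>])
  from three_piece_angle_type[OF minimax_angleD(2)[OF \<theta>] this z]
  show ?thesis using minimax_arc_radius[OF \<theta> z] by auto
qed

end
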